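(* There exist functions $c, C : (0,1)\times(0,1)\to(0,\infty)$ such that the following holds for all $\epsilon,\gamma\in(0,1)$. Given $N\in\mathbb{N}$, assume that we have at our disposal a sequence of (independent, uniform) random bits of length $\max\{N^\gamma, C(\epsilon,\gamma)\}\,\log\big(N/(\epsilon\gamma)\big)$. Then, in deterministic time polynomial in $N$ (with $\epsilon,\gamma$ regarded as constants), we can generate from these bits numbers $M>0$ and $m\in\mathbb{N}$ with $m\ge c(\epsilon,\gamma)N$, and (a basis of) an $m$-dimensional linear subspace $E$ of $\ell_1^N$, such that with probability greater than $98\%$ (over the random bits) $$\forall x\in E,\quad (1-\epsilon)\,M\,\|x\|_2\le \|x\|_1\le (1+\epsilon)\,M\,\|x\|_2 .$$
   Context: $\ell_1^N$ denotes $\mathbb{R}^N$ with the norm $\|x\|_1=\sum_{i=1}^N|x_i|$, and $\|x\|_2=(\sum_{i=1}^N x_i^2)^{1/2}$. A subspace is "generated" when the algorithm outputs a basis of it. The algorithm is deterministic apart from its use of the supplied random bits as input. *)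

theory Defs
  imports
    "HOL-Probability.Probability"
    "Jordan_Normal_Form.VS_Connect"
begin

section \<open>Deterministic time\<close>

text \<open>
  The machine model is a random access machine over the integers with unit cost and with addition
  and subtraction, but not multiplication, as arithmetic instructions, in the form of a structured
  programming language. Within \<open>t\<close> steps such a machine only forms numbers of \<open>O(t + n)\<close> bits,
  \<open>n\<close> being the bit length of the numbers in the input, so that polynomial time agrees with
  polynomial time on a Turing machine (Cook and Reckhow, Time bounded random access machines, 1973).
  The memory consists of named arrays indexed by integers; index \<open>0\<close> serves for scalar variables.
\<close>

type_synonym memory = "string \<Rightarrow> int \<Rightarrow> int"

datatype expr = Lit int | Cell string expr | Add expr expr | Sub expr expr

datatype program =
    Skip
  | Assign string expr expr
  | Seq program program
  | Cond expr program program
  | While expr program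

fun eval_expr :: "expr \<Rightarrow> memory \<Rightarrow> int" where
  "eval_expr (Lit k) s = k"
| "eval_expr (Cell a e) s = s a (eval_expr e s)"
| "eval_expr (Add e f) s = eval_expr e s + eval_expr f s"
| "eval_expr (Sub e f) s = eval_expr e s - eval_expr f s"

fun cost :: "expr \<Rightarrow> nat" where
  "cost (Lit k) = 1"
| "cost (Cell a e) = 1 + cost e"
| "cost (Add e f) = 1 + cost e + cost f"
| "cost (Sub e f) = 1 + cost e + cost f"

text \<open>
  \<open>exec P s t s'\<close>: started in memory \<open>s\<close>, the program \<open>P\<close> halts after exactly \<open>t\<close> steps in memory
  \<open>s'\<close>. The tests of \<open>Cond\<close> and \<open>While\<close> ask whether the value of the expression is positive.
\<close>

inductive exec :: "program \<Rightarrow> memory \<Rightarrow> nat \<Rightarrow> memory \<Rightarrow> bool" where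
  exec_Skip: "exec Skip s 1 s"
| exec_Assign:
    "exec (Assign a i e) s (1 + cost i + cost e)
       (s(a := (s a)(eval_expr i s := eval_expr e s)))"
| exec_Seq: "exec P s t s' \<Longrightarrow> exec Q s' u s'' \<Longrightarrow> exec (Seq P Q) s (t + u) s''"
| exec_CondT: "eval_expr b s > 0 \<Longrightarrow> exec P s t s' \<Longrightarrow> exec (Cond b P Q) s (1 + cost b + t) s'"
| exec_CondF: "\<not> eval_expr b s > 0 \<Longrightarrow> exec Q s t s' \<Longrightarrow> exec (Cond b P Q) s (1 + cost b + t) s'"
| exec_WhileF: "\<not> eval_expr b s > 0 \<Longrightarrow> exec (While b P) s (1 + cost b) s"
| exec_WhileT:
    "eval_expr b s > 0 \<Longrightarrow> exec P s t s' \<Longrightarrow> exec (While b P) s' u s'' \<Longrightarrow>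
     exec (While b P) s (1 + cost b + t + u) s''"

lemma exec_deterministic:
  assumes "exec P s t s'" and "exec P s u s''"
  shows "u = t \<and> s'' = s'"
  using assms
proof (induction arbitrary: u s'' rule: exec.induct)
  case (exec_Skip s)
  then show ?case by cases auto
next
  case (exec_Assign a i e s)
  then show ?case by cases auto
next
  case (exec_Seq P s t s1 Q v s2)
  from exec_Seq.prems show ?case
    by cases (use exec_Seq.IH in blast)
next
  case (exec_CondT b s P t s1 Q)
  from exec_CondT.prems show ?case
    by cases (use exec_CondT.hyps exec_CondT.IH in blast)+
next
  case (exec_CondF b s Q t s1 P)
  from exec_CondF.prems show ?case
    by cases (use exec_CondF.hyps exec_CondF.IH in blast)+
next
  case (exec_WhileF b s P)
  from exec_WhileF.prems show ?case
    by cases (use exec_WhileF.hyps in auto)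
next
  case (exec_WhileT b s P t s1 v s2)
  from exec_WhileT.prems show ?case
    by cases (use exec_WhileT.hyps exec_WhileT.IH in blast)+
qed

text \<open>
  The input consists of the number \<open>N\<close> and of the random bits together with their number.
\<close>

definition input_memory :: "nat \<Rightarrow> bool list \<Rightarrow> memory" where
  "input_memory N bs = (\<lambda>a i.
     if a = ''N'' \<and> i = 0 then int N
     else if a = ''length'' \<and> i = 0 then int (length bs)
     else if a = ''bits'' \<and> 0 \<le> i \<and> i < int (length bs) then of_bool (bs ! nat i)
     else 0)"

text \<open>
  The output consists of a rational number \<open>M\<close>, of \<open>m\<close>, and of \<open>m\<close> vectors with \<open>N\<close> rational
  coordinates, in row-major order. Rational numbers are written as a numerator and a positive
  denominator.
\<close>

definition reads_rat :: "memory \<Rightarrow> string \<Rightarrow> string \<Rightarrow> int \<Rightarrow> real \<Rightarrow> bool" where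
  "reads_rat s num den i x \<longleftrightarrow> s den i > 0 \<and> x = of_int (s num i) / of_int (s den i)"

definition reads_output :: "nat \<Rightarrow> memory \<Rightarrow> real \<Rightarrow> nat \<Rightarrow> real vec list \<Rightarrow> bool" where
  "reads_output N s M m vs \<longleftrightarrow>
     reads_rat s ''M_num'' ''M_den'' 0 M \<and>
     s ''m'' 0 = int m \<and>
     length vs = m \<and>
     (\<forall>j<m. vs ! j \<in> carrier_vec N \<and>
        (\<forall>i<N. reads_rat s ''num'' ''den'' (int (j * N + i)) (vec_index (vs ! j) i)))"


section \<open>Subspaces of $\ell_1^N$\<close>

abbreviation real_space :: "nat \<Rightarrow> (real, real vec) module" where
  "real_space N \<equiv> module_vec TYPE(real) N"

abbreviation subspace_of :: "nat \<Rightarrow> real vec set \<Rightarrow> bool" where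
  "subspace_of N E \<equiv> VectorSpace.subspace class_ring E (real_space N)"

abbreviation restricted_space :: "nat \<Rightarrow> real vec set \<Rightarrow> (real, real vec) module" where
  "restricted_space N E \<equiv> (real_space N)\<lparr>carrier := E\<rparr>"

definition dim_subspace :: "nat \<Rightarrow> real vec set \<Rightarrow> nat" where
  "dim_subspace N E = vectorspace.dim class_ring (restricted_space N E)"

definition is_basis_of :: "nat \<Rightarrow> real vec list \<Rightarrow> real vec set \<Rightarrow> bool" where
  "is_basis_of N vs E \<longleftrightarrow>
     distinct vs \<and> vectorspace.basis class_ring (restricted_space N E) (set vs)"

definition norm1 :: "real vec \<Rightarrow> real" where
  "norm1 x = (\<Sum>i<dim_vec x. \<bar>vec_index x i\<bar>)"

definition norm2 :: "real vec \<Rightarrow> real" where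
  "norm2 x = sqrt (\<Sum>i<dim_vec x. (vec_index x i)\<^sup>2)"


section \<open>Generating a subspace from random bits\<close>

text \<open>
  On input \<open>N\<close> and \<open>bs\<close>, the program \<open>A\<close> generates \<open>M\<close>, \<open>m\<close> and a basis of the \<open>m\<close>-dimensional
  subspace \<open>E\<close> within \<open>T\<close> steps.
\<close>

definition generates ::
  "program \<Rightarrow> nat \<Rightarrow> nat \<Rightarrow> bool list \<Rightarrow> real \<Rightarrow> nat \<Rightarrow> real vec set \<Rightarrow> bool" where
  "generates A T N bs M m E \<longleftrightarrow>
     subspace_of N E \<and> dim_subspace N E = m \<and>
     (\<exists>t s vs. exec A (input_memory N bs) t s \<and> t \<le> T \<and>
        reads_output N s M m vs \<and> is_basis_of N vs E)"

definition bit_strings :: "nat \<Rightarrow> bool list set" where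
  "bit_strings L = {bs. length bs = L}"

text \<open>The prescribed length of the bit sequence is a real number; it is rounded down.\<close>

definition num_bits :: "real \<Rightarrow> real \<Rightarrow> real \<Rightarrow> nat \<Rightarrow> nat" where
  "num_bits C \<epsilon> \<gamma> N = nat \<lfloor>max (real N powr \<gamma>) C * ln (real N / (\<epsilon> * \<gamma>))\<rfloor>"

end

theory Submission
  imports Defs
begin

text \<open>
  Consider norms of block form: \<open>x\<close> has blocks \<open>x\<^sub>i\<close>, \<open>i < n\<close>, of constant size \<open>B\<close>, and its
  \<open>\<ell>\<^sub>1(\<ell>\<^sub>2)\<close> norm is the sum of the Euclidean norms of the blocks. By Cauchy--Schwarz it is at most
  \<open>\<surd>n\<close> times the Euclidean norm, so a subspace is nearly Euclidean as soon as the reverse estimate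
  holds up to a factor \<open>1 - \<eta>\<close>. For large \<open>B\<close> the column space of a random sign matrix has this
  property, in dimension proportional to \<open>n\<close>; appending a copy of the identity matrix makes the
  columns independent for all outcomes. By Minkowski's inequality the lower estimate is
  multiplicative under tensor products, so that the \<open>r\<close>-fold tensor power of one random matrix with
  about \<open>N\<^bsup>2/r\<^esup>\<close> entries gives a subspace of proportional dimension in about \<open>N\<close> coordinates.
  The blocks of constant size \<open>B\<^sup>r\<close> are finally embedded into \<open>\<ell>\<^sub>1\<close> by a fixed integer matrix, which
  is hard-wired into the program.
\<close>


section \<open>A language of integer expressions\<close>

text \<open>The obstacle is the upper estimate. Cauchy-Schwarz is the upper bound that survives
  every tensor power, but a random subspace with scalar coordinates typically stays a factor
  \<open>sqrt (2 / pi)\<close> below it, and this gap would be raised to a power. Blocks close it: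
  the norm of a block of B independent signed sums concentrates, so the blocks of a vector in the
  column space have nearly equal norms and Cauchy-Schwarz is nearly sharp. The Gaussian factor then
  enters only once, in the embedding of the blocks.

  A matrix with k columns takes a multiple of k^2 bits, where k is about N^(1/r); with r \<ge>
  4/\<gamma> this leaves room for the constant. The union bound over a net in dimension k is
  affordable because the number of blocks is a large multiple of k.

  The machine can only write rational numbers. The basis is integral, r is even so that the square
  root of the number of blocks is an integer, and the ratio of the embedding constants is replaced
  by a nearby rational.\<close>

datatype iexp =
    Const int
  | Var nat
  | Size
  | Bit iexp
  | Plus iexp iexp
  | Minus iexp iexp
  | IfPos iexp iexp iexp
  | Sigma nat iexp

text \<open>\<open>w\<close> stands for the contents of the array of bits and \<open>r\<close> for
  those of the loop variables. Every sum has exactly N terms, so the nesting alone controls the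
  running time.\<close>

fun ieval :: "iexp \<Rightarrow> nat \<Rightarrow> (int \<Rightarrow> int) \<Rightarrow> (int \<Rightarrow> int) \<Rightarrow> int" where
  "ieval (Const k) N w r = k"
| "ieval (Var v) N w r = r (int v)"
| "ieval Size N w r = int N"
| "ieval (Bit a) N w r = w (ieval a N w r)"
| "ieval (Plus a b) N w r = ieval a N w r + ieval b N w r"
| "ieval (Minus a b) N w r = ieval a N w r - ieval b N w r"
| "ieval (IfPos a b c) N w r = (if ieval a N w r > 0 then ieval b N w r else ieval c N w r)"
| "ieval (Sigma v a) N w r = (\<Sum>i<N. ieval a N w (r(int v := int i)))"

abbreviation register :: "nat \<Rightarrow> expr" where
  "register d \<equiv> Cell ''t'' (Lit (int d))"

abbreviation set_register :: "nat \<Rightarrow> expr \<Rightarrow> program" where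
  "set_register d \<equiv> Assign ''t'' (Lit (int d))"

abbreviation loop_var :: "nat \<Rightarrow> expr" where
  "loop_var v \<equiv> Cell ''v'' (Lit (int v))"

abbreviation set_loop_var :: "nat \<Rightarrow> expr \<Rightarrow> program" where
  "set_loop_var v \<equiv> Assign ''v'' (Lit (int v))"

abbreviation below_size :: "nat \<Rightarrow> expr" where
  "below_size v \<equiv> Sub (Cell ''N'' (Lit 0)) (loop_var v)"

abbreviation step_loop_var :: "nat \<Rightarrow> program" where
  "step_loop_var v \<equiv> set_loop_var v (Add (loop_var v) (Lit 1))"

text \<open>
  The value of the expression ends up in register \<open>d\<close>; the registers below \<open>d\<close> keep their contents.
\<close>

fun compile :: "iexp \<Rightarrow> nat \<Rightarrow> program" where
  "compile (Const k) d = set_register d (Lit k)"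
| "compile (Var v) d = set_register d (loop_var v)"
| "compile Size d = set_register d (Cell ''N'' (Lit 0))"
| "compile (Bit a) d = Seq (compile a d) (set_register d (Cell ''bits'' (register d)))"
| "compile (Plus a b) d = Seq (compile a d) (Seq (compile b (Suc d))
     (set_register d (Add (register d) (register (Suc d)))))"
| "compile (Minus a b) d = Seq (compile a d) (Seq (compile b (Suc d))
     (set_register d (Sub (register d) (register (Suc d)))))"
| "compile (IfPos a b c) d = Seq (compile a d) (Cond (register d) (compile b d) (compile c d))"
| "compile (Sigma v a) d =
     Seq (set_register d (Lit 0)) (Seq (set_register (Suc d) (loop_var v))
     (Seq (set_loop_var v (Lit 0))
     (Seq (While (below_size v)
       (Seq (compile a (Suc (Suc d)))
       (Seq (set_register d (Add (register d) (register (Suc (Suc d)))))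
         (step_loop_var v))))
     (set_loop_var v (register (Suc d))))))"

text \<open>The constants are generous bounds for the instructions around the recursive calls.
  \<open>IfPos\<close> adds the times of both branches, because their maximum need not be a
  polynomial.\<close>

fun time_poly :: "iexp \<Rightarrow> nat poly" where
  "time_poly (Const k) = [:3:]"
| "time_poly (Var v) = [:4:]"
| "time_poly Size = [:4:]"
| "time_poly (Bit a) = time_poly a + [:6:]"
| "time_poly (Plus a b) = time_poly a + time_poly b + [:8:]"
| "time_poly (Minus a b) = time_poly a + time_poly b + [:8:]"
| "time_poly (IfPos a b c) = time_poly a + time_poly b + time_poly c + [:4:]"
| "time_poly (Sigma v a) = [:0, 1:] * (time_poly a + [:22:]) + [:30:]"

section \<open>Time-bounded runs and correctness of the compiler\<close>

definition runs :: "program \<Rightarrow> memory \<Rightarrow> nat \<Rightarrow> memory \<Rightarrow> bool" where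
  "runs P s T s' \<longleftrightarrow> (\<exists>t\<le>T. exec P s t s')"

lemma runs_Seq: "runs P s T s' \<Longrightarrow> runs Q s' U s'' \<Longrightarrow> T + U \<le> V \<Longrightarrow> runs (Seq P Q) s V s''"
  unfolding runs_def by (meson add_mono exec_Seq le_trans)

lemma runs_Assign:
  "s' = s(a := (s a)(eval_expr i s := eval_expr e s)) \<Longrightarrow> 1 + cost i + cost e \<le> T \<Longrightarrow>
   runs (Assign a i e) s T s'"
  unfolding runs_def using exec_Assign by blast

lemma runs_CondT:
  "eval_expr b s > 0 \<Longrightarrow> runs P s T s' \<Longrightarrow> 1 + cost b + T \<le> V \<Longrightarrow> runs (Cond b P Q) s V s'"
  unfolding runs_def by (meson exec_CondT add_left_mono le_trans)

lemma runs_CondF: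
  "\<not> eval_expr b s > 0 \<Longrightarrow> runs Q s T s' \<Longrightarrow> 1 + cost b + T \<le> V \<Longrightarrow> runs (Cond b P Q) s V s'"
  unfolding runs_def by (meson exec_CondF add_left_mono le_trans)

text \<open>The invariant carries the number of completed rounds, which yields termination and the
  time bound together.\<close>

lemma runs_While:
  assumes step: "\<And>i s. i < n \<Longrightarrow> I i s \<Longrightarrow> eval_expr b s > 0 \<and> (\<exists>s'. runs P s T s' \<and> I (Suc i) s')"
    and stop: "\<And>s. I n s \<Longrightarrow> \<not> eval_expr b s > 0"
    and "I 0 s"
  shows "\<exists>s'. runs (While b P) s (n * (1 + cost b + T) + (1 + cost b)) s' \<and> I n s'"
proof -
  \<comment> \<open>The induction is on the number \<open>j\<close> of rounds left, since
    \<open>exec_WhileT\<close> peels off the first round.\<close>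
  have "\<exists>s'. runs (While b P) s (j * (1 + cost b + T) + (1 + cost b)) s' \<and> I n s'"
    if "I i s" "i + j = n" for i j s
    using that
  proof (induction j arbitrary: i s)
    case 0
    then show ?case
      using stop[of s] exec_WhileF[of b s P] unfolding runs_def by auto
  next
    case (Suc j)
    then obtain s' where s': "eval_expr b s > 0" "runs P s T s'" "I (Suc i) s'"
      using step[of i s] by auto
    then obtain s'' where s'': "runs (While b P) s' (j * (1 + cost b + T) + (1 + cost b)) s''" "I n s''"
      using Suc.IH[of "Suc i" s'] Suc.prems by auto
    obtain t where t: "t \<le> T" "exec P s t s'" using s'(2) unfolding runs_def by auto
    obtain u where u: "u \<le> j * (1 + cost b + T) + (1 + cost b)" "exec (While b P) s' u s''"
      using s''(1) unfolding runs_def by auto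
    have "exec (While b P) s (1 + cost b + t + u) s''"
      using exec_WhileT[OF s'(1) t(2) u(2)] .
    moreover have "1 + cost b + t + u \<le> Suc j * (1 + cost b + T) + (1 + cost b)"
      using t(1) u(1) by simp
    ultimately show ?case using s''(2) unfolding runs_def by blast
  qed
  from this[OF assms(3), of n] show ?thesis by simp
qed

text \<open>A frame condition: only registers from \<open>d\<close> on may change. The first operand
  can therefore wait in register \<open>d\<close> while the second is computed in
  \<open>Suc d\<close>, and the loop variables are as before.\<close>

definition evaluates_to :: "memory \<Rightarrow> nat \<Rightarrow> int \<Rightarrow> memory \<Rightarrow> bool" where
  "evaluates_to s d x s' \<longleftrightarrow>
     (\<forall>a. a \<noteq> ''t'' \<longrightarrow> s' a = s a) \<and> (\<forall>i<int d. s' ''t'' i = s ''t'' i) \<and> s' ''t'' (int d) = x"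

lemma compile_correct:
  assumes "s ''N'' 0 = int N"
  shows "\<exists>s'. runs (compile e d) s (poly (time_poly e) N) s' \<and>
    evaluates_to s d (ieval e N (s ''bits'') (s ''v'')) s'"
  using assms
proof (induction e arbitrary: d s)
  case (Const k)
  show ?case
    by (rule exI, rule conjI, simp, rule runs_Assign[OF refl]) (auto simp: evaluates_to_def)
next
  case (Var v)
  show ?case
    by (rule exI, rule conjI, simp, rule runs_Assign[OF refl]) (auto simp: evaluates_to_def)
next
  case Size
  show ?case
    by (rule exI, rule conjI, simp, rule runs_Assign[OF refl])
      (use Size in \<open>auto simp: evaluates_to_def\<close>)
next
  case (Bit a)
  from Bit.IH[of s d, OF Bit.prems] obtain s1 where
    1: "runs (compile a d) s (poly (time_poly a) N) s1"
       "evaluates_to s d (ieval a N (s ''bits'') (s ''v'')) s1" by blast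
  show ?case
    by (rule exI, rule conjI, simp, rule runs_Seq[OF 1(1)], rule runs_Assign[OF refl order_refl])
      (use 1(2) in \<open>auto simp: evaluates_to_def\<close>)
next
  case (Plus a b)
  from Plus.IH(1)[of s d, OF Plus.prems] obtain s1 where
    1: "runs (compile a d) s (poly (time_poly a) N) s1"
       "evaluates_to s d (ieval a N (s ''bits'') (s ''v'')) s1" by blast
  from 1(2) Plus.prems have "s1 ''N'' 0 = int N" by (auto simp: evaluates_to_def)
  from Plus.IH(2)[of s1 "Suc d", OF this] obtain s2 where
    2: "runs (compile b (Suc d)) s1 (poly (time_poly b) N) s2"
       "evaluates_to s1 (Suc d) (ieval b N (s1 ''bits'') (s1 ''v'')) s2" by blast
  show ?case
    by (rule exI, rule conjI, simp, rule runs_Seq[OF 1(1)], rule runs_Seq[OF 2(1)],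
        rule runs_Assign[OF refl order_refl], rule order_refl)
      (use 1(2) 2(2) in \<open>auto simp: evaluates_to_def\<close>)
next
  case (Minus a b)
  from Minus.IH(1)[of s d, OF Minus.prems] obtain s1 where
    1: "runs (compile a d) s (poly (time_poly a) N) s1"
       "evaluates_to s d (ieval a N (s ''bits'') (s ''v'')) s1" by blast
  from 1(2) Minus.prems have "s1 ''N'' 0 = int N" by (auto simp: evaluates_to_def)
  from Minus.IH(2)[of s1 "Suc d", OF this] obtain s2 where
    2: "runs (compile b (Suc d)) s1 (poly (time_poly b) N) s2"
       "evaluates_to s1 (Suc d) (ieval b N (s1 ''bits'') (s1 ''v'')) s2" by blast
  show ?case
    by (rule exI, rule conjI, simp, rule runs_Seq[OF 1(1)], rule runs_Seq[OF 2(1)],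
        rule runs_Assign[OF refl order_refl], rule order_refl)
      (use 1(2) 2(2) in \<open>auto simp: evaluates_to_def\<close>)
next
  case (IfPos a b c)
  from IfPos.IH(1)[of s d, OF IfPos.prems] obtain s1 where
    1: "runs (compile a d) s (poly (time_poly a) N) s1"
       "evaluates_to s d (ieval a N (s ''bits'') (s ''v'')) s1" by blast
  from 1(2) IfPos.prems have s1: "s1 ''N'' 0 = int N" by (auto simp: evaluates_to_def)
  from IfPos.IH(2)[of s1 d, OF s1] obtain s2 where
    2: "runs (compile b d) s1 (poly (time_poly b) N) s2"
       "evaluates_to s1 d (ieval b N (s1 ''bits'') (s1 ''v'')) s2" by blast
  from IfPos.IH(3)[of s1 d, OF s1] obtain s3 where
    3: "runs (compile c d) s1 (poly (time_poly c) N) s3"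
       "evaluates_to s1 d (ieval c N (s1 ''bits'') (s1 ''v'')) s3" by blast
  have s1d: "s1 ''t'' (int d) = ieval a N (s ''bits'') (s ''v'')"
    using 1(2) by (simp add: evaluates_to_def)
  show ?case
  proof (cases "ieval a N (s ''bits'') (s ''v'') > 0")
    case True
    have "runs (compile (IfPos a b c) d) s (poly (time_poly (IfPos a b c)) N) s2"
      unfolding compile.simps
      by (rule runs_Seq[OF 1(1)], rule runs_CondT[OF _ 2(1) order_refl]) (use True s1d in auto)
    then show ?thesis
      using True 1(2) 2(2) by (intro exI[of _ s2]) (auto simp: evaluates_to_def)
  next
    case False
    have "runs (compile (IfPos a b c) d) s (poly (time_poly (IfPos a b c)) N) s3"
      unfolding compile.simps
      by (rule runs_Seq[OF 1(1)], rule runs_CondF[OF _ 3(1) order_refl]) (use False s1d in auto)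
    then show ?thesis
      using False 1(2) 3(2) by (intro exI[of _ s3]) (auto simp: evaluates_to_def)
  qed
next
  case (Sigma v a)
  define w where "w = s ''bits''"
  define r where "r = s ''v''"
  \<comment> \<open>After \<open>i\<close> rounds register \<open>d\<close> holds the partial sum
    and register \<open>Suc d\<close> the outer value of variable \<open>v\<close>, which is
    restored at the end; the body works from \<open>Suc (Suc d)\<close> on and leaves both
    alone.\<close>
  define I where "I = (\<lambda>i s'. (\<forall>a. a \<noteq> ''t'' \<longrightarrow> a \<noteq> ''v'' \<longrightarrow> s' a = s a) \<and> s' ''v'' = r(int v := int i) \<and>
     (\<forall>j<int d. s' ''t'' j = s ''t'' j) \<and> s' ''t'' (int (Suc d)) = r (int v) \<and>
     s' ''t'' (int d) = (\<Sum>i<i. ieval a N w (r(int v := int i))))"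
  define s1 where "s1 = s(''t'' := (s ''t'')(int d := 0))"
  define s2 where "s2 = s1(''t'' := (s1 ''t'')(int (Suc d) := r (int v)))"
  define s3 where "s3 = s2(''v'' := r(int v := 0))"
  let ?body = "Seq (compile a (Suc (Suc d)))
       (Seq (set_register d (Add (register d) (register (Suc (Suc d))))) (step_loop_var v))"
  have r1: "runs (set_register d (Lit 0)) s 3 s1"
    by (rule runs_Assign) (auto simp: s1_def)
  have r2: "runs (set_register (Suc d) (loop_var v)) s1 4 s2"
    by (rule runs_Assign) (auto simp: s1_def s2_def r_def)
  have r3: "runs (set_loop_var v (Lit 0)) s2 3 s3"
    by (rule runs_Assign) (auto simp: s1_def s2_def s3_def r_def)
  have I0: "I 0 s3"
    by (auto simp: I_def s1_def s2_def s3_def)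
  have "\<exists>s'. runs (While (below_size v) ?body) s3
      (N * (1 + cost (below_size v) + (poly (time_poly a) N + 13)) + (1 + cost (below_size v))) s' \<and> I N s'"
  proof (rule runs_While[where I = I])
    fix i s' assume i: "i < N" and Ii: "I i s'"
    have N': "s' ''N'' 0 = int N" and vv: "s' ''v'' = r(int v := int i)" and bb: "s' ''bits'' = w"
      using Ii Sigma.prems by (auto simp: I_def w_def)
    from Sigma.IH[of s' "Suc (Suc d)", OF N'] obtain t1 where
      t1: "runs (compile a (Suc (Suc d))) s' (poly (time_poly a) N) t1"
        "evaluates_to s' (Suc (Suc d)) (ieval a N w (r(int v := int i))) t1"
      unfolding vv bb by blast
    define t2 where "t2 = t1(''t'' := (t1 ''t'')(int d := t1 ''t'' (int d) + t1 ''t'' (int (Suc (Suc d)))))"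
    define t3 where "t3 = t2(''v'' := (t2 ''v'')(int v := t2 ''v'' (int v) + 1))"
    have "runs (set_register d (Add (register d) (register (Suc (Suc d))))) t1 7 t2"
      by (rule runs_Assign) (auto simp: t2_def)
    moreover have "runs (step_loop_var v) t2 6 t3"
      by (rule runs_Assign) (auto simp: t3_def)
    ultimately have "runs ?body s' (poly (time_poly a) N + 13) t3"
      by (intro runs_Seq[OF t1(1)] runs_Seq[where T = 7 and U = 6]) auto
    moreover have "I (Suc i) t3"
      using Ii t1(2) by (auto simp: I_def t3_def t2_def evaluates_to_def fun_eq_iff)
    ultimately show "eval_expr (below_size v) s' > 0 \<and>
       (\<exists>s''. runs ?body s' (poly (time_poly a) N + 13) s'' \<and> I (Suc i) s'')"
      using i N' vv by auto
  next
    fix s' assume "I N s'"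
    then show "\<not> eval_expr (below_size v) s' > 0"
      using Sigma.prems by (auto simp: I_def)
  next
    show "I 0 s3" by (rule I0)
  qed
  then obtain s4 where r4: "runs (While (below_size v) ?body) s3
      (N * (1 + cost (below_size v) + (poly (time_poly a) N + 13)) + (1 + cost (below_size v))) s4"
    and I4: "I N s4" by blast
  define s5 where "s5 = s4(''v'' := (s4 ''v'')(int v := s4 ''t'' (int (Suc d))))"
  have r5: "runs (set_loop_var v (register (Suc d))) s4 4 s5"
    by (rule runs_Assign) (auto simp: s5_def)
  have "runs (compile (Sigma v a) d) s (poly (time_poly (Sigma v a)) N) s5"
    unfolding compile.simps
    by (rule runs_Seq[OF r1], rule runs_Seq[OF r2], rule runs_Seq[OF r3], rule runs_Seq[OF r4 r5])
      (rule order_refl, rule order_refl, rule order_refl, simp add: algebra_simps)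
  moreover have "evaluates_to s d (ieval (Sigma v a) N (s ''bits'') (s ''v'')) s5"
    using I4 by (auto simp: I_def s5_def evaluates_to_def w_def r_def)
  ultimately show ?case by blast
qed

section \<open>Arithmetic by bounded counting\<close>

fun fresh :: "iexp \<Rightarrow> nat" where
  "fresh (Const k) = 0"
| "fresh (Var v) = Suc v"
| "fresh Size = 0"
| "fresh (Bit a) = fresh a"
| "fresh (Plus a b) = max (fresh a) (fresh b)"
| "fresh (Minus a b) = max (fresh a) (fresh b)"
| "fresh (IfPos a b c) = max (fresh a) (max (fresh b) (fresh c))"
| "fresh (Sigma v a) = max (Suc v) (fresh a)"

lemma ieval_cong:
  "(\<And>v. v < fresh a \<Longrightarrow> r (int v) = r' (int v)) \<Longrightarrow> ieval a N w r = ieval a N w r'"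
proof (induction a arbitrary: r r')
  case (Sigma v a)
  show ?case
    unfolding ieval.simps
    by (rule sum.cong[OF refl], rule Sigma.IH) (use Sigma.prems in auto)
next
  case (Bit a)
  have "ieval a N w r = ieval a N w r'" by (rule Bit.IH) (use Bit.prems in auto)
  then show ?case by simp
next
  case (Plus a b)
  have "ieval a N w r = ieval a N w r'" "ieval b N w r = ieval b N w r'"
    by (rule Plus.IH; use Plus.prems in auto)+
  then show ?case by simp
next
  case (Minus a b)
  have "ieval a N w r = ieval a N w r'" "ieval b N w r = ieval b N w r'"
    by (rule Minus.IH; use Minus.prems in auto)+
  then show ?case by simp
next
  case (IfPos a b c)
  have "ieval a N w r = ieval a N w r'" "ieval b N w r = ieval b N w r'"
    "ieval c N w r = ieval c N w r'"
    by (rule IfPos.IH; use IfPos.prems in auto)+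
  then show ?case by simp
qed auto

text \<open>Lets a new loop be wrapped around given expressions without capturing their
  variables.\<close>

lemma ieval_fresh: "fresh a \<le> v \<Longrightarrow> ieval a N w (r(int v := x)) = ieval a N w r"
  by (rule ieval_cong) auto

text \<open>Counting the indices below a threshold recovers the threshold. Product, quotient and
  root are all computed this way, which forces the counted quantity to be at most N.\<close>

lemma sum_threshold: "(\<Sum>i<N. if P i then x else (0::int)) = int k * x"
  if "\<And>i. i < N \<Longrightarrow> P i \<longleftrightarrow> i < k" "k \<le> N"
proof -
  have "(\<Sum>i<N. if P i then x else 0) = (\<Sum>i<N. if i < k then x else 0)"
    using that by (intro sum.cong) auto
  also have "\<dots> = (\<Sum>i\<in>{..<N} \<inter> {i. i < k}. x)"
    by (subst sum.inter_restrict) auto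
  also have "{..<N} \<inter> {i. i < k} = {..<k}" using that(2) by auto
  finally show ?thesis by simp
qed

text \<open>Adds \<open>b\<close> once for every index below \<open>a\<close>. So only the first
  factor has to lie between 0 and N; the second may be large or negative.\<close>

definition mulE :: "iexp \<Rightarrow> iexp \<Rightarrow> iexp" where
  "mulE a b = (let v = max (fresh a) (fresh b) in Sigma v (IfPos (Minus a (Var v)) b (Const 0)))"

lemma ieval_mulE:
  assumes "0 \<le> ieval a N w r" "ieval a N w r \<le> int N"
  shows "ieval (mulE a b) N w r = ieval a N w r * ieval b N w r"
proof -
  let ?a = "ieval a N w r"
  have "ieval (mulE a b) N w r = (\<Sum>i<N. if ?a - int i > 0 then ieval b N w r else 0)"
    unfolding mulE_def Let_def by (simp add: ieval_fresh cong: if_cong)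
  also have "\<dots> = int (nat ?a) * ieval b N w r"
    by (rule sum_threshold) (use assms in auto)
  finally show ?thesis using assms by simp
qed

text \<open>Counts the i with (i + 1) b \<le> a; the added 1 turns the strict test of the language
  into \<le>. The factor i + 1 is at most N, as \<open>mulE\<close> requires.\<close>

definition divE :: "iexp \<Rightarrow> iexp \<Rightarrow> iexp" where
  "divE a b = (let v = max (fresh a) (fresh b) in
     Sigma v (IfPos (Minus (Plus a (Const 1)) (mulE (Plus (Var v) (Const 1)) b)) (Const 1) (Const 0)))"

lemma le_zdiv_iff: "b > 0 \<Longrightarrow> c * b \<le> a \<longleftrightarrow> c \<le> a div (b::int)"
proof
  assume b: "b > 0" and "c * b \<le> a"
  then show "c \<le> a div b" using zdiv_mono1[of "c * b" a b] by simp
next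
  assume b: "b > 0" and "c \<le> a div b"
  then have "c * b \<le> a div b * b" by simp
  also have "\<dots> \<le> a" using b by (metis div_mod_decomp_int pos_mod_sign le_add_same_cancel1)
  finally show "c * b \<le> a" .
qed

lemma int_div_le: "0 \<le> a \<Longrightarrow> b > 0 \<Longrightarrow> a div b \<le> (a::int)"
  by (cases "b = 1"; cases "a = 0") (auto simp: int_div_less_self less_imp_le)

lemma ieval_divE:
  assumes "0 \<le> ieval a N w r" "ieval a N w r \<le> int N" "ieval b N w r > 0"
  shows "ieval (divE a b) N w r = ieval a N w r div ieval b N w r"
proof -
  let ?a = "ieval a N w r" and ?b = "ieval b N w r"
  have "ieval (divE a b) N w r = (\<Sum>i<N. if ?a + 1 - (int i + 1) * ?b > 0 then 1 else 0)"
    unfolding divE_def Let_def by (simp add: ieval_fresh ieval_mulE cong: if_cong)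
  also have "\<dots> = int (nat (?a div ?b)) * 1"
  proof (rule sum_threshold)
    fix i
    have "?a + 1 - (int i + 1) * ?b > 0 \<longleftrightarrow> (int i + 1) * ?b \<le> ?a" by auto
    also have "\<dots> \<longleftrightarrow> int i + 1 \<le> ?a div ?b"
      using assms(3) by (rule le_zdiv_iff)
    finally show "?a + 1 - (int i + 1) * ?b > 0 \<longleftrightarrow> i < nat (?a div ?b)" by linarith
  next
    have "?a div ?b \<le> ?a" using assms by (simp add: int_div_le)
    then show "nat (?a div ?b) \<le> N" using assms by linarith
  qed
  finally show ?thesis
    using assms by (simp add: pos_imp_zdiv_nonneg_iff)
qed

definition modE :: "iexp \<Rightarrow> iexp \<Rightarrow> iexp" where
  "modE a b = Minus a (mulE (divE a b) b)"

lemma ieval_modE: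
  assumes "0 \<le> ieval a N w r" "ieval a N w r \<le> int N" "ieval b N w r > 0"
  shows "ieval (modE a b) N w r = ieval a N w r mod ieval b N w r"
proof -
  let ?a = "ieval a N w r" and ?b = "ieval b N w r"
  have "?a div ?b \<le> ?a" using assms by (simp add: int_div_le)
  moreover have "0 \<le> ?a div ?b" using assms by (simp add: pos_imp_zdiv_nonneg_iff)
  ultimately have "ieval (mulE (divE a b) b) N w r = ?a div ?b * ?b"
    using assms by (subst ieval_mulE) (auto simp: ieval_divE)
  then show ?thesis unfolding modE_def by (simp add: minus_div_mult_eq_mod)
qed

fun powE :: "iexp \<Rightarrow> nat \<Rightarrow> iexp" where
  "powE a 0 = Const 1"
| "powE a (Suc n) = mulE a (powE a n)"

lemma ieval_powE:
  "0 \<le> ieval a N w r \<Longrightarrow> ieval a N w r \<le> int N \<Longrightarrow> ieval (powE a n) N w r = ieval a N w r ^ n"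
  by (induction n) (auto simp: ieval_mulE)

text \<open>A constant factor is unrolled in the program text instead of looped over, so neither it
  nor the product has to stay below N.\<close>

fun scaleE :: "nat \<Rightarrow> iexp \<Rightarrow> iexp" where
  "scaleE 0 a = Const 0"
| "scaleE (Suc n) a = Plus a (scaleE n a)"

lemma ieval_scaleE: "ieval (scaleE n a) N w r = int n * ieval a N w r"
  by (induction n) (auto simp: algebra_simps)

definition intscaleE :: "int \<Rightarrow> iexp \<Rightarrow> iexp" where
  "intscaleE z a = Minus (scaleE (nat z) a) (scaleE (nat (- z)) a)"

lemma ieval_intscaleE: "ieval (intscaleE z a) N w r = z * ieval a N w r"
  unfolding intscaleE_def by (cases "z \<ge> 0") (auto simp: ieval_scaleE)

definition eqE :: "iexp \<Rightarrow> iexp \<Rightarrow> iexp \<Rightarrow> iexp \<Rightarrow> iexp" where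
  "eqE a b c d = IfPos (Minus a b) d (IfPos (Minus b a) d c)"

lemma ieval_eqE:
  "ieval (eqE a b c d) N w r =
     (if ieval a N w r = ieval b N w r then ieval c N w r else ieval d N w r)"
  unfolding eqE_def by auto

text \<open>Entries of the sign matrix may be negative, where \<open>mulE\<close> does not apply; a
  case distinction covers the three values that occur.\<close>

definition signmulE :: "iexp \<Rightarrow> iexp \<Rightarrow> iexp" where
  "signmulE a b = IfPos a b (IfPos (Minus (Const 0) a) (Minus (Const 0) b) (Const 0))"

lemma ieval_signmulE:
  "ieval a N w r \<in> {-1, 0, 1} \<Longrightarrow> ieval (signmulE a b) N w r = ieval a N w r * ieval b N w r"
  unfolding signmulE_def by auto

fun sumE :: "(nat \<Rightarrow> iexp) \<Rightarrow> nat \<Rightarrow> iexp" where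
  "sumE f 0 = Const 0"
| "sumE f (Suc n) = Plus (sumE f n) (f n)"

lemma ieval_sumE: "ieval (sumE f n) N w r = (\<Sum>i<n. ieval (f i) N w r)"
  by (induction n) auto

section \<open>Writing the output into memory\<close>

definition for_size :: "nat \<Rightarrow> program \<Rightarrow> program" where
  "for_size v P = Seq (set_loop_var v (Lit 0)) (While (below_size v) (Seq P (step_loop_var v)))"

text \<open>The row index \<open>j\<close> is loop variable 0, and the column index \<open>i\<close> is loop variable 1.\<close>

definition write_entry :: "iexp \<Rightarrow> program" where
  "write_entry a =
     Seq (compile (Plus (mulE (Var 0) Size) (Var 1)) 0)
    (Seq (compile a 1)
    (Seq (Assign ''num'' (register 0) (register 1))
         (Assign ''den'' (register 0) (Lit 1))))"

text \<open>The loops fill an N by N array, as every loop runs up to N; a reader of the output looks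
  at its first \<open>m\<close> rows.\<close>

definition output_program :: "iexp \<Rightarrow> iexp \<Rightarrow> iexp \<Rightarrow> int \<Rightarrow> program" where
  "output_program a m M q =
     Seq (for_size 0 (for_size 1 (write_entry a)))
    (Seq (compile m 0) (Seq (Assign ''m'' (Lit 0) (register 0))
    (Seq (compile M 0) (Seq (Assign ''M_num'' (Lit 0) (register 0))
         (Assign ''M_den'' (Lit 0) (Lit q))))))"

definition entry_poly :: "iexp \<Rightarrow> nat poly" where
  "entry_poly a = time_poly (Plus (mulE (Var 0) Size) (Var 1)) + time_poly a + [:9:]"

definition row_poly :: "iexp \<Rightarrow> nat poly" where
  "row_poly a = [:3:] + ([:0,1:] * (entry_poly a + [:12:]) + [:6:])"

definition output_poly :: "iexp \<Rightarrow> iexp \<Rightarrow> iexp \<Rightarrow> nat poly" where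
  "output_poly a m M =
     [:3:] + ([:0,1:] * (row_poly a + [:12:]) + [:6:]) + time_poly m + time_poly M + [:11:]"

lemma runs_for_size:
  assumes "s ''N'' 0 = int N"
    and "I 0 (s(''v'' := (s ''v'')(int v := 0)))"
    and step: "\<And>i s. i < N \<Longrightarrow> I i s \<Longrightarrow>
      \<exists>s'. runs P s T s' \<and> s' ''v'' (int v) = int i \<and>
           I (Suc i) (s'(''v'' := (s' ''v'')(int v := int (Suc i))))"
    and inv: "\<And>i s. I i s \<Longrightarrow> s ''N'' 0 = int N \<and> s ''v'' (int v) = int i"
  shows "\<exists>s'. runs (for_size v P) s (3 + (N * (T + 12) + 6)) s' \<and> I N s'"
proof -
  let ?s0 = "s(''v'' := (s ''v'')(int v := 0))"
  have 0: "runs (set_loop_var v (Lit 0)) s 3 ?s0"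
    by (rule runs_Assign) auto
  have "\<exists>s'. runs (While (below_size v) (Seq P (step_loop_var v))) ?s0
      (N * (1 + cost (below_size v) + (T + 6)) + (1 + cost (below_size v))) s' \<and> I N s'"
  proof (rule runs_While[where I = I])
    fix i s assume "i < N" "I i s"
    from step[OF this] obtain s' where s': "runs P s T s'" "s' ''v'' (int v) = int i"
       "I (Suc i) (s'(''v'' := (s' ''v'')(int v := int (Suc i))))" by blast
    have "runs (Seq P (step_loop_var v)) s (T + 6) (s'(''v'' := (s' ''v'')(int v := int (Suc i))))"
      by (rule runs_Seq[OF s'(1) runs_Assign order_refl]) (use s'(2) in \<open>auto simp: add.commute\<close>)
    then show "eval_expr (below_size v) s > 0 \<and>
      (\<exists>s'. runs (Seq P (step_loop_var v)) s (T + 6) s' \<and> I (Suc i) s')"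
      using s'(3) inv[OF \<open>I i s\<close>] \<open>i < N\<close> by auto
  next
    fix s assume "I N s"
    from inv[OF this] show "\<not> eval_expr (below_size v) s > 0" by simp
  qed (use assms in auto)
  moreover have "N * (1 + cost (below_size v) + (T + 6)) + (1 + cost (below_size v)) = N * (T + 12) + 6"
    by (simp add: algebra_simps)
  ultimately obtain s' where
    1: "runs (While (below_size v) (Seq P (step_loop_var v))) ?s0 (N * (T + 12) + 6) s'" "I N s'"
    by metis
  show ?thesis
    unfolding for_size_def using runs_Seq[OF 0 1(1) order_refl] 1(2) by blast
qed

lemma runs_write_entry:
  assumes "s ''N'' 0 = int N" "s ''v'' 0 = int j" "s ''v'' 1 = int i" "j < N"
  shows "\<exists>s'. runs (write_entry a) s (poly (entry_poly a) N) s' \<and>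
    (\<forall>x. x \<notin> {''t'', ''num'', ''den''} \<longrightarrow> s' x = s x) \<and>
    s' ''num'' = (s ''num'')(int (j * N + i) := ieval a N (s ''bits'') (s ''v'')) \<and>
    s' ''den'' = (s ''den'')(int (j * N + i) := 1)"
proof -
  let ?ix = "Plus (mulE (Var 0) Size) (Var 1)"
  have ix: "ieval ?ix N (s ''bits'') (s ''v'') = int (j * N + i)"
    using assms by (simp add: ieval_mulE)
  from compile_correct[of s N ?ix 0, OF assms(1)] obtain s1 where
    1: "runs (compile ?ix 0) s (poly (time_poly ?ix) N) s1" "evaluates_to s 0 (int (j * N + i)) s1"
    unfolding ix by blast
  have "s1 ''N'' 0 = int N" "s1 ''bits'' = s ''bits''" "s1 ''v'' = s ''v''"
    using assms 1(2) by (auto simp: evaluates_to_def)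
  with compile_correct[of s1 N a 1] obtain s2 where
    2: "runs (compile a 1) s1 (poly (time_poly a) N) s2"
       "evaluates_to s1 1 (ieval a N (s ''bits'') (s ''v'')) s2"
    by auto
  define s3 where "s3 = s2(''num'' := (s2 ''num'')(s2 ''t'' 0 := s2 ''t'' 1))"
  define s4 where "s4 = s3(''den'' := (s3 ''den'')(s3 ''t'' 0 := 1))"
  have 3: "runs (Assign ''num'' (register 0) (register 1)) s2 5 s3"
    by (rule runs_Assign) (auto simp: s3_def)
  have 4: "runs (Assign ''den'' (register 0) (Lit 1)) s3 4 s4"
    by (rule runs_Assign) (auto simp: s4_def)
  have "runs (write_entry a) s (poly (entry_poly a) N) s4"
    unfolding write_entry_def entry_poly_def
    by (rule runs_Seq[OF 1(1)], rule runs_Seq[OF 2(1)], rule runs_Seq[OF 3 4 order_refl])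
      (rule order_refl, simp)
  then show ?thesis
    using 1(2) 2(2) by (intro exI[of _ s4]) (auto simp: evaluates_to_def s4_def s3_def)
qed

text \<open>Row-major positions do not collide, so a write leaves the finished entries
  intact.\<close>

lemma index_eq_iff:
  assumes "i < N" "i' < (N::nat)"
  shows "j * N + i = j' * N + i' \<longleftrightarrow> j = j' \<and> i = i'"
proof
  assume eq: "j * N + i = j' * N + i'"
  have "(j * N + i) div N = j" "(j' * N + i') div N = j'" "(j * N + i) mod N = i" "(j' * N + i') mod N = i'"
    using assms by auto
  then show "j = j' \<and> i = i'" using eq by metis
qed auto

text \<open>The hypotheses on \<open>m\<close> and \<open>M\<close> quantify over all
  \<open>r\<close>, because these expressions are evaluated with whatever values the loops have left
  in the loop variables.\<close>

lemma runs_output_program: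
  assumes N: "s ''N'' 0 = int N"
    and a: "\<And>i j r. i < N \<Longrightarrow> j < N \<Longrightarrow> r 0 = int j \<Longrightarrow> r 1 = int i \<Longrightarrow>
       ieval a N (s ''bits'') r = F j i"
    and m: "\<And>r. ieval m N (s ''bits'') r = m'"
    and M: "\<And>r. ieval M N (s ''bits'') r = M'"
  shows "\<exists>s'. runs (output_program a m M q) s (poly (output_poly a m M) N) s' \<and>
     (\<forall>j<N. \<forall>i<N. s' ''num'' (int (j * N + i)) = F j i \<and> s' ''den'' (int (j * N + i)) = 1) \<and>
     s' ''m'' 0 = m' \<and> s' ''M_num'' 0 = M' \<and> s' ''M_den'' 0 = q"
proof -
  \<comment> \<open>\<open>J\<close> is the invariant of the loop over rows; \<open>I\<close> adds
    to it the finished part of row \<open>j\<close>.\<close>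
  define J where "J = (\<lambda>j s'. s' ''N'' 0 = int N \<and> s' ''bits'' = s ''bits'' \<and>
    s' ''v'' (int 0) = int j \<and>
    (\<forall>j'<j. \<forall>i<N. s' ''num'' (int (j' * N + i)) = F j' i \<and> s' ''den'' (int (j' * N + i)) = 1))"
  define I where "I = (\<lambda>j i s'. s' ''N'' 0 = int N \<and> s' ''bits'' = s ''bits'' \<and>
    s' ''v'' (int 0) = int j \<and> s' ''v'' (int 1) = int i \<and>
    (\<forall>j'<j. \<forall>i<N. s' ''num'' (int (j' * N + i)) = F j' i \<and> s' ''den'' (int (j' * N + i)) = 1) \<and>
    (\<forall>i'<i. s' ''num'' (int (j * N + i')) = F j i' \<and> s' ''den'' (int (j * N + i')) = 1))"
  have "\<exists>s'. runs (for_size 0 (for_size 1 (write_entry a))) s (3 + (N * (poly (row_poly a) N + 12) + 6)) s'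
     \<and> J N s'"
  proof (rule runs_for_size)
    show "s ''N'' 0 = int N" by (rule N)
    show "J 0 (s(''v'' := (s ''v'')(int 0 := 0)))"
      using N by (auto simp: J_def)
    show "J i s' \<Longrightarrow> s' ''N'' 0 = int N \<and> s' ''v'' (int 0) = int i" for i s'
      by (auto simp: J_def)
  next
    fix j s0 assume j: "j < N" and Jj: "J j s0"
    have "\<exists>s'. runs (for_size 1 (write_entry a)) s0 (3 + (N * (poly (entry_poly a) N + 12) + 6)) s' \<and> I j N s'"
    proof (rule runs_for_size)
      show "s0 ''N'' 0 = int N" using Jj by (simp add: J_def)
      show "I j 0 (s0(''v'' := (s0 ''v'')(int 1 := 0)))"
        using Jj by (auto simp: J_def I_def)
      show "I j i s' \<Longrightarrow> s' ''N'' 0 = int N \<and> s' ''v'' (int 1) = int i" for i s'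
        by (auto simp: I_def)
    next
      fix i s1 assume i: "i < N" and Ii: "I j i s1"
      then have "s1 ''N'' 0 = int N" "s1 ''v'' 0 = int j" "s1 ''v'' 1 = int i"
        by (auto simp: I_def)
      from runs_write_entry[OF this j, of a] obtain s2 where
        s2: "runs (write_entry a) s1 (poly (entry_poly a) N) s2"
         "\<And>x. x \<notin> {''t'', ''num'', ''den''} \<Longrightarrow> s2 x = s1 x"
         "s2 ''num'' = (s1 ''num'')(int (j * N + i) := ieval a N (s1 ''bits'') (s1 ''v''))"
         "s2 ''den'' = (s1 ''den'')(int (j * N + i) := 1)" by blast
      have "ieval a N (s1 ''bits'') (s1 ''v'') = F j i"
        using a[OF i j] Ii by (simp add: I_def)
      then have num: "s2 ''num'' = (s1 ''num'')(int (j * N + i) := F j i)" using s2(3) by simp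
      have "I j (Suc i) (s2(''v'' := (s2 ''v'')(int 1 := int (Suc i))))"
        unfolding I_def
        using Ii i by (auto simp: I_def s2(2,4) num index_eq_iff less_Suc_eq simp del: of_nat_add of_nat_mult)
      then show "\<exists>s'. runs (write_entry a) s1 (poly (entry_poly a) N) s' \<and> s' ''v'' (int 1) = int i \<and>
           I j (Suc i) (s'(''v'' := (s' ''v'')(int 1 := int (Suc i))))"
        using s2(1) s2(2)[of "''v''"] Ii by (intro exI[of _ s2]) (auto simp: I_def)
    qed
    then obtain s' where s': "runs (for_size 1 (write_entry a)) s0 (poly (row_poly a) N) s'" "I j N s'"
      unfolding row_poly_def by auto
    then show "\<exists>s'. runs (for_size 1 (write_entry a)) s0 (poly (row_poly a) N) s' \<and> s' ''v'' (int 0) = int j \<and>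
       J (Suc j) (s'(''v'' := (s' ''v'')(int 0 := int (Suc j))))"
      by (intro exI[of _ s']) (auto simp: I_def J_def less_Suc_eq)
  qed
  then obtain s1 where
    1: "runs (for_size 0 (for_size 1 (write_entry a))) s (3 + (N * (poly (row_poly a) N + 12) + 6)) s1"
      "J N s1" by blast
  have "s1 ''N'' 0 = int N" using 1(2) by (simp add: J_def)
  from compile_correct[of s1 N m 0, OF this] obtain s2 where
    2: "runs (compile m 0) s1 (poly (time_poly m) N) s2" "evaluates_to s1 0 m' s2"
    using 1(2) m by (auto simp: J_def)
  define s3 where "s3 = s2(''m'' := (s2 ''m'')(0 := m'))"
  have 3: "runs (Assign ''m'' (Lit 0) (register 0)) s2 4 s3"
    by (rule runs_Assign) (use 2(2) in \<open>auto simp: s3_def evaluates_to_def\<close>)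
  have "s3 ''N'' 0 = int N" "s3 ''bits'' = s ''bits''"
    using 1(2) 2(2) by (auto simp: J_def s3_def evaluates_to_def)
  with compile_correct[of s3 N M 0] M obtain s4 where
    4: "runs (compile M 0) s3 (poly (time_poly M) N) s4" "evaluates_to s3 0 M' s4"
    by auto
  define s5 where "s5 = s4(''M_num'' := (s4 ''M_num'')(0 := M'))"
  have 5: "runs (Assign ''M_num'' (Lit 0) (register 0)) s4 4 s5"
    by (rule runs_Assign) (use 4(2) in \<open>auto simp: s5_def evaluates_to_def\<close>)
  define s6 where "s6 = s5(''M_den'' := (s5 ''M_den'')(0 := q))"
  have 6: "runs (Assign ''M_den'' (Lit 0) (Lit q)) s5 3 s6"
    by (rule runs_Assign) (auto simp: s6_def)
  have "runs (output_program a m M q) s (poly (output_poly a m M) N) s6"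
    unfolding output_program_def
    by (rule runs_Seq[OF 1(1)], rule runs_Seq[OF 2(1)], rule runs_Seq[OF 3], rule runs_Seq[OF 4(1)],
        rule runs_Seq[OF 5 6], (rule order_refl)+) (simp add: output_poly_def)
  then show ?thesis
    using 1(2) 2(2) 4(2)
    by (intro exI[of _ s6]) (auto simp: J_def s3_def s5_def s6_def evaluates_to_def simp del: of_nat_add of_nat_mult)
qed


section \<open>Averages over bit strings\<close>

text \<open>Expectation over uniform bits, kept as a finite sum. Independence is then the splitting
  of a string, \<open>avg_append\<close>.\<close>

definition avg :: "nat \<Rightarrow> (bool list \<Rightarrow> real) \<Rightarrow> real" where
  "avg L f = (\<Sum>bs\<in>bit_strings L. f bs) / 2 ^ L"

lemma bit_strings_eq: "bit_strings L = {bs. set bs \<subseteq> UNIV \<and> length bs = L}"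
  by (simp add: bit_strings_def)

lemma finite_bit_strings [simp]: "finite (bit_strings L)"
  unfolding bit_strings_eq by (rule finite_lists_length_eq) simp

lemma card_bit_strings: "card (bit_strings L) = 2 ^ L"
  unfolding bit_strings_eq by (subst card_lists_length_eq) auto

lemma avg_const [simp]: "avg L (\<lambda>_. c) = c"
  by (simp add: avg_def card_bit_strings)

lemma avg_add: "avg L (\<lambda>x. f x + g x) = avg L f + avg L g"
  by (simp add: avg_def sum.distrib add_divide_distrib)

lemma avg_diff: "avg L (\<lambda>x. f x - g x) = avg L f - avg L g"
  by (simp add: avg_def sum_subtractf diff_divide_distrib)

lemma avg_cmult: "avg L (\<lambda>x. c * f x) = c * avg L f"
  by (simp add: avg_def sum_distrib_left)

lemma avg_cmult_right: "avg L (\<lambda>x. f x * c) = avg L f * c"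
  by (simp add: avg_def sum_distrib_right)

lemma avg_mono: "(\<And>x. length x = L \<Longrightarrow> f x \<le> g x) \<Longrightarrow> avg L f \<le> avg L g"
  unfolding avg_def by (intro divide_right_mono sum_mono) (auto simp: bit_strings_def)

lemma avg_cong: "(\<And>x. length x = L \<Longrightarrow> f x = g x) \<Longrightarrow> avg L f = avg L g"
  unfolding avg_def by (intro arg_cong2[where f = "(/)"] sum.cong) (auto simp: bit_strings_def)

lemma avg_append: "avg (a + b) f = avg a (\<lambda>x. avg b (\<lambda>y. f (x @ y)))"
proof -
  have "(\<Sum>bs\<in>bit_strings (a + b). f bs) =
      (\<Sum>(x, y)\<in>bit_strings a \<times> bit_strings b. f (x @ y))"
    by (rule sum.reindex_bij_witness[where i = "\<lambda>(x, y). x @ y" and j = "\<lambda>z. (take a z, drop a z)"])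
      (auto simp: bit_strings_def)
  also have "\<dots> = (\<Sum>x\<in>bit_strings a. \<Sum>y\<in>bit_strings b. f (x @ y))"
    by (simp add: sum.cartesian_product)
  finally show ?thesis
    by (simp add: avg_def sum_divide_distrib power_add field_simps)
qed

lemma avg_0: "avg 0 f = f []"
  by (simp add: avg_def bit_strings_def)

lemma avg_1: "avg (Suc 0) f = (f [True] + f [False]) / 2"
proof -
  have "bit_strings (Suc 0) = {[True], [False]}"
    by (auto simp: bit_strings_def length_Suc_conv)
  then show ?thesis by (simp add: avg_def)
qed

lemma avg_Suc: "avg (Suc L) f = avg L (\<lambda>x. (f (x @ [True]) + f (x @ [False])) / 2)"
  using avg_append[of L "Suc 0" f] by (simp add: avg_1)

lemma avg_of_bool_union:
  "avg L (\<lambda>x. of_bool (P x \<or> Q x)) \<le> avg L (\<lambda>x. of_bool (P x)) + avg L (\<lambda>x. of_bool (Q x))"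
  unfolding avg_add[symmetric] by (rule avg_mono) auto

text \<open>The union bound, to be applied to the net of coefficient vectors.\<close>

lemma avg_of_bool_ex:
  "finite Z \<Longrightarrow> avg L (\<lambda>x. of_bool (\<exists>z\<in>Z. P z x)) \<le> (\<Sum>z\<in>Z. avg L (\<lambda>x. of_bool (P z x)))"
proof (induction Z rule: finite_induct)
  case (insert z Z)
  have "avg L (\<lambda>x. of_bool (\<exists>z\<in>insert z Z. P z x)) \<le>
      avg L (\<lambda>x. of_bool (P z x)) + avg L (\<lambda>x. of_bool (\<exists>z\<in>Z. P z x))"
    using avg_of_bool_union[of L "P z" "\<lambda>x. \<exists>z\<in>Z. P z x"] by simp
  then show ?case using insert by simp
qed simp

definition chunk :: "nat \<Rightarrow> nat \<Rightarrow> bool list \<Rightarrow> bool list" where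
  "chunk m i bs = take m (drop (i * m) bs)"

lemma chunk_append:
  assumes "length x = n * m" "length y = m"
  shows "i < n \<Longrightarrow> chunk m i (x @ y) = chunk m i x" "chunk m n (x @ y) = y"
proof -
  show "chunk m n (x @ y) = y" using assms by (simp add: chunk_def)
  assume "i < n"
  then have "i * m + m \<le> n * m" by (metis Suc_leI add.commute mult_Suc mult_le_mono1)
  then show "chunk m i (x @ y) = chunk m i x" using assms by (simp add: chunk_def)
qed

text \<open>Disjoint chunks are independent and identically distributed, which is what exponential
  moments of sums over chunks need.\<close>

lemma avg_prod_chunk:
  "avg (n * m) (\<lambda>bs. \<Prod>i<n. \<phi> (chunk m i bs)) = avg m \<phi> ^ n"
proof (induction n)
  case 0
  then show ?case by (simp add: avg_0)
next
  case (Suc n)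
  have "avg (Suc n * m) (\<lambda>bs. \<Prod>i<Suc n. \<phi> (chunk m i bs)) =
     avg (n * m + m) (\<lambda>bs. \<Prod>i<Suc n. \<phi> (chunk m i bs))"
    by (simp add: add.commute)
  also have "\<dots> = avg (n * m) (\<lambda>x. avg m (\<lambda>y. (\<Prod>i<n. \<phi> (chunk m i x)) * \<phi> y))"
    unfolding avg_append by (intro avg_cong) (simp add: chunk_append[where n = n])
  also have "\<dots> = avg m \<phi> ^ n * avg m \<phi>"
    by (simp add: avg_cmult avg_cmult_right Suc.IH)
  finally show ?case by (simp add: mult.commute)
qed

section \<open>Moments and upper tail of signed sums\<close>

definition sgn_bit :: "bool \<Rightarrow> real" where
  "sgn_bit b = (if b then 1 else -1)"

definition signed_sum :: "(nat \<Rightarrow> real) \<Rightarrow> nat \<Rightarrow> bool list \<Rightarrow> real" where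
  "signed_sum u k bs = (\<Sum>j<k. sgn_bit (bs ! j) * u j)"

lemma signed_sum_snoc:
  "length x = k \<Longrightarrow> signed_sum u (Suc k) (x @ [b]) = signed_sum u k x + sgn_bit b * u k"
  unfolding signed_sum_def by (simp add: nth_append)

text \<open>This is the auxiliary inequality behind Hoeffding's lemma at \<open>2 * x\<close> and
  probability 1/2, after taking out the factor \<open>exp (- x)\<close>. It asks for a nonnegative
  argument, and evenness gives the rest.\<close>

lemma cosh_le_exp_square: "(exp x + exp (- x)) / 2 \<le> exp (x\<^sup>2 / 2)" for x :: real
proof -
  have *: "(exp x + exp (- x)) / 2 \<le> exp (x\<^sup>2 / 2)" if "x \<ge> 0" for x :: real
  proof -
    have pos: "1 + (exp (2 * x) - 1) / 2 > 0"
      using exp_gt_zero[of "2 * x"] by (simp add: field_simps del: exp_gt_zero)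
    have "(exp x + exp (- x)) / 2 = exp (- x) * (1 + (exp (2 * x) - 1) / 2)"
      by (simp add: field_simps flip: exp_add)
    also have "\<dots> = exp (- x + ln (1 + (exp (2 * x) - 1) / 2))"
      using pos by (simp only: exp_add exp_ln)
    also have "\<dots> \<le> exp (x\<^sup>2 / 2)"
      using Hoeffdings_lemma_aux[of "2 * x" "1 / 2"] that by simp
    finally show ?thesis .
  qed
  show ?thesis
    using *[of x] *[of "- x"] by (cases "x \<ge> 0") (auto simp: add.commute)
qed

text \<open>For a Gaussian of variance v the average is (1 - 2sv)^(-1/2), which lies below this
  bound. The exponent is shaped for the induction: averaging over the last sign, with coefficient c,
  costs \<open>exp (s * c\<^sup>2)\<close> and replaces s by s / (1 - 2sc^2), and such substitutions
  compose by adding variances.\<close>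

lemma avg_exp_signed_sum_square:
  assumes "s \<ge> 0" "2 * s * (\<Sum>j<k. (u j)\<^sup>2) < 1"
  shows "avg k (\<lambda>bs. exp (s * (signed_sum u k bs)\<^sup>2)) \<le>
    exp (s * (\<Sum>j<k. (u j)\<^sup>2) / (1 - 2 * s * (\<Sum>j<k. (u j)\<^sup>2)))"
  using assms
proof (induction k arbitrary: s)
  case 0
  then show ?case by (simp add: avg_0 signed_sum_def)
next
  case (Suc k)
  define v c where "v = (\<Sum>j<k. (u j)\<^sup>2)" and "c = u k"
  define s' where "s' = s / (1 - 2 * s * c\<^sup>2)"
  have v: "v \<ge> 0" unfolding v_def by (simp add: sum_nonneg)
  have lt: "2 * s * c\<^sup>2 + 2 * s * v < 1"
    using Suc.prems by (simp add: v_def c_def algebra_simps)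
  moreover have "2 * s * v \<ge> 0" "2 * s * c\<^sup>2 \<ge> 0" using v Suc.prems by auto
  ultimately have lt1: "1 - 2 * s * c\<^sup>2 > 0" by linarith
  have s': "s' \<ge> 0" using lt1 Suc.prems by (simp add: s'_def)
  have s'v: "2 * s' * v < 1" using lt lt1 by (simp add: s'_def field_simps)
  \<comment> \<open>The new coefficient of the squared sum is s (1 + 2sc^2), and (1 + x)(1 - x)
    \<le> 1.\<close>
  have ss': "s + 2 * s\<^sup>2 * c\<^sup>2 \<le> s'"
  proof -
    have "(s + 2 * s\<^sup>2 * c\<^sup>2) * (1 - 2 * s * c\<^sup>2) = s - 4 * s * (s * c\<^sup>2)\<^sup>2"
      by (simp add: field_simps power2_eq_square)
    also have "\<dots> \<le> s" using Suc.prems by simp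
    finally show ?thesis using lt1 by (simp add: s'_def field_simps)
  qed
  have "avg (Suc k) (\<lambda>bs. exp (s * (signed_sum u (Suc k) bs)\<^sup>2)) =
     avg k (\<lambda>x. (exp (s * (signed_sum u k x + c)\<^sup>2) + exp (s * (signed_sum u k x - c)\<^sup>2)) / 2)"
    unfolding avg_Suc by (rule avg_cong) (simp add: signed_sum_snoc sgn_bit_def c_def)
  also have "\<dots> \<le> avg k (\<lambda>x. exp (s * c\<^sup>2) * exp (s' * (signed_sum u k x)\<^sup>2))"
  proof (rule avg_mono)
    fix x
    let ?a = "signed_sum u k x"
    \<comment> \<open>Once the squares are expanded, the cross terms average to the hyperbolic
      cosine of 2sac.\<close>
    have "(exp (s * (?a + c)\<^sup>2) + exp (s * (?a - c)\<^sup>2)) / 2 =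
      exp (s * (?a\<^sup>2 + c\<^sup>2)) * ((exp (2 * s * ?a * c) + exp (- (2 * s * ?a * c))) / 2)"
      by (simp add: power2_eq_square field_simps flip: exp_add)
    also have "\<dots> \<le> exp (s * (?a\<^sup>2 + c\<^sup>2)) * exp ((2 * s * ?a * c)\<^sup>2 / 2)"
      by (intro mult_left_mono cosh_le_exp_square) simp
    also have "\<dots> = exp (s * c\<^sup>2) * exp ((s + 2 * s\<^sup>2 * c\<^sup>2) * ?a\<^sup>2)"
      by (simp add: power2_eq_square algebra_simps flip: exp_add)
    also have "\<dots> \<le> exp (s * c\<^sup>2) * exp (s' * ?a\<^sup>2)"
      using ss' by (simp add: mult_right_mono)
    finally show "(exp (s * (?a + c)\<^sup>2) + exp (s * (?a - c)\<^sup>2)) / 2 \<le> exp (s * c\<^sup>2) * exp (s' * ?a\<^sup>2)" .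
  qed
  also have "\<dots> = exp (s * c\<^sup>2) * avg k (\<lambda>x. exp (s' * (signed_sum u k x)\<^sup>2))"
    by (rule avg_cmult)
  also have "\<dots> \<le> exp (s * c\<^sup>2) * exp (s' * v / (1 - 2 * s' * v))"
    using Suc.IH[of s'] s' s'v by (simp add: v_def)
  also have "\<dots> = exp (s * c\<^sup>2 + s' * v / (1 - 2 * s' * v))" by (simp add: exp_add)
  also have "\<dots> \<le> exp (s * (v + c\<^sup>2) / (1 - 2 * s * (v + c\<^sup>2)))"
  proof -
    have pos: "1 - 2 * s * (v + c\<^sup>2) > 0" using lt by (simp add: algebra_simps)
    have "s' * v / (1 - 2 * s' * v) = s * v / (1 - 2 * s * (v + c\<^sup>2))"
    proof -
      have "s' * v / (1 - 2 * s' * v) = (s * v / (1 - 2 * s * c\<^sup>2)) / ((1 - 2 * s * (v + c\<^sup>2)) / (1 - 2 * s * c\<^sup>2))"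
        using lt1 by (simp add: s'_def field_simps)
      also have "\<dots> = s * v / (1 - 2 * s * (v + c\<^sup>2))" using lt1 by simp
      finally show ?thesis .
    qed
    moreover have "s * c\<^sup>2 \<le> s * c\<^sup>2 / (1 - 2 * s * (v + c\<^sup>2))"
      using pos Suc.prems v by (simp add: le_divide_eq) (auto intro!: mult_left_le)
    ultimately show ?thesis by (simp add: add_divide_distrib algebra_simps)
  qed
  finally show ?case by (simp add: v_def c_def)
qed

text \<open>Odd powers of the last sign cancel in the average. The fourth moment obeys the Gaussian
  bound, which later keeps the mean of a block norm close to \<open>sqrt B\<close>.\<close>

lemma avg_signed_sum_moments:
  "avg k (\<lambda>bs. (signed_sum u k bs)\<^sup>2) = (\<Sum>j<k. (u j)\<^sup>2)"
  "avg k (\<lambda>bs. (signed_sum u k bs) ^ 4) \<le> 3 * (\<Sum>j<k. (u j)\<^sup>2)\<^sup>2"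
proof -
  have 2: "avg k (\<lambda>bs. (signed_sum u k bs)\<^sup>2) = (\<Sum>j<k. (u j)\<^sup>2)" for k
  proof (induction k)
    case (Suc k)
    have "avg (Suc k) (\<lambda>bs. (signed_sum u (Suc k) bs)\<^sup>2) =
       avg k (\<lambda>x. (signed_sum u k x)\<^sup>2 + (u k)\<^sup>2)"
      unfolding avg_Suc
      by (rule avg_cong) (simp add: signed_sum_snoc sgn_bit_def power2_eq_square field_simps)
    then show ?case by (simp add: avg_add Suc.IH)
  qed (simp add: avg_0 signed_sum_def)
  show "avg k (\<lambda>bs. (signed_sum u k bs)\<^sup>2) = (\<Sum>j<k. (u j)\<^sup>2)" by (rule 2)
  show "avg k (\<lambda>bs. (signed_sum u k bs) ^ 4) \<le> 3 * (\<Sum>j<k. (u j)\<^sup>2)\<^sup>2"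
  proof (induction k)
    case (Suc k)
    define v c where "v = (\<Sum>j<k. (u j)\<^sup>2)" and "c = u k"
    have "avg (Suc k) (\<lambda>bs. (signed_sum u (Suc k) bs) ^ 4) =
       avg k (\<lambda>x. (signed_sum u k x) ^ 4 + (6 * c\<^sup>2 * (signed_sum u k x)\<^sup>2 + c ^ 4))"
      unfolding avg_Suc
      by (rule avg_cong) (simp add: signed_sum_snoc sgn_bit_def c_def power2_eq_square power4_eq_xxxx field_simps)
    also have "\<dots> \<le> 3 * v\<^sup>2 + (6 * c\<^sup>2 * v + c ^ 4)"
      using Suc.IH by (simp add: avg_add avg_cmult 2 v_def)
    also have "\<dots> = 3 * (v + c\<^sup>2)\<^sup>2 - 2 * c ^ 4"
      by (simp add: power2_eq_square power4_eq_xxxx algebra_simps)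
    also have "\<dots> \<le> 3 * (v + c\<^sup>2)\<^sup>2" by simp
    finally show ?case by (simp add: v_def c_def)
  qed (simp add: avg_0 signed_sum_def)
qed

lemma avg_upper_tail:
  fixes \<tau> :: real
  assumes v: "(\<Sum>j<k. (u j)\<^sup>2) \<le> 1" and \<tau>: "0 < \<tau>" "\<tau> \<le> 1"
  shows "avg (R * k) (\<lambda>bs. of_bool ((\<Sum>i<R. (signed_sum u k (chunk k i bs))\<^sup>2) \<ge> R * (1 + \<tau>)))
    \<le> exp (- (real R * \<tau>\<^sup>2 / 16))"
proof -
  \<comment> \<open>This \<open>s\<close> minimises 4s^2 - s\<tau>, the exponent per chunk in the
    Chernoff bound, and leaves -\<tau>^2/16.\<close>
  define s v where "s = \<tau> / 8" and "v = (\<Sum>j<k. (u j)\<^sup>2)"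
  have s: "s > 0" "s \<le> 1 / 8" using \<tau> by (auto simp: s_def)
  have v0: "0 \<le> v" "v \<le> 1" using assms by (auto simp: v_def sum_nonneg)
  have sv: "s * v \<le> s" using s v0 by simp
  have A: "avg k (\<lambda>bs. exp (s * (signed_sum u k bs)\<^sup>2)) \<le> exp (s + 4 * s\<^sup>2)"
  proof -
    have "avg k (\<lambda>bs. exp (s * (signed_sum u k bs)\<^sup>2)) \<le> exp (s * v / (1 - 2 * s * v))"
      using avg_exp_signed_sum_square[of s u k] s sv unfolding v_def[symmetric] by linarith
    also have "s * v / (1 - 2 * s * v) \<le> s / (1 - 2 * s)"
      using s sv v0 by (intro frac_le) auto
    also have "\<dots> \<le> s + 4 * s\<^sup>2"
    proof -
      have "(s + 4 * s\<^sup>2) * (1 - 2 * s) = s + 2 * s\<^sup>2 * (1 - 4 * s)"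
        by (simp add: power2_eq_square algebra_simps)
      also have "\<dots> \<ge> s" using s by simp
      finally show ?thesis using s by (simp add: divide_le_eq)
    qed
    finally show ?thesis by simp
  qed
  have "avg (R * k) (\<lambda>bs. of_bool ((\<Sum>i<R. (signed_sum u k (chunk k i bs))\<^sup>2) \<ge> R * (1 + \<tau>))) \<le>
    avg (R * k) (\<lambda>bs. exp (- (s * (R * (1 + \<tau>)))) *
       (\<Prod>i<R. exp (s * (signed_sum u k (chunk k i bs))\<^sup>2)))"
  proof (rule avg_mono)
    fix bs
    let ?X = "\<Sum>i<R. (signed_sum u k (chunk k i bs))\<^sup>2"
    have "exp (- (s * (R * (1 + \<tau>)))) * (\<Prod>i<R. exp (s * (signed_sum u k (chunk k i bs))\<^sup>2)) =
      exp (s * (?X - R * (1 + \<tau>)))"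
      by (simp add: exp_sum[symmetric] sum_distrib_left exp_add[symmetric] algebra_simps)
    moreover have "of_bool (?X \<ge> R * (1 + \<tau>)) \<le> exp (s * (?X - R * (1 + \<tau>)))"
      using s by (auto simp: of_bool_def)
    ultimately show "of_bool (?X \<ge> R * (1 + \<tau>)) \<le> exp (- (s * (R * (1 + \<tau>)))) *
       (\<Prod>i<R. exp (s * (signed_sum u k (chunk k i bs))\<^sup>2))" by simp
  qed
  also have "\<dots> = exp (- (s * (R * (1 + \<tau>)))) * avg k (\<lambda>bs. exp (s * (signed_sum u k bs)\<^sup>2)) ^ R"
    using avg_prod_chunk[of R k "\<lambda>b. exp (s * (signed_sum u k b)\<^sup>2)"] by (simp add: avg_cmult)
  also have "\<dots> \<le> exp (- (s * (R * (1 + \<tau>)))) * exp (s + 4 * s\<^sup>2) ^ R"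
    by (intro mult_left_mono power_mono A) (auto simp: avg_def sum_nonneg)
  also have "\<dots> = exp (- (real R * \<tau>\<^sup>2 / 16))"
    by (simp add: exp_of_nat_mult[symmetric] exp_add[symmetric] s_def power2_eq_square field_simps)
  finally show ?thesis .
qed

section \<open>Lower tail of block norms\<close>

definition block_norm :: "(nat \<Rightarrow> real) \<Rightarrow> nat \<Rightarrow> nat \<Rightarrow> bool list \<Rightarrow> real" where
  "block_norm u k B bs = sqrt (\<Sum>c<B. (signed_sum u k (chunk k c bs))\<^sup>2)"

text \<open>Variances of independent copies add up, and each is at most 3 - 1 = 2.\<close>

lemma avg_sum_chunk:
  assumes "avg m X = 1" "avg m (\<lambda>b. (X b)\<^sup>2) \<le> 3"
  shows "avg (B * m) (\<lambda>bs. \<Sum>c<B. X (chunk m c bs)) = B"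
    "avg (B * m) (\<lambda>bs. (\<Sum>c<B. X (chunk m c bs))\<^sup>2) \<le> (real B)\<^sup>2 + 2 * B"
proof (induction B)
  case 0
  { case 1 then show ?case by simp }
  { case 2 then show ?case by simp }
next
  case (Suc B)
  have *: "avg (Suc B * m) f = avg (B * m) (\<lambda>x. avg m (\<lambda>y. f (x @ y)))" for f
    using avg_append[of "B * m" m f] by (simp add: add.commute)
  have one: "avg (Suc B * m) (\<lambda>bs. \<Sum>c<Suc B. X (chunk m c bs)) =
     avg (B * m) (\<lambda>x. avg m (\<lambda>y. (\<Sum>c<B. X (chunk m c x)) + X y))"
    unfolding * by (intro avg_cong) (simp add: chunk_append[where n = B])
  have two: "avg (Suc B * m) (\<lambda>bs. (\<Sum>c<Suc B. X (chunk m c bs))\<^sup>2) =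
     avg (B * m) (\<lambda>x. avg m (\<lambda>y. (\<Sum>c<B. X (chunk m c x))\<^sup>2 +
       (2 * (\<Sum>c<B. X (chunk m c x)) * X y + (X y)\<^sup>2)))"
    unfolding * by (intro avg_cong) (simp add: chunk_append[where n = B] power2_sum)
  { case 1 then show ?case unfolding one by (simp add: avg_add assms Suc.IH(1)) }
  have "avg (Suc B * m) (\<lambda>bs. (\<Sum>c<Suc B. X (chunk m c bs))\<^sup>2) =
     avg (B * m) (\<lambda>x. (\<Sum>c<B. X (chunk m c x))\<^sup>2) + (2 * real B + avg m (\<lambda>b. (X b)\<^sup>2))"
    unfolding two by (simp add: avg_add avg_cmult assms(1) Suc.IH(1))
  also have "\<dots> \<le> (real B)\<^sup>2 + 2 * B + (2 * real B + 3)"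
    using Suc.IH(2) assms(2) by linarith
  finally have three: "avg (Suc B * m) (\<lambda>bs. (\<Sum>c<Suc B. X (chunk m c bs))\<^sup>2) \<le> \<dots>" .
  { case 2 show ?case using three by (simp add: power2_eq_square algebra_simps) }
qed

text \<open>The parabola touches the square root at 1, so it turns two moments of a variable
  concentrated near 1 into a good lower bound for its mean square root. With y = sqrt x the
  difference is y (y - 1)^2 (y + 2) / 2.\<close>

lemma sqrt_ge_parabola: "x \<ge> 0 \<Longrightarrow> sqrt x \<ge> (3 * x - x\<^sup>2) / 2"
proof -
  assume x: "x \<ge> 0"
  define y where "y = sqrt x"
  have y: "y \<ge> 0" "x = y\<^sup>2" using x by (auto simp: y_def)
  have "0 \<le> y * ((y - 1)\<^sup>2 * (y + 2))" using y by simp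
  also have "\<dots> = 2 * y - 3 * y\<^sup>2 + (y\<^sup>2)\<^sup>2"
    by (simp add: power2_eq_square algebra_simps)
  finally show ?thesis using y unfolding y_def[symmetric] by simp
qed

lemma exp_minus_le_quadratic: "x \<ge> 0 \<Longrightarrow> exp (- x) \<le> 1 - x + x\<^sup>2 / 2" for x :: real
proof -
  assume x: "x \<ge> 0"
  let ?f = "\<lambda>x::real. 1 - x + x\<^sup>2 / 2 - exp (- x)"
  have "?f 0 \<le> ?f x"
  proof (rule DERIV_nonneg_imp_nondecreasing[OF x])
    fix t :: real
    have "(?f has_real_derivative (-1 + t + exp (- t))) (at t)"
      by (auto intro!: derivative_eq_intros)
    moreover have "-1 + t + exp (- t) \<ge> 0"
      using exp_ge_add_one_self[of "- t"] by simp
    ultimately show "\<exists>y. (?f has_real_derivative y) (at t) \<and> 0 \<le> y" by blast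
  qed
  then show ?thesis by simp
qed

text \<open>The lower tail of a nonnegative variable needs no exponential moments: a quadratic
  majorant of exp(-x) reduces it to the first two. Here the mean is nearly 1 and the second moment
  exactly 1.\<close>

lemma avg_lower_tail:
  fixes \<tau> :: real
  assumes v: "(\<Sum>j<k. (u j)\<^sup>2) = 1" and \<tau>: "0 < \<tau>" and B: "B > 0"
  shows "avg (n * (B * k)) (\<lambda>bs. of_bool ((\<Sum>i<n. block_norm u k B (chunk (B * k) i bs)) \<le>
      n * sqrt B * (1 - 1 / B - \<tau>)))
    \<le> exp (- (real n * \<tau>\<^sup>2 / 2))"
proof -
  define W where "W bs = block_norm u k B bs / sqrt B" for bs
  define Y where "Y bs = (\<Sum>c<B. (signed_sum u k (chunk k c bs))\<^sup>2)" for bs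
  have W0: "W bs \<ge> 0" for bs by (simp add: W_def block_norm_def sum_nonneg)
  have WY: "(W bs)\<^sup>2 = Y bs / B" "W bs = sqrt (Y bs / B)" for bs
    using B by (auto simp: W_def block_norm_def Y_def power_divide sum_nonneg real_sqrt_divide)
  have Y0: "Y bs \<ge> 0" for bs by (simp add: Y_def sum_nonneg)
  have Y1: "avg (B * k) Y = B"
    unfolding Y_def
    by (rule avg_sum_chunk) (use avg_signed_sum_moments[of k u] v in simp_all)
  have Y2: "avg (B * k) (\<lambda>bs. (Y bs)\<^sup>2) \<le> (real B)\<^sup>2 + 2 * B"
    unfolding Y_def
    by (rule avg_sum_chunk) (use avg_signed_sum_moments[of k u] v in simp_all)
  \<comment> \<open>Averaging the parabola gives (3 - (1 + 2/B)) / 2 = 1 - 1/B.\<close>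
  have W1: "avg (B * k) W \<ge> 1 - 1 / B"
  proof -
    have "avg (B * k) (\<lambda>bs. (3 / (2 * B)) * Y bs - (1 / (2 * (real B)\<^sup>2)) * (Y bs)\<^sup>2) \<le> avg (B * k) W"
    proof (rule avg_mono)
      fix bs
      show "(3 / (2 * B)) * Y bs - (1 / (2 * (real B)\<^sup>2)) * (Y bs)\<^sup>2 \<le> W bs"
      proof -
        have "(3 / (2 * B)) * Y bs - (1 / (2 * (real B)\<^sup>2)) * (Y bs)\<^sup>2 =
            (3 * (Y bs / B) - (Y bs / B)\<^sup>2) / 2"
          using B by (simp add: power_divide diff_divide_distrib)
        then show ?thesis
          using sqrt_ge_parabola[of "Y bs / B"] Y0[of bs] WY(2)[of bs] by simp
      qed
    qed
    moreover have "avg (B * k) (\<lambda>bs. (3 / (2 * B)) * Y bs - (1 / (2 * (real B)\<^sup>2)) * (Y bs)\<^sup>2) =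
       (3 / (2 * B)) * B - (1 / (2 * (real B)\<^sup>2)) * avg (B * k) (\<lambda>bs. (Y bs)\<^sup>2)"
      unfolding avg_diff avg_cmult Y1 by simp
    moreover have "(1 / (2 * (real B)\<^sup>2)) * avg (B * k) (\<lambda>bs. (Y bs)\<^sup>2) \<le>
       (1 / (2 * (real B)\<^sup>2)) * ((real B)\<^sup>2 + 2 * B)"
      by (intro mult_left_mono Y2) simp
    moreover have "(3 / (2 * B)) * B - (1 / (2 * (real B)\<^sup>2)) * ((real B)\<^sup>2 + 2 * B) = 1 - 1 / B"
      using B by (simp add: field_simps power2_eq_square)
    ultimately show ?thesis by linarith
  qed
  have E: "avg (B * k) (\<lambda>bs. exp (- (\<tau> * W bs))) \<le> exp (- \<tau> * (1 - 1 / B) + \<tau>\<^sup>2 / 2)"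
  proof -
    have "avg (B * k) (\<lambda>bs. exp (- (\<tau> * W bs))) \<le>
       avg (B * k) (\<lambda>bs. 1 - (\<tau> * W bs - (\<tau>\<^sup>2 / (2 * B)) * Y bs))"
    proof (rule avg_mono)
      fix bs
      show "exp (- (\<tau> * W bs)) \<le> 1 - (\<tau> * W bs - (\<tau>\<^sup>2 / (2 * B)) * Y bs)"
        using exp_minus_le_quadratic[of "\<tau> * W bs"] W0[of bs] \<tau>
        by (simp add: power_mult_distrib WY(1))
    qed
    also have "\<dots> = 1 - (\<tau> * avg (B * k) W - (\<tau>\<^sup>2 / (2 * B)) * B)"
      unfolding avg_diff avg_cmult Y1 by simp
    also have "\<dots> \<le> 1 + (- \<tau> * (1 - 1 / B) + \<tau>\<^sup>2 / 2)"
      using W1 \<tau> B mult_left_mono[OF W1, of \<tau>] by simp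
    also have "\<dots> \<le> exp (- \<tau> * (1 - 1 / B) + \<tau>\<^sup>2 / 2)"
      by (rule exp_ge_add_one_self)
    finally show ?thesis .
  qed
  let ?a = "real n * (1 - 1 / B - \<tau>)"
  have "avg (n * (B * k)) (\<lambda>bs. of_bool ((\<Sum>i<n. block_norm u k B (chunk (B * k) i bs)) \<le>
      n * sqrt B * (1 - 1 / B - \<tau>))) \<le>
    avg (n * (B * k)) (\<lambda>bs. exp (\<tau> * ?a) * (\<Prod>i<n. exp (- (\<tau> * W (chunk (B * k) i bs)))))"
  proof (rule avg_mono)
    fix bs
    let ?X = "\<Sum>i<n. W (chunk (B * k) i bs)"
    have X: "(\<Sum>i<n. block_norm u k B (chunk (B * k) i bs)) = sqrt B * ?X"
      using B by (simp add: W_def sum_distrib_left)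
    have "exp (\<tau> * ?a) * (\<Prod>i<n. exp (- (\<tau> * W (chunk (B * k) i bs)))) = exp (\<tau> * (?a - ?X))"
      by (simp add: exp_sum[symmetric] sum_negf sum_distrib_left exp_add[symmetric] right_diff_distrib)
    moreover have "of_bool (sqrt B * ?X \<le> n * sqrt B * (1 - 1 / B - \<tau>)) \<le> exp (\<tau> * (?a - ?X))"
    proof (cases "sqrt B * ?X \<le> n * sqrt B * (1 - 1 / B - \<tau>)")
      case True
      then have "sqrt B * ?X \<le> sqrt B * ?a" by (simp add: mult_ac)
      then have "?X \<le> ?a" using B by simp
      then show ?thesis using \<tau> by (auto simp: of_bool_def)
    qed auto
    ultimately show "of_bool ((\<Sum>i<n. block_norm u k B (chunk (B * k) i bs)) \<le>
      n * sqrt B * (1 - 1 / B - \<tau>)) \<le>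
      exp (\<tau> * ?a) * (\<Prod>i<n. exp (- (\<tau> * W (chunk (B * k) i bs))))"
      unfolding X by simp
  qed
  also have "\<dots> = exp (\<tau> * ?a) * avg (B * k) (\<lambda>bs. exp (- (\<tau> * W bs))) ^ n"
    using avg_prod_chunk[of n "B * k" "\<lambda>b. exp (- (\<tau> * W b))"] by (simp add: avg_cmult)
  also have "\<dots> \<le> exp (\<tau> * ?a) * exp (- \<tau> * (1 - 1 / B) + \<tau>\<^sup>2 / 2) ^ n"
    by (intro mult_left_mono power_mono E) (auto simp: avg_def sum_nonneg)
  also have "\<dots> = exp (- (real n * \<tau>\<^sup>2 / 2))"
    by (simp add: exp_of_nat_mult[symmetric] exp_add[symmetric] power2_eq_square algebra_simps)
  finally show ?thesis .
qed


section \<open>Bounds on a lattice net\<close>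

text \<open>Rows of the matrix \<open>a\<close> are indexed by a block \<open>i\<close> and a place
  \<open>c\<close> inside it, columns by \<open>j\<close>.\<close>

definition lin :: "(nat \<Rightarrow> nat \<Rightarrow> nat \<Rightarrow> real) \<Rightarrow> nat \<Rightarrow> (nat \<Rightarrow> real) \<Rightarrow> nat \<Rightarrow> nat \<Rightarrow> real" where
  "lin a k u i c = (\<Sum>j<k. a i c j * u j)"

definition norm12 :: "nat \<Rightarrow> nat \<Rightarrow> (nat \<Rightarrow> nat \<Rightarrow> real) \<Rightarrow> real" where
  "norm12 n B x = (\<Sum>i<n. L2_set (x i) {..<B})"

definition norm22 :: "nat \<Rightarrow> nat \<Rightarrow> (nat \<Rightarrow> nat \<Rightarrow> real) \<Rightarrow> real" where
  "norm22 n B x = L2_set (\<lambda>i. L2_set (x i) {..<B}) {..<n}"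

lemma norm22_square: "(norm22 n B x)\<^sup>2 = (\<Sum>i<n. \<Sum>c<B. (x i c)\<^sup>2)"
  by (simp add: norm22_def L2_set_def sum_nonneg)

lemma norm12_nonneg [simp]: "norm12 n B x \<ge> 0" by (simp add: norm12_def sum_nonneg)
lemma norm22_nonneg [simp]: "norm22 n B x \<ge> 0" by (simp add: norm22_def)

lemma norm12_le_norm22: "norm12 n B x \<le> sqrt n * norm22 n B x"
proof -
  have "norm12 n B x = (\<Sum>i<n. \<bar>1\<bar> * \<bar>L2_set (x i) {..<B}\<bar>)"
    by (simp add: norm12_def)
  also have "\<dots> \<le> L2_set (\<lambda>_. 1) {..<n} * L2_set (\<lambda>i. L2_set (x i) {..<B}) {..<n}"
    by (rule L2_set_mult_ineq)
  finally show ?thesis by (simp add: norm22_def L2_set_def)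
qed

lemma norm12_triangle: "norm12 n B (\<lambda>i c. x i c + y i c) \<le> norm12 n B x + norm12 n B y"
  unfolding norm12_def sum.distrib[symmetric] by (intro sum_mono L2_set_triangle_ineq)

lemma norm22_triangle: "norm22 n B (\<lambda>i c. x i c + y i c) \<le> norm22 n B x + norm22 n B y"
proof -
  have "norm22 n B (\<lambda>i c. x i c + y i c) \<le>
     L2_set (\<lambda>i. L2_set (x i) {..<B} + L2_set (y i) {..<B}) {..<n}"
    unfolding norm22_def by (intro L2_set_mono L2_set_triangle_ineq) auto
  also have "\<dots> \<le> norm22 n B x + norm22 n B y"
    unfolding norm22_def by (rule L2_set_triangle_ineq)
  finally show ?thesis .
qed

lemma L2_set_cmult: "L2_set (\<lambda>i. r * f i) A = \<bar>r\<bar> * L2_set f A"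
  by (simp add: L2_set_def power_mult_distrib real_sqrt_mult flip: sum_distrib_left)

lemma norm12_cmult: "norm12 n B (\<lambda>i c. r * x i c) = \<bar>r\<bar> * norm12 n B x"
  by (simp add: norm12_def L2_set_cmult sum_distrib_left)

lemma norm22_cmult: "norm22 n B (\<lambda>i c. r * x i c) = \<bar>r\<bar> * norm22 n B x"
  by (simp add: norm22_def L2_set_cmult)

lemma lin_add: "lin a k (\<lambda>j. u j + v j) i c = lin a k u i c + lin a k v i c"
  by (simp add: lin_def algebra_simps sum.distrib)

lemma lin_cmult: "lin a k (\<lambda>j. r * u j) i c = r * lin a k u i c"
  by (simp add: lin_def algebra_simps sum_distrib_left)

text \<open>Rounding goes towards zero: no coordinate grows, so the lattice point stays in the ball
  of the net, and each coordinate moves by at most 1.\<close>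

lemma round_to_lattice:
  fixes w :: "nat \<Rightarrow> real"
  obtains z :: "nat \<Rightarrow> int" where
    "L2_set (\<lambda>j. of_int (z j)) {..<k} \<le> L2_set w {..<k}"
    "L2_set (\<lambda>j. w j - of_int (z j)) {..<k} \<le> sqrt k"
proof
  define z where "z = (\<lambda>j. if w j \<ge> 0 then \<lfloor>w j\<rfloor> else \<lceil>w j\<rceil>)"
  have 1: "\<bar>real_of_int (z j)\<bar> \<le> \<bar>w j\<bar>" for j
    unfolding z_def
    using of_int_floor_le[of "w j"] le_of_int_ceiling[of "w j"]
      zero_le_floor[of "w j"] ceiling_le_zero[of "w j"] by (cases "w j \<ge> 0") auto
  have 2: "\<bar>w j - real_of_int (z j)\<bar> \<le> 1" for j
  proof (cases "w j \<ge> 0")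
    case True
    show ?thesis unfolding z_def if_P[OF True] using floor_correct[of "w j"] by linarith
  next
    case False
    show ?thesis unfolding z_def if_not_P[OF False] using ceiling_correct[of "w j"] by linarith
  qed
  show "L2_set (\<lambda>j. of_int (z j)) {..<k} \<le> L2_set w {..<k}"
    unfolding L2_set_def by (intro real_sqrt_le_mono sum_mono) (use 1 in \<open>simp add: abs_le_square_iff[symmetric]\<close>)
  have "L2_set (\<lambda>j. w j - of_int (z j)) {..<k} \<le> L2_set (\<lambda>_. 1) {..<k}"
    unfolding L2_set_def
    by (intro real_sqrt_le_mono sum_mono) (use 2 in \<open>simp add: abs_square_le_1\<close>)
  then show "L2_set (\<lambda>j. w j - of_int (z j)) {..<k} \<le> sqrt k" by (simp add: L2_set_def)
qed

text \<open>The deterministic half of the net argument. After scaling to radius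
  \<open>sqrt k * H\<close>, rounding to integers has relative error 1/H, so the integer points of
  this ball act as a net of mesh 1/H. The upper hypothesis is measured against the radius, the lower
  one against the norm of \<open>z\<close> itself.\<close>

locale net_bounds =
  fixes a :: "nat \<Rightarrow> nat \<Rightarrow> nat \<Rightarrow> real" and n B k H :: nat and \<tau> :: real
  assumes a: "\<And>i c j. i < n \<Longrightarrow> c < B \<Longrightarrow> j < k \<Longrightarrow> \<bar>a i c j\<bar> \<le> 1"
    and k: "k > 0" and H: "H \<ge> 2" and \<tau>: "0 < \<tau>" "\<tau> \<le> 1 / 2"
    and upper: "\<And>z. (\<Sum>j<k. (z j)\<^sup>2) \<le> int (k * H\<^sup>2) \<Longrightarrow>
       (norm22 n B (lin a k (\<lambda>j. of_int (z j))))\<^sup>2 \<le> real (n * B) * (1 + \<tau>) * (k * H\<^sup>2)"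
    and lower: "\<And>z. (\<Sum>j<k. (z j)\<^sup>2) \<le> int (k * H\<^sup>2) \<Longrightarrow>
       norm12 n B (lin a k (\<lambda>j. of_int (z j))) \<ge>
         n * sqrt B * (1 - 2 * \<tau>) * L2_set (\<lambda>j. of_int (z j)) {..<k}"
begin

definition G where "G u = norm22 n B (lin a k u)"
definition F where "F u = norm12 n B (lin a k u)"
definition nrm where "nrm (u :: nat \<Rightarrow> real) = L2_set u {..<k}"
definition \<alpha> where "\<alpha> = sqrt (real (n * B) * (1 + \<tau>))"

lemma G_triangle: "G (\<lambda>j. u j + v j) \<le> G u + G v"
  unfolding G_def lin_add by (rule norm22_triangle)

lemma F_triangle: "F (\<lambda>j. u j + v j) \<le> F u + F v"
  unfolding F_def lin_add by (rule norm12_triangle)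

lemma G_cmult: "G (\<lambda>j. r * u j) = \<bar>r\<bar> * G u"
  unfolding G_def lin_cmult by (rule norm22_cmult)

lemma F_cmult: "F (\<lambda>j. r * u j) = \<bar>r\<bar> * F u"
  unfolding F_def lin_cmult by (rule norm12_cmult)

lemma F_le_G: "F u \<le> sqrt n * G u"
  unfolding F_def G_def by (rule norm12_le_norm22)

lemma nrm_zero_imp: "nrm u = 0 \<Longrightarrow> G u = 0 \<and> F u = 0"
proof -
  assume "nrm u = 0"
  then have "\<And>j. j < k \<Longrightarrow> u j = 0"
    by (auto simp: nrm_def L2_set_eq_0_iff)
  then have "lin a k u i c = 0" for i c by (simp add: lin_def)
  then show ?thesis by (simp add: G_def F_def norm22_def norm12_def L2_set_def)
qed

lemma nrm_cmult: "nrm (\<lambda>j. r * u j) = \<bar>r\<bar> * nrm u"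
  unfolding nrm_def by (rule L2_set_cmult)

text \<open>Reduces a homogeneous property to vectors of norm \<open>sqrt k * H\<close> and supplies
  a nearby net point; vectors of norm 0 cannot be rescaled and are left to a separate
  hypothesis.\<close>

lemma scaled:
  assumes "\<And>w z. nrm w = sqrt k * H \<Longrightarrow> nrm (\<lambda>j. of_int (z j)) \<le> nrm w \<Longrightarrow>
     (\<Sum>j<k. (z j)\<^sup>2) \<le> int (k * H\<^sup>2) \<Longrightarrow>
     nrm (\<lambda>j. w j - of_int (z j)) \<le> sqrt k \<Longrightarrow> \<exists>r. w = (\<lambda>j. r * u j) \<Longrightarrow> Q w"
    and Q: "\<And>r. r > 0 \<Longrightarrow> Q (\<lambda>j. r * u j) \<Longrightarrow> Q u"
    and "nrm u = 0 \<Longrightarrow> Q u"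
  shows "Q u"
proof (cases "nrm u = 0")
  case False
  then have pos: "nrm u > 0" by (simp add: nrm_def less_le)
  define r where "r = sqrt k * H / nrm u"
  have r: "r > 0" using pos k H by (simp add: r_def)
  let ?w = "\<lambda>j. r * u j"
  have w: "nrm ?w = sqrt k * H"
    unfolding nrm_cmult using r pos by (simp add: r_def)
  obtain z where z: "nrm (\<lambda>j. of_int (z j)) \<le> nrm ?w" "nrm (\<lambda>j. ?w j - of_int (z j)) \<le> sqrt k"
    unfolding nrm_def by (rule round_to_lattice)
  have "(nrm (\<lambda>j. of_int (z j)))\<^sup>2 \<le> (sqrt k * H)\<^sup>2"
    using z(1) w by (intro power_mono) (auto simp: nrm_def)
  then have "(\<Sum>j<k. (real_of_int (z j))\<^sup>2) \<le> k * (real H)\<^sup>2"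
    by (simp add: nrm_def L2_set_def sum_nonneg power_mult_distrib)
  then have "real_of_int (\<Sum>j<k. (z j)\<^sup>2) \<le> real_of_int (int (k * H\<^sup>2))" by simp
  then have "(\<Sum>j<k. (z j)\<^sup>2) \<le> int (k * H\<^sup>2)" by (simp only: of_int_le_iff)
  then have "Q ?w" using assms(1)[OF w z(1)] z(2) by blast
  then show ?thesis using Q r by blast
qed (use assms(3) in auto)

text \<open>A bootstrap: the net point obeys the hypothesis of the locale, and the remainder,
  shorter by a factor H, the bound already known.\<close>

lemma G_step:
  assumes K: "\<And>u. G u \<le> K * nrm u"
  shows "G u \<le> (\<alpha> + K / H) * nrm u"
proof (rule scaled[where Q = "\<lambda>u. G u \<le> (\<alpha> + K / H) * nrm u"])
  fix w and z :: "nat \<Rightarrow> int"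
  assume w: "nrm w = sqrt k * H" and z: "(\<Sum>j<k. (z j)\<^sup>2) \<le> int (k * H\<^sup>2)"
    and d: "nrm (\<lambda>j. w j - of_int (z j)) \<le> sqrt k"
  have K0: "K \<ge> 0"
  proof -
    have "0 \<le> G w" by (simp add: G_def)
    also have "\<dots> \<le> K * (sqrt k * H)" using K[of w] w by simp
    finally have "0 \<le> K * (sqrt k * H)" .
    moreover have "sqrt k * H > 0" using k H by simp
    ultimately show ?thesis by (simp only: zero_le_mult_iff) linarith
  qed
  have "G w \<le> G (\<lambda>j. of_int (z j)) + G (\<lambda>j. w j - of_int (z j))"
    using G_triangle[of "\<lambda>j. of_int (z j)" "\<lambda>j. w j - of_int (z j)"] by simp
  also have "G (\<lambda>j. of_int (z j)) \<le> \<alpha> * (sqrt k * H)"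
  proof -
    have "(G (\<lambda>j. of_int (z j)))\<^sup>2 \<le> (\<alpha> * (sqrt k * H))\<^sup>2"
      using upper[OF z] \<tau> by (simp add: G_def \<alpha>_def power_mult_distrib mult_ac)
    then show ?thesis
      by (rule power2_le_imp_le) (use \<tau> in \<open>simp add: \<alpha>_def\<close>)
  qed
  also have "G (\<lambda>j. w j - of_int (z j)) \<le> K * sqrt k"
    using K[of "\<lambda>j. w j - of_int (z j)"] mult_left_mono[OF d K0] by linarith
  also have "\<alpha> * (sqrt k * H) + K * sqrt k = (\<alpha> + K / H) * nrm w"
    using H w by (simp add: field_simps)
  finally show "G w \<le> (\<alpha> + K / H) * nrm w" by simp
next
  fix r :: real assume "r > 0" "G (\<lambda>j. r * u j) \<le> (\<alpha> + K / H) * nrm (\<lambda>j. r * u j)"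
  then show "G u \<le> (\<alpha> + K / H) * nrm u"
    unfolding G_cmult nrm_cmult by (simp add: mult.left_commute)
next
  assume "nrm u = 0"
  then show "G u \<le> (\<alpha> + K / H) * nrm u" using nrm_zero_imp[of u] by simp
qed

text \<open>Any finite bound can start the iteration; this one comes from the size of the entries
  alone.\<close>

lemma G_crude: "G u \<le> sqrt (n * B * k) * nrm u"
proof -
  have lin: "(lin a k u i c)\<^sup>2 \<le> k * (nrm u)\<^sup>2" if "i < n" "c < B" for i c
  proof -
    have "\<bar>lin a k u i c\<bar> \<le> (\<Sum>j<k. \<bar>a i c j\<bar> * \<bar>u j\<bar>)"
      unfolding lin_def by (rule order_trans[OF sum_abs]) (simp add: abs_mult)
    also have "\<dots> \<le> (\<Sum>j<k. \<bar>1\<bar> * \<bar>u j\<bar>)"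
      using a[OF that] by (intro sum_mono mult_right_mono) auto
    also have "\<dots> \<le> L2_set (\<lambda>_. 1) {..<k} * nrm u"
      unfolding nrm_def by (rule L2_set_mult_ineq)
    also have "L2_set (\<lambda>_. 1) {..<k} = sqrt k" by (simp add: L2_set_def)
    finally have "\<bar>lin a k u i c\<bar> \<le> sqrt k * nrm u" .
    then have "\<bar>lin a k u i c\<bar>\<^sup>2 \<le> (sqrt k * nrm u)\<^sup>2" by (intro power_mono) auto
    then show ?thesis by (simp add: power_mult_distrib)
  qed
  have "(G u)\<^sup>2 \<le> (\<Sum>i<n. \<Sum>c<B. k * (nrm u)\<^sup>2)"
    unfolding G_def norm22_square by (intro sum_mono lin) auto
  also have "\<dots> = (sqrt (n * B * k) * nrm u)\<^sup>2" by (simp add: power_mult_distrib mult_ac)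
  finally show ?thesis by (rule power2_le_imp_le) (simp add: nrm_def)
qed

lemma alpha_nonneg: "\<alpha> \<ge> 0" using \<tau> by (simp add: \<alpha>_def)

lemma nrm_nonneg [simp]: "nrm u \<ge> 0" by (simp add: nrm_def)

text \<open>As H \<ge> 2, a bootstrap step at least halves the excess over 2\<alpha>; the limit
  removes the crude starting bound.\<close>

lemma G_bound_2: "G u \<le> 2 * \<alpha> * nrm u"
proof -
  let ?K = "sqrt (n * B * k)"
  have "\<forall>u. G u \<le> (2 * \<alpha> + ?K / 2 ^ t) * nrm u" for t
  proof (induction t)
    case 0
    show ?case
    proof
      fix u
      have "G u \<le> ?K * nrm u" by (rule G_crude)
      also have "\<dots> \<le> (2 * \<alpha> + ?K / 2 ^ 0) * nrm u"
        using alpha_nonneg by (intro mult_right_mono) auto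
      finally show "G u \<le> (2 * \<alpha> + ?K / 2 ^ 0) * nrm u" .
    qed
  next
    case (Suc t)
    show ?case
    proof
      fix u
      have "G u \<le> (\<alpha> + (2 * \<alpha> + ?K / 2 ^ t) / H) * nrm u"
        using Suc by (intro G_step) auto
      also have "\<dots> \<le> (\<alpha> + (2 * \<alpha> + ?K / 2 ^ t) / 2) * nrm u"
        using alpha_nonneg H by (intro mult_right_mono add_left_mono divide_left_mono) auto
      finally show "G u \<le> (2 * \<alpha> + ?K / 2 ^ Suc t) * nrm u" by (simp add: field_simps)
    qed
  qed
  then have le: "G u \<le> (2 * \<alpha> + ?K / 2 ^ t) * nrm u" for t by blast
  have "(\<lambda>t. (2 * \<alpha> + ?K * (1 / 2) ^ t) * nrm u) \<longlonglongrightarrow> (2 * \<alpha> + ?K * 0) * nrm u"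
    by (intro tendsto_mult tendsto_add tendsto_const LIMSEQ_power_zero) auto
  moreover have "G u \<le> (2 * \<alpha> + ?K * (1 / 2) ^ t) * nrm u" for t
    using le[of t] by (simp add: power_divide)
  ultimately have "G u \<le> (2 * \<alpha> + ?K * 0) * nrm u"
    by (intro LIMSEQ_le_const) auto
  then show ?thesis by simp
qed

lemma G_bound: "G u \<le> \<alpha> * (1 + 2 / H) * nrm u"
  using G_step[OF G_bound_2, of u] by (simp add: algebra_simps)

text \<open>The bound at the net point minus the upper estimate of the remainder. Of the loss 4/H,
  one part comes from the net point being shorter by up to \<open>sqrt k\<close>, and three from the
  remainder, whose \<open>G\<close> is at most 2\<alpha> times \<open>sqrt k\<close> with \<alpha>
  \<le> 3/2 \<open>sqrt (n * B)\<close>.\<close>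

lemma F_bound: "F u \<ge> n * sqrt B * (1 - 2 * \<tau> - 4 / H) * nrm u"
proof (rule scaled[where Q = "\<lambda>u. F u \<ge> n * sqrt B * (1 - 2 * \<tau> - 4 / H) * nrm u"])
  fix w and z :: "nat \<Rightarrow> int"
  assume w: "nrm w = sqrt k * H" and z: "(\<Sum>j<k. (z j)\<^sup>2) \<le> int (k * H\<^sup>2)"
    and d: "nrm (\<lambda>j. w j - of_int (z j)) \<le> sqrt k"
  let ?n = "n * sqrt B * (1 - 2 * \<tau>)"
  have n0: "?n \<ge> 0" using \<tau> by simp
  let ?d = "\<lambda>j. of_int (z j) - w j"
  have d': "nrm ?d \<le> sqrt k"
    using d nrm_cmult[of "-1" "\<lambda>j. w j - of_int (z j)"] by simp
  have "sqrt k * H \<le> nrm (\<lambda>j. of_int (z j)) + nrm (\<lambda>j. w j - of_int (z j))"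
    using L2_set_triangle_ineq[of "\<lambda>j. of_int (z j)" "\<lambda>j. w j - of_int (z j)" "{..<k}"] w
    by (simp add: nrm_def)
  then have z1: "nrm (\<lambda>j. of_int (z j)) \<ge> sqrt k * (H - 1)"
    using d H by (simp add: algebra_simps of_nat_diff)
  have \<alpha>: "\<alpha> \<le> 3 / 2 * sqrt (n * B)"
  proof -
    have "\<alpha> \<le> sqrt ((3 / 2)\<^sup>2 * (n * B))"
      unfolding \<alpha>_def using \<tau> mult_right_mono[of "1 + \<tau>" "9 / 4" "real n * real B"]
      by (intro real_sqrt_le_mono) (simp add: power2_eq_square mult.commute)
    then show ?thesis by (simp add: real_sqrt_mult)
  qed
  have "?n * (sqrt k * (H - 1)) \<le> ?n * nrm (\<lambda>j. of_int (z j))"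
    using z1 n0 by (rule mult_left_mono)
  also have "\<dots> \<le> F (\<lambda>j. of_int (z j))"
    using lower[OF z] by (simp add: F_def nrm_def)
  also have "\<dots> \<le> F w + F ?d"
    using F_triangle[of w ?d] by simp
  also have "F ?d \<le> sqrt n * (2 * \<alpha> * sqrt k)"
  proof -
    have "F ?d \<le> sqrt n * (2 * \<alpha> * nrm ?d)"
      by (rule order_trans[OF F_le_G mult_left_mono[OF G_bound_2]]) simp
    also have "\<dots> \<le> sqrt n * (2 * \<alpha> * sqrt k)"
      using d' alpha_nonneg by (intro mult_left_mono) auto
    finally show ?thesis .
  qed
  also have "\<dots> \<le> sqrt n * (2 * (3 / 2 * sqrt (n * B)) * sqrt k)"
    using \<alpha> by (intro mult_left_mono mult_right_mono) auto
  also have "\<dots> = 3 * n * sqrt B * sqrt k"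
    by (simp add: real_sqrt_mult)
  finally have *: "F w \<ge> ?n * (sqrt k * (H - 1)) - 3 * n * sqrt B * sqrt k" by simp
  have "n * sqrt B * (1 - 2 * \<tau> - 4 / H) * nrm w =
     n * sqrt B * sqrt k * ((1 - 2 * \<tau>) * H - 4)"
    using H w by (simp add: field_simps)
  also have "\<dots> \<le> n * sqrt B * sqrt k * ((1 - 2 * \<tau>) * (H - 1) - 3)"
    using \<tau> H by (intro mult_left_mono) (auto simp: algebra_simps of_nat_diff)
  also have "\<dots> = ?n * (sqrt k * (H - 1)) - 3 * n * sqrt B * sqrt k"
    by (simp add: algebra_simps)
  finally show "F w \<ge> n * sqrt B * (1 - 2 * \<tau> - 4 / H) * nrm w" using * by linarith
next
  fix r :: real
  assume "r > 0" "F (\<lambda>j. r * u j) \<ge> n * sqrt B * (1 - 2 * \<tau> - 4 / H) * nrm (\<lambda>j. r * u j)"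
  then show "F u \<ge> n * sqrt B * (1 - 2 * \<tau> - 4 / H) * nrm u"
    unfolding F_cmult nrm_cmult by (simp add: mult.left_commute)
next
  assume "nrm u = 0"
  then show "F u \<ge> n * sqrt B * (1 - 2 * \<tau> - 4 / H) * nrm u" using nrm_zero_imp[of u] by simp
qed

end

section \<open>Cardinality of the lattice net\<close>

lemma sum_half_powers: "(\<Sum>z\<in>{- int R..int R}. (1 / 2 :: real) ^ nat \<bar>z\<bar>) \<le> 3"
proof -
  have "(\<Sum>z\<in>{- int R..int R}. (1 / 2 :: real) ^ nat \<bar>z\<bar>) = 3 - 2 * (1 / 2) ^ R"
  proof (induction R)
    case (Suc R)
    have "{- int (Suc R)..int (Suc R)} = insert (int (Suc R)) (insert (- int (Suc R)) {- int R..int R})"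
      by auto
    then show ?case using Suc by (simp add: nat_add_distrib)
  qed simp
  then show ?thesis by simp
qed

text \<open>Extensional functions make the set finite; since |z| \<le> z^2 for integers, the box
  contains the whole ball.\<close>

definition net :: "nat \<Rightarrow> nat \<Rightarrow> (nat \<Rightarrow> int) set" where
  "net k H = {z \<in> PiE {..<k} (\<lambda>_. {- int (k * H\<^sup>2)..int (k * H\<^sup>2)}). (\<Sum>j<k. (z j)\<^sup>2) \<le> int (k * H\<^sup>2)}"

lemma finite_net [simp]: "finite (net k H)"
  unfolding net_def by (intro finite_subset[OF _ finite_PiE[of "{..<k}" "\<lambda>_. {- int (k * H\<^sup>2)..int (k * H\<^sup>2)}"]]) auto

lemma abs_le_square_int: "\<bar>z\<bar> \<le> z\<^sup>2" for z :: int
proof (cases "z = 0")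
  case False
  then have "\<bar>z\<bar> * 1 \<le> \<bar>z\<bar> * \<bar>z\<bar>" by (intro mult_left_mono) auto
  then show ?thesis by (simp add: power2_eq_square)
qed simp

text \<open>Instead of comparing volumes, every point of the net gets a weight 2^(kH^2 - sum of
  |z_j|) \<ge> 1, which factors over the coordinates. The base depends on H only, so the growth is
  exponential in k.\<close>

lemma card_net: "real (card (net k H)) \<le> (3 * 2 ^ (H\<^sup>2)) ^ k"
proof -
  let ?R = "k * H\<^sup>2"
  let ?P = "PiE {..<k} (\<lambda>_. {- int ?R..int ?R})"
  have fin: "finite ?P" by (intro finite_PiE) auto
  have "real (card (net k H)) = (\<Sum>z\<in>net k H. 1)" by simp
  also have "\<dots> \<le> (\<Sum>z\<in>net k H. \<Prod>j<k. 2 ^ (H\<^sup>2) * (1 / 2) ^ nat \<bar>z j\<bar>)"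
  proof (rule sum_mono)
    fix z assume "z \<in> net k H"
    then have "(\<Sum>j<k. (z j)\<^sup>2) \<le> int ?R" by (simp add: net_def)
    moreover have "\<bar>z j\<bar> \<le> (z j)\<^sup>2" for j
      by (rule abs_le_square_int)
    then have "(\<Sum>j<k. \<bar>z j\<bar>) \<le> (\<Sum>j<k. (z j)\<^sup>2)" by (rule sum_mono)
    ultimately have "int (\<Sum>j<k. nat \<bar>z j\<bar>) \<le> int ?R" by simp
    then have le: "(\<Sum>j<k. nat \<bar>z j\<bar>) \<le> k * H\<^sup>2" by (simp only: of_nat_le_iff)
    have "1 = (2::real) ^ (k * H\<^sup>2) * (1 / 2) ^ (k * H\<^sup>2)"
      by (simp add: power_mult_distrib[symmetric])
    also have "\<dots> \<le> 2 ^ (k * H\<^sup>2) * (1 / 2) ^ (\<Sum>j<k. nat \<bar>z j\<bar>)"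
      using le by (intro mult_left_mono power_decreasing) auto
    also have "\<dots> = (\<Prod>j<k. 2 ^ (H\<^sup>2) * (1 / 2) ^ nat \<bar>z j\<bar>)"
      by (simp add: prod.distrib power_sum power_mult[symmetric] mult.commute)
    finally show "1 \<le> (\<Prod>j<k. 2 ^ (H\<^sup>2) * (1 / 2 :: real) ^ nat \<bar>z j\<bar>)" .
  qed
  also have "\<dots> \<le> (\<Sum>z\<in>?P. \<Prod>j<k. 2 ^ (H\<^sup>2) * (1 / 2) ^ nat \<bar>z j\<bar>)"
    by (rule sum_mono2[OF fin]) (use net_def in blast, simp add: prod_nonneg)
  also have "\<dots> = (\<Prod>j<k. \<Sum>y\<in>{- int ?R..int ?R}. 2 ^ (H\<^sup>2) * (1 / 2) ^ nat \<bar>y\<bar>)"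
    by (rule prod_sum_PiE[symmetric]) auto
  also have "\<dots> = (2 ^ (H\<^sup>2) * (\<Sum>y\<in>{- int ?R..int ?R}. (1 / 2) ^ nat \<bar>y\<bar>)) ^ k"
    by (simp add: sum_distrib_left)
  also have "\<dots> \<le> (2 ^ (H\<^sup>2) * 3) ^ k"
    by (intro power_mono mult_left_mono sum_half_powers) (auto intro!: mult_nonneg_nonneg sum_nonneg)
  finally show ?thesis by (simp add: mult.commute)
qed

lemma restrict_in_net:
  assumes "(\<Sum>j<k. (z j)\<^sup>2) \<le> int (k * H\<^sup>2)"
  shows "restrict z {..<k} \<in> net k H"
proof -
  have "z j \<in> {- int (k * H\<^sup>2)..int (k * H\<^sup>2)}" if "j < k" for j
  proof -
    have "\<bar>z j\<bar> \<le> (z j)\<^sup>2"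
      by (rule abs_le_square_int)
    also have "\<dots> \<le> (\<Sum>j<k. (z j)\<^sup>2)" using that by (intro member_le_sum) auto
    finally show ?thesis using assms by auto
  qed
  then show ?thesis using assms by (auto simp: net_def)
qed


section \<open>Random sign matrices\<close>

lemma sum_lessThan_add: "(\<Sum>l<a + b. f l) = (\<Sum>l<a. f l) + (\<Sum>l<b. f (a + l))"
  for f :: "nat \<Rightarrow> 'a::comm_monoid_add"
  by (induction b) (auto simp: add.assoc)

lemma sum_nat_mult: "(\<Sum>l<n * B. f l) = (\<Sum>i<n. \<Sum>c<B. f (i * B + c))"
  for f :: "nat \<Rightarrow> 'a::comm_monoid_add"
proof (induction n)
  case (Suc n)
  have "(\<Sum>l<Suc n * B. f l) = (\<Sum>l<n * B + B. f l)" by (simp add: add.commute)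
  then show ?case by (simp add: sum_lessThan_add Suc.IH)
qed simp

text \<open>A reverse Cauchy-Schwarz inequality on the column space: \<beta> = 1 would force all
  blocks of every vector there to have equal norm.\<close>

definition spread :: "real \<Rightarrow> nat \<Rightarrow> nat \<Rightarrow> nat \<Rightarrow> (nat \<Rightarrow> nat \<Rightarrow> nat \<Rightarrow> real) \<Rightarrow> bool" where
  "spread \<beta> n B k a \<longleftrightarrow> (\<forall>u. \<beta> * sqrt n * norm22 n B (lin a k u) \<le> norm12 n B (lin a k u))"

text \<open>The bits fill the sign part row by row. In the appended part, block \<open>n + j\<close>
  repeats coordinate \<open>j\<close> of the argument at all its B places, which fits the identity
  into the block form.\<close>

definition base_matrix :: "nat \<Rightarrow> nat \<Rightarrow> nat \<Rightarrow> bool list \<Rightarrow> nat \<Rightarrow> nat \<Rightarrow> nat \<Rightarrow> real" where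
  "base_matrix n B k bs i c j =
     (if i < n then sgn_bit (bs ! ((i * B + c) * k + j)) else of_bool (i = n + j))"

lemma signed_sum_chunk:
  "l * k \<le> length bs \<Longrightarrow> signed_sum u k (chunk k l bs) = (\<Sum>j<k. sgn_bit (bs ! (l * k + j)) * u j)"
  unfolding signed_sum_def chunk_def by (intro sum.cong) auto

lemma index_le:
  assumes "i < n" "c < B" "length bs \<ge> n * B * k"
  shows "(i * B + c) * k \<le> length bs" "i * (B * k) + c * k + k \<le> length bs"
proof -
  have "i * B + c + 1 \<le> n * B"
    using assms(1,2) by (metis Suc_eq_plus1 Suc_leI add_less_cancel_left le_trans mult_Suc mult_le_mono1 add.commute)
  then have "(i * B + c + 1) * k \<le> n * B * k" by (rule mult_le_mono1)
  then show "(i * B + c) * k \<le> length bs" "i * (B * k) + c * k + k \<le> length bs"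
    using assms(3) by (simp_all add: algebra_simps)
qed

lemma lin_base_matrix:
  assumes "i < n" "c < B" "length bs \<ge> n * B * k"
  shows "lin (base_matrix n B k bs) k u i c = signed_sum u k (chunk k (i * B + c) bs)"
  using assms index_le[OF assms] by (simp add: signed_sum_chunk lin_def base_matrix_def)

lemma nth_chunk: "j < m \<Longrightarrow> i * m + m \<le> length bs \<Longrightarrow> chunk m i bs ! j = bs ! (i * m + j)"
  by (simp add: chunk_def)

text \<open>The bits of block \<open>i\<close> form one chunk of length \<open>B * k\<close>, so the
  norms of different blocks are independent.\<close>

lemma block_norm_chunk:
  assumes "i < n" "length bs \<ge> n * B * k"
  shows "block_norm u k B (chunk (B * k) i bs) = L2_set (lin (base_matrix n B k bs) k u i) {..<B}"
proof -
  have "signed_sum u k (chunk k c (chunk (B * k) i bs)) = lin (base_matrix n B k bs) k u i c" if c: "c < B" for c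
  proof -
    have le: "c * k + k \<le> B * k" using c by (metis Suc_leI add.commute mult_Suc mult_le_mono1)
    have "Suc i * (B * k) \<le> n * (B * k)" using assms(1) by (intro mult_le_mono1) simp
    then have le2: "i * (B * k) + B * k \<le> length bs" using assms(2) by (simp add: mult.assoc)
    have "chunk k c (chunk (B * k) i bs) ! j = bs ! ((i * B + c) * k + j)" if "j < k" for j
    proof -
      have "chunk k c (chunk (B * k) i bs) ! j = chunk (B * k) i bs ! (c * k + j)"
        using that le le2 by (intro nth_chunk) (auto simp: chunk_def)
      also have "\<dots> = bs ! (i * (B * k) + (c * k + j))"
        using that le le2 by (intro nth_chunk) auto
      finally show ?thesis by (simp add: algebra_simps)
    qed
    then show ?thesis
      using assms by (simp add: signed_sum_def lin_def base_matrix_def)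
  qed
  then show ?thesis by (simp add: block_norm_def L2_set_def)
qed

lemma norm12_cong: "(\<And>i c. i < n \<Longrightarrow> c < B \<Longrightarrow> x i c = y i c) \<Longrightarrow> norm12 n B x = norm12 n B y"
  unfolding norm12_def L2_set_def by simp

lemma norm22_cong: "(\<And>i c. i < n \<Longrightarrow> c < B \<Longrightarrow> x i c = y i c) \<Longrightarrow> norm22 n B x = norm22 n B y"
  unfolding norm22_def L2_set_def by simp

lemma signed_sum_divide: "signed_sum (\<lambda>j. u j / r) k bs = signed_sum u k bs / r"
  by (simp add: signed_sum_def sum_divide_distrib)

lemma block_norm_divide: "r > 0 \<Longrightarrow> block_norm (\<lambda>j. u j / r) k B bs = block_norm u k B bs / r"
  by (simp add: block_norm_def signed_sum_divide power_divide sum_divide_distrib[symmetric] real_sqrt_divide)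

text \<open>The coefficients are divided by the radius of the net here, and by their own norm in
  \<open>bad_lower\<close>: the upper tail bound asks for norm at most 1, the lower one for norm
  exactly 1.\<close>

definition bad_upper :: "nat \<Rightarrow> nat \<Rightarrow> nat \<Rightarrow> nat \<Rightarrow> real \<Rightarrow> (nat \<Rightarrow> int) \<Rightarrow> bool list \<Rightarrow> bool" where
  "bad_upper n B k H \<tau> z bs \<longleftrightarrow>
     (\<Sum>l<n * B. (signed_sum (\<lambda>j. of_int (z j) / (sqrt k * H)) k (chunk k l bs))\<^sup>2) \<ge> (n * B) * (1 + \<tau>)"

definition bad_lower :: "nat \<Rightarrow> nat \<Rightarrow> nat \<Rightarrow> real \<Rightarrow> (nat \<Rightarrow> int) \<Rightarrow> bool list \<Rightarrow> bool" where
  "bad_lower n B k \<tau> z bs \<longleftrightarrow> L2_set (\<lambda>j. of_int (z j)) {..<k} > 0 \<and>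
     (\<Sum>i<n. block_norm (\<lambda>j. of_int (z j) / L2_set (\<lambda>j. of_int (z j)) {..<k}) k B (chunk (B * k) i bs))
        \<le> n * sqrt B * (1 - 1 / B - \<tau>)"

lemma avg_bad_upper:
  assumes z: "z \<in> net k H" and "k > 0" "H > 0" "0 < \<tau>" "\<tau> \<le> 1" "B > 0"
  shows "avg (n * B * k) (\<lambda>bs. of_bool (bad_upper n B k H \<tau> z bs)) \<le> exp (- (real n * \<tau>\<^sup>2 / 16))"
proof -
  have "(\<Sum>j<k. (real_of_int (z j))\<^sup>2) = real_of_int (\<Sum>j<k. (z j)\<^sup>2)" by simp
  also have "\<dots> \<le> real_of_int (int (k * H\<^sup>2))"
    using z by (subst of_int_le_iff) (simp add: net_def)
  finally have "(\<Sum>j<k. (real_of_int (z j))\<^sup>2) \<le> k * (real H)\<^sup>2" by simp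
  then have "(\<Sum>j<k. (real_of_int (z j) / (sqrt k * H))\<^sup>2) \<le> 1"
    using assms by (simp add: power_divide power_mult_distrib sum_divide_distrib[symmetric])
  then have "avg (n * B * k) (\<lambda>bs. of_bool (bad_upper n B k H \<tau> z bs)) \<le> exp (- (real (n * B) * \<tau>\<^sup>2 / 16))"
    unfolding bad_upper_def using assms avg_upper_tail[where u = "\<lambda>j. real_of_int (z j) / (sqrt k * H)" and k = k and \<tau> = \<tau> and R = "n * B"]
    by simp
  \<comment> \<open>The exponent is weakened from n B to n so that both kinds of failure share one
    bound.\<close>
  also have "\<dots> \<le> exp (- (real n * \<tau>\<^sup>2 / 16))"
    using \<open>B > 0\<close> mult_left_mono[of 1 "real B" "real n * \<tau>\<^sup>2"] by (simp add: mult_ac)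
  finally show ?thesis .
qed

lemma avg_bad_lower:
  assumes "0 < \<tau>" "B > 0"
  shows "avg (n * B * k) (\<lambda>bs. of_bool (bad_lower n B k \<tau> z bs)) \<le> exp (- (real n * \<tau>\<^sup>2 / 16))"
proof (cases "L2_set (\<lambda>j. real_of_int (z j)) {..<k} > 0")
  case True
  let ?r = "L2_set (\<lambda>j. real_of_int (z j)) {..<k}"
  have "(\<Sum>j<k. (real_of_int (z j))\<^sup>2) = ?r\<^sup>2"
    by (simp add: L2_set_def sum_nonneg)
  then have "(\<Sum>j<k. (real_of_int (z j) / ?r)\<^sup>2) = 1"
    using True by (simp add: power_divide sum_divide_distrib[symmetric])
  from avg_lower_tail[OF this assms, of n]
  have "avg (n * B * k) (\<lambda>bs. of_bool (bad_lower n B k \<tau> z bs)) \<le> exp (- (real n * \<tau>\<^sup>2 / 2))"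
    using True by (simp add: bad_lower_def mult.assoc)
  also have "\<dots> \<le> exp (- (real n * \<tau>\<^sup>2 / 16))" by simp
  finally show ?thesis .
next
  case False
  then have "(\<lambda>bs. of_bool (bad_lower n B k \<tau> z bs)) = (\<lambda>bs. 0::real)"
    by (auto simp: bad_lower_def fun_eq_iff)
  then show ?thesis by simp
qed

lemma net_bounds_base_matrix:
  assumes L: "length bs = n * B * k"
    and good: "\<And>z. z \<in> net k H \<Longrightarrow> \<not> bad_upper n B k H \<tau> z bs \<and> \<not> bad_lower n B k \<tau> z bs"
    and k: "k > 0" and H: "H \<ge> 2" and \<tau>: "0 < \<tau>" "\<tau> \<le> 1 / 2" and B: "B > 0" "1 / B \<le> \<tau>"
  shows "net_bounds (base_matrix n B k bs) n B k H \<tau>"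
proof
  show "\<bar>base_matrix n B k bs i c j\<bar> \<le> 1" for i c j
    by (auto simp: base_matrix_def sgn_bit_def)
next
  fix z :: "nat \<Rightarrow> int"
  assume z: "(\<Sum>j<k. (z j)\<^sup>2) \<le> int (k * H\<^sup>2)"
  \<comment> \<open>The net consists of extensional functions, so \<open>z\<close> is cut off
    outside the first \<open>k\<close> indices, which neither \<open>lin\<close> nor the norm
    sees.\<close>
  define z' where "z' = restrict z {..<k}"
  have z': "z' \<in> net k H" unfolding z'_def using z by (rule restrict_in_net)
  have lin: "lin a k (\<lambda>j. of_int (z j)) = lin a k (\<lambda>j. of_int (z' j))" for a
    by (auto simp: lin_def z'_def fun_eq_iff)
  have L2: "L2_set (\<lambda>j. of_int (z j)) {..<k} = L2_set (\<lambda>j. of_int (z' j)) {..<k}"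
    by (auto simp: z'_def L2_set_def)
  let ?x = "lin (base_matrix n B k bs) k (\<lambda>j. real_of_int (z' j))"
  let ?s = "sqrt k * H"
  have s: "?s > 0" using k H by simp
  have "(norm22 n B ?x)\<^sup>2 = (\<Sum>l<n * B. (signed_sum (\<lambda>j. of_int (z' j)) k (chunk k l bs))\<^sup>2)"
    unfolding norm22_square sum_nat_mult
    by (intro sum.cong refl arg_cong[where f = "\<lambda>x. x\<^sup>2"] lin_base_matrix) (auto simp: L)
  also have "\<dots> = ?s\<^sup>2 * (\<Sum>l<n * B. (signed_sum (\<lambda>j. of_int (z' j) / ?s) k (chunk k l bs))\<^sup>2)"
    unfolding signed_sum_divide power_divide sum_divide_distrib[symmetric] using s k H by simp
  also have "\<dots> \<le> ?s\<^sup>2 * ((n * B) * (1 + \<tau>))"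
    using good[OF z'] by (intro mult_left_mono) (auto simp: bad_upper_def)
  also have "\<dots> = real (n * B) * (1 + \<tau>) * (k * H\<^sup>2)"
    by (simp add: power_mult_distrib)
  finally show "(norm22 n B (lin (base_matrix n B k bs) k (\<lambda>j. of_int (z j))))\<^sup>2 \<le> \<dots>"
    unfolding lin .
  let ?r = "L2_set (\<lambda>j. real_of_int (z' j)) {..<k}"
  show "norm12 n B (lin (base_matrix n B k bs) k (\<lambda>j. of_int (z j))) \<ge>
         n * sqrt B * (1 - 2 * \<tau>) * L2_set (\<lambda>j. of_int (z j)) {..<k}"
  proof (cases "?r > 0")
    case True
    have "norm12 n B ?x = (\<Sum>i<n. block_norm (\<lambda>j. of_int (z' j)) k B (chunk (B * k) i bs))"
      unfolding norm12_def by (intro sum.cong refl block_norm_chunk[symmetric]) (auto simp: L)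
    also have "\<dots> = ?r * (\<Sum>i<n. block_norm (\<lambda>j. of_int (z' j) / ?r) k B (chunk (B * k) i bs))"
      unfolding block_norm_divide[OF True] sum_divide_distrib[symmetric] using True by simp
    also have "\<dots> \<ge> ?r * (n * sqrt B * (1 - 1 / B - \<tau>))"
      using good[OF z'] True by (intro mult_left_mono) (auto simp: bad_lower_def)
    \<comment> \<open>Here 1/B \<le> \<tau> turns the bias of the mean block norm into a second
      \<tau>.\<close>
    also have "?r * (n * sqrt B * (1 - 1 / B - \<tau>)) \<ge> ?r * (n * sqrt B * (1 - 2 * \<tau>))"
      using B True by (intro mult_left_mono) auto
    finally show ?thesis unfolding lin L2 by (simp add: mult_ac)
  next
    case False
    then have "?r = 0" by (simp add: order.antisym not_less)
    then show ?thesis unfolding lin L2 by simp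
  qed
qed (use assms in auto)

lemma norm22_identity_block:
  "(norm22 (n + k) B (lin (base_matrix n B k bs) k u))\<^sup>2 =
     (norm22 n B (lin (base_matrix n B k bs) k u))\<^sup>2 + B * (L2_set u {..<k})\<^sup>2"
proof -
  let ?x = "lin (base_matrix n B k bs) k u"
  have id: "?x (n + j) c = u j" if "j < k" for j c
    using that by (simp add: lin_def base_matrix_def of_bool_def if_distrib[of "\<lambda>x. x * _"] cong: if_cong)
  have "(norm22 (n + k) B ?x)\<^sup>2 = (\<Sum>i<n. \<Sum>c<B. (?x i c)\<^sup>2) + (\<Sum>j<k. \<Sum>c<B. (?x (n + j) c)\<^sup>2)"
    unfolding norm22_square by (rule sum_lessThan_add)
  also have "(\<Sum>j<k. \<Sum>c<B. (?x (n + j) c)\<^sup>2) = B * (L2_set u {..<k})\<^sup>2"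
    by (simp add: id L2_set_def sum_nonneg sum_distrib_left)
  finally show ?thesis by (simp add: norm22_square)
qed

lemma norm12_mono: "n \<le> n' \<Longrightarrow> norm12 n B x \<le> norm12 n' B x"
  unfolding norm12_def by (intro sum_mono2) auto

text \<open>The identity blocks are few and light: they are dropped from the sum of block norms, and
  they enlarge the Euclidean norm and the number of blocks only slightly. The losses are 6\<tau>
  below and 9\<tau> above, and (1 - 16\<tau>)(1 + 9\<tau>) \<le> 1 - 6\<tau>.\<close>

lemma spread_base_matrix:
  assumes nb: "net_bounds (base_matrix n B k bs) n B k H \<tau>"
    and small: "\<tau> \<le> 1 / 16" "1 / H \<le> \<tau>" and kn: "real k \<le> \<tau> * n"
  shows "spread (1 - 16 * \<tau>) (n + k) B k (base_matrix n B k bs)"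
  unfolding spread_def
proof
  fix u
  interpret net_bounds "base_matrix n B k bs" n B k H \<tau> by (rule nb)
  let ?x = "lin (base_matrix n B k bs) k u"
  define r where "r = L2_set u {..<k}"
  have r: "r \<ge> 0" by (simp add: r_def)
  have t0: "\<tau> > 0" "k > 0" using net_bounds_axioms by (auto simp: net_bounds_def)
  \<comment> \<open>Follows from k \<ge> 1; it absorbs the contribution B r^2 of the identity blocks
    into a term with the factor \<tau> n.\<close>
  have n: "real n * \<tau> \<ge> 1" using kn t0(2) mult.commute[of \<tau> "real n"] by linarith
  have "norm12 (n + k) B ?x \<ge> n * sqrt B * (1 - 2 * \<tau> - 4 / H) * r"
    using F_bound[of u] norm12_mono[of n "n + k" B ?x] by (simp add: F_def nrm_def r_def)
  also have "n * sqrt B * (1 - 2 * \<tau> - 4 / H) * r \<ge> n * sqrt B * (1 - 6 * \<tau>) * r"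
    using small(2) r by (intro mult_right_mono mult_left_mono) auto
  finally have lo: "norm12 (n + k) B ?x \<ge> n * sqrt B * (1 - 6 * \<tau>) * r" .
  have g: "norm22 n B ?x \<le> \<alpha> * (1 + 2 * \<tau>) * r"
  proof -
    have "norm22 n B ?x \<le> \<alpha> * (1 + 2 / H) * r"
      using G_bound[of u] by (simp add: G_def nrm_def r_def)
    also have "\<dots> \<le> \<alpha> * (1 + 2 * \<tau>) * r"
      using small(2) r alpha_nonneg by (intro mult_right_mono mult_left_mono) auto
    finally show ?thesis .
  qed
  have "(norm22 (n + k) B ?x)\<^sup>2 \<le> (\<alpha> * (1 + 2 * \<tau>) * r)\<^sup>2 + B * r\<^sup>2"
    unfolding norm22_identity_block r_def[symmetric] using g by (intro add_right_mono power_mono) auto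
  also have "\<dots> = B * r\<^sup>2 * (n * (1 + \<tau>) * (1 + 2 * \<tau>)\<^sup>2 + 1)"
  proof -
    have "\<alpha>\<^sup>2 = real n * real B * (1 + \<tau>)" using t0 by (simp add: \<alpha>_def)
    then show ?thesis unfolding power_mult_distrib by (simp only: ring_distribs mult_ac mult_1_right)
  qed
  also have "\<dots> \<le> B * r\<^sup>2 * (n * ((1 + \<tau>) * (1 + 2 * \<tau>)\<^sup>2 + \<tau>))"
    using n by (intro mult_left_mono) (auto simp: algebra_simps)
  also have "\<dots> \<le> B * r\<^sup>2 * (n * (1 + 3 * \<tau>)\<^sup>2)"
  proof -
    \<comment> \<open>The next inequality compares 1 + 6\<tau> + 8\<tau>^2 + 4\<tau>^3 with 1 +
      6\<tau> + 9\<tau>^2.\<close>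
    have "4 * \<tau> ^ 3 \<le> \<tau>\<^sup>2"
      using small(1) t0 by (simp add: power2_eq_square power3_eq_cube)
    then have "(1 + \<tau>) * (1 + 2 * \<tau>)\<^sup>2 + \<tau> \<le> (1 + 3 * \<tau>)\<^sup>2"
      by (simp add: power2_eq_square power3_eq_cube algebra_simps)
    then show ?thesis by (intro mult_left_mono) auto
  qed
  finally have up: "(norm22 (n + k) B ?x)\<^sup>2 \<le> B * r\<^sup>2 * (n * (1 + 3 * \<tau>)\<^sup>2)" .
  have "(sqrt (n + k) * norm22 (n + k) B ?x)\<^sup>2 \<le> (n * (1 + 3 * \<tau>)\<^sup>2) * (B * r\<^sup>2 * (n * (1 + 3 * \<tau>)\<^sup>2))"
    unfolding power_mult_distrib
  proof (intro mult_mono up)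
    have "real (n + k) \<le> n * (1 + \<tau>)" using kn by (simp add: algebra_simps)
    also have "\<dots> \<le> n * (1 + 3 * \<tau>)\<^sup>2"
      using t0 by (intro mult_left_mono) (auto simp: power2_eq_square algebra_simps)
    finally show "(sqrt (n + k))\<^sup>2 \<le> n * (1 + 3 * \<tau>)\<^sup>2" by simp
  qed auto
  also have "\<dots> = (n * sqrt B * (1 + 3 * \<tau>)\<^sup>2 * r)\<^sup>2"
    by (simp add: power_mult_distrib power2_eq_square)
  finally have "sqrt (n + k) * norm22 (n + k) B ?x \<le> n * sqrt B * (1 + 3 * \<tau>)\<^sup>2 * r"
    by (rule power2_le_imp_le) (use r in auto)
  also have "\<dots> \<le> n * sqrt B * (1 + 9 * \<tau>) * r"
  proof -
    have "\<tau> * \<tau> * 9 \<le> \<tau> * 3" using small(1) t0 by simp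
    then have "(1 + 3 * \<tau>)\<^sup>2 \<le> 1 + 9 * \<tau>"
      by (simp add: power2_eq_square algebra_simps)
    then show ?thesis using r by (intro mult_right_mono mult_left_mono) auto
  qed
  finally have "(1 - 16 * \<tau>) * (sqrt (n + k) * norm22 (n + k) B ?x) \<le>
      (1 - 16 * \<tau>) * (n * sqrt B * (1 + 9 * \<tau>) * r)"
    using small(1) by (intro mult_left_mono) auto
  also have "\<dots> = n * sqrt B * r * ((1 - 16 * \<tau>) * (1 + 9 * \<tau>))" by simp
  also have "\<dots> \<le> n * sqrt B * r * (1 - 6 * \<tau>)"
    using r t0 by (intro mult_left_mono) (auto simp: algebra_simps)
  also have "\<dots> \<le> norm12 (n + k) B ?x" using lo by (simp add: mult_ac)
  finally show "(1 - 16 * \<tau>) * sqrt (n + k) * norm22 (n + k) B ?x \<le> norm12 (n + k) B ?x"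
    by (simp add: mult.assoc)
qed

text \<open>The matrix reads a prefix of the bits, while the supply may be longer.\<close>

lemma base_matrix_take:
  assumes "length bs \<ge> n * B * k"
  shows "spread \<beta> (n + k) B k (base_matrix n B k (take (n * B * k) bs)) \<longleftrightarrow>
     spread \<beta> (n + k) B k (base_matrix n B k bs)"
proof -
  have "base_matrix n B k (take (n * B * k) bs) i c j = base_matrix n B k bs i c j"
    if "c < B" "j < k" for i c j
  proof (cases "i < n")
    case True
    have "(i * B + c) * k + j < n * B * k"
      using index_le(2)[OF True that(1), where bs = "replicate (n * B * k) False" and k = k] that(2)
      by (simp add: algebra_simps)
    then show ?thesis by (simp add: base_matrix_def)
  qed (simp add: base_matrix_def)
  then have "lin (base_matrix n B k (take (n * B * k) bs)) k u i c = lin (base_matrix n B k bs) k u i c"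
    if "c < B" for u i c using that by (simp add: lin_def)
  then show ?thesis
    unfolding spread_def by (simp cong: norm12_cong norm22_cong)
qed

lemma avg_take:
  assumes "a \<le> L"
  shows "avg L (\<lambda>bs. f (take a bs)) = avg a f"
proof -
  have "avg L (\<lambda>bs. f (take a bs)) = avg (a + (L - a)) (\<lambda>bs. f (take a bs))"
    using assms by simp
  also have "\<dots> = avg a (\<lambda>x. avg (L - a) (\<lambda>y. f x))"
    unfolding avg_append by (intro avg_cong) simp
  finally show ?thesis by simp
qed

text \<open>Order of choices: \<eta> fixes \<tau>, then B = H, then D, and only k grows. The net has
  at most K^k points, each failing with probability at most 2 exp(-D\<tau>^2/16)^k, and D is taken
  large enough to beat K.\<close>

theorem base_matrix_spread:
  assumes \<eta>: "0 < \<eta>" "\<eta> < 1"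
  shows "\<exists>B>0. \<exists>D>0. \<forall>k\<ge>7. \<forall>L\<ge>D * k * B * k.
    avg L (\<lambda>bs. of_bool (\<not> spread (1 - \<eta>) (D * k + k) B k (base_matrix (D * k) B k bs))) < 2 / 100"
proof -
  \<comment> \<open>Matches the loss of 16\<tau> in \<open>spread_base_matrix\<close>.\<close>
  define \<tau> where "\<tau> = \<eta> / 16"
  have \<tau>: "0 < \<tau>" "\<tau> \<le> 1 / 16" using \<eta> by (auto simp: \<tau>_def)
  define B where "B = nat \<lceil>1 / \<tau>\<rceil>"
  define H where "H = B"
  have "real B \<ge> 1 / \<tau>" by (simp add: B_def) linarith
  moreover have "1 / \<tau> \<ge> 16" using \<tau> by (simp add: field_simps)
  ultimately have B16: "real B \<ge> 16" and Bt: "real B \<ge> 1 / \<tau>" by linarith+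
  have "B \<ge> 2" using B16 by linarith
  moreover have "1 / B \<le> \<tau>" using Bt B16 \<tau> by (simp add: divide_le_eq mult.commute)
  ultimately have B: "B \<ge> 2" "1 / B \<le> \<tau>" by auto
  define K where "K = (3 * 2 ^ (H\<^sup>2) :: real)"
  have "(1::real) \<le> 2 ^ (H\<^sup>2)" by (rule one_le_power) simp
  then have K: "K \<ge> 1" unfolding K_def by linarith
  \<comment> \<open>The first bound gives k \<le> \<tau> n for n = D k, the second lets the tails
    win over the net.\<close>
  define D where "D = nat \<lceil>max (1 / \<tau>) (16 * (1 + ln K) / \<tau>\<^sup>2)\<rceil>"
  have "real D \<ge> max (1 / \<tau>) (16 * (1 + ln K) / \<tau>\<^sup>2)" by (simp add: D_def) linarith
  then have D: "real D \<ge> 1 / \<tau>" "real D \<ge> 16 * (1 + ln K) / \<tau>\<^sup>2" by auto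
  have D0: "D > 0" using D(1) \<open>1 / \<tau> \<ge> 16\<close> by (auto intro: Suc_leI)
  have D2: "exp (- (D * \<tau>\<^sup>2 / 16)) * K \<le> exp (- 1)"
  proof -
    have "1 + ln K \<le> D * \<tau>\<^sup>2 / 16" using D(2) \<tau> by (simp add: field_simps)
    then have "exp (- (D * \<tau>\<^sup>2 / 16)) \<le> exp (- 1 - ln K)" by simp
    also have "\<dots> = exp (- 1) / K" using K by (simp add: exp_diff)
    finally show ?thesis using K by (simp add: field_simps)
  qed
  have main: "avg L (\<lambda>bs. of_bool (\<not> spread (1 - \<eta>) (D * k + k) B k (base_matrix (D * k) B k bs))) < 2 / 100"
    if k: "k \<ge> 7" and L: "L \<ge> D * k * B * k" for k L
  proof -
    define n where "n = D * k"
    have "1 \<le> \<tau> * real D" using D(1) \<tau> by (simp add: field_simps)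
    then have kn: "real k \<le> \<tau> * n"
      using mult_right_mono[of 1 "\<tau> * real D" "real k"] by (simp add: n_def mult_ac)
    have good: "spread (1 - \<eta>) (n + k) B k (base_matrix n B k bs)"
      if "length bs = n * B * k" "\<And>z. z \<in> net k H \<Longrightarrow> \<not> bad_upper n B k H \<tau> z bs \<and> \<not> bad_lower n B k \<tau> z bs" for bs
    proof -
      have "net_bounds (base_matrix n B k bs) n B k H \<tau>"
        by (rule net_bounds_base_matrix[OF that]) (use k \<tau> B in \<open>auto simp: H_def\<close>)
      from spread_base_matrix[OF this] show ?thesis
        using \<tau> B kn by (auto simp: H_def \<tau>_def)
    qed
    have "avg L (\<lambda>bs. of_bool (\<not> spread (1 - \<eta>) (n + k) B k (base_matrix n B k bs))) =
       avg L (\<lambda>bs. of_bool (\<not> spread (1 - \<eta>) (n + k) B k (base_matrix n B k (take (n * B * k) bs))))"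
      using L by (intro avg_cong) (simp add: base_matrix_take n_def)
    also have "\<dots> = avg (n * B * k) (\<lambda>bs. of_bool (\<not> spread (1 - \<eta>) (n + k) B k (base_matrix n B k bs)))"
      using L by (subst avg_take) (auto simp: n_def)
    also have "\<dots> \<le> avg (n * B * k) (\<lambda>bs. of_bool (\<exists>z\<in>net k H. bad_upper n B k H \<tau> z bs \<or> bad_lower n B k \<tau> z bs))"
      using good by (intro avg_mono) (auto simp: of_bool_def)
    also have "\<dots> \<le> (\<Sum>z\<in>net k H. avg (n * B * k) (\<lambda>bs. of_bool (bad_upper n B k H \<tau> z bs \<or> bad_lower n B k \<tau> z bs)))"
      by (rule avg_of_bool_ex) simp
    also have "\<dots> \<le> (\<Sum>z\<in>net k H. 2 * exp (- (real n * \<tau>\<^sup>2 / 16)))"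
    proof (rule sum_mono)
      fix z assume z: "z \<in> net k H"
      have "avg (n * B * k) (\<lambda>bs. of_bool (bad_upper n B k H \<tau> z bs)) \<le> exp (- (real n * \<tau>\<^sup>2 / 16))"
        using z k \<tau> B by (intro avg_bad_upper) (auto simp: H_def)
      moreover have "avg (n * B * k) (\<lambda>bs. of_bool (bad_lower n B k \<tau> z bs)) \<le> exp (- (real n * \<tau>\<^sup>2 / 16))"
        using \<tau> B by (intro avg_bad_lower) auto
      ultimately show "avg (n * B * k) (\<lambda>bs. of_bool (bad_upper n B k H \<tau> z bs \<or> bad_lower n B k \<tau> z bs))
          \<le> 2 * exp (- (real n * \<tau>\<^sup>2 / 16))"
        using avg_of_bool_union[of "n * B * k" "bad_upper n B k H \<tau> z" "bad_lower n B k \<tau> z"] by linarith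
    qed
    also have "\<dots> = 2 * (real (card (net k H)) * exp (- (D * \<tau>\<^sup>2 / 16)) ^ k)"
      by (simp add: n_def exp_of_nat_mult[symmetric] mult_ac)
    also have "\<dots> \<le> 2 * (K ^ k * exp (- (D * \<tau>\<^sup>2 / 16)) ^ k)"
      using card_net[of k H] by (intro mult_left_mono mult_right_mono) (auto simp: K_def)
    also have "\<dots> = 2 * (exp (- (D * \<tau>\<^sup>2 / 16)) * K) ^ k"
      by (simp add: power_mult_distrib mult.commute)
    also have "\<dots> \<le> 2 * exp (- 1) ^ k"
      using D2 K by (intro mult_left_mono power_mono) auto
    also have "\<dots> \<le> 2 * (1 / 2) ^ k"
    proof -
      have "exp (- 1) \<le> 1 / (2::real)"
        using exp_ge_add_one_self[of 1] by (simp add: exp_minus field_simps)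
      then show ?thesis by (intro mult_left_mono power_mono) auto
    qed
    \<comment> \<open>For k \<ge> 7 the bound is 2/128, which is below 2/100; k = 6 would give
      2/64.\<close>
    also have "\<dots> \<le> 2 * (1 / 2) ^ 7"
      using k by (intro mult_left_mono power_decreasing) auto
    also have "\<dots> < 2 / 100" by (simp add: power_divide)
    finally show ?thesis by (simp add: n_def)
  qed
  have "B > 0" using B by simp
  then show ?thesis using D0 main by (intro exI[of _ B] conjI exI[of _ D]) auto
qed


section \<open>Tensor powers\<close>

text \<open>The Kronecker power, with indices read as numbers of \<open>r\<close> digits; the
  recursion strips the last digit of each index.\<close>

fun tensor_power :: "nat \<Rightarrow> nat \<Rightarrow> nat \<Rightarrow> (nat \<Rightarrow> nat \<Rightarrow> nat \<Rightarrow> real) \<Rightarrow> nat \<Rightarrow> nat \<Rightarrow> nat \<Rightarrow> nat \<Rightarrow> real" where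
  "tensor_power n B k a 0 i c j = 1"
| "tensor_power n B k a (Suc r) i c j =
     tensor_power n B k a r (i div n) (c div B) (j div k) * a (i mod n) (c mod B) (j mod k)"

definition tensor_at ::
    "nat \<Rightarrow> nat \<Rightarrow> nat \<Rightarrow> (nat \<Rightarrow> nat \<Rightarrow> nat \<Rightarrow> real) \<Rightarrow> (nat \<Rightarrow> nat \<Rightarrow> nat \<Rightarrow> real) \<Rightarrow> nat \<Rightarrow> nat \<Rightarrow> nat \<Rightarrow> real" where
  "tensor_at n B k a b i c j = b (i div n) (c div B) (j div k) * a (i mod n) (c mod B) (j mod k)"

lemma L2_set_sum_le: "finite I \<Longrightarrow> L2_set (\<lambda>x. \<Sum>i\<in>I. f i x) A \<le> (\<Sum>i\<in>I. L2_set (f i) A)"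
proof (induction I rule: finite_induct)
  case (insert i I)
  then show ?case
    using L2_set_triangle_ineq[of "f i" "\<lambda>x. \<Sum>i\<in>I. f i x" A] by simp
qed (simp add: L2_set_def)

lemma L2_set_nested: "L2_set (\<lambda>x. L2_set (f x) B) A = L2_set (\<lambda>y. L2_set (\<lambda>x. f x y) A) B"
  by (simp add: L2_set_def sum_nonneg sum.swap[of _ A B])

lemma L2_set_nat_mult: "L2_set f {..<n * B} = L2_set (\<lambda>i. L2_set (\<lambda>c. f (i * B + c)) {..<B}) {..<n}"
  for n :: nat
  unfolding L2_set_def sum_nat_mult by (simp add: sum_nonneg)

text \<open>
  Minkowski's inequality lets the two factors act one after the other: first the second factor along
  the fast indices, with the slow index of the first factor frozen, and then the first factor.
\<close>

lemma spread_tensor: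
  assumes a: "spread \<alpha> n B k a" and b: "spread \<beta> n' B' k' b"
    and \<alpha>: "\<alpha> \<ge> 0" and \<beta>: "\<beta> \<ge> 0"
  shows "spread (\<beta> * \<alpha>) (n' * n) (B' * B) (k' * k) (tensor_at n B k a b)"
  unfolding spread_def
proof
  fix u
  let ?x = "lin (tensor_at n B k a b) (k' * k) u"
  define y where "y i' i c' c = ?x (i' * n + i) (c' * B + c)" for i' i c' c
  have split: "?x (i' * n + i) (c' * B + c) =
      (\<Sum>j'<k'. \<Sum>j<k. b i' c' j' * a i c j * u (j' * k + j))" if "i < n" "c < B" for i' i c' c
    unfolding lin_def sum_nat_mult using that by (intro sum.cong refl) (simp add: tensor_at_def)
  \<comment> \<open>With i' and c' frozen the entries form a vector in the column space of
    \<open>a\<close>, with i and c frozen one in that of \<open>b\<close>.\<close>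
  have y_a: "y i' i c' c = lin a k (\<lambda>j. \<Sum>j'<k'. b i' c' j' * u (j' * k + j)) i c" if "i < n" "c < B" for i' i c' c
    unfolding y_def split[OF that] unfolding lin_def
    by (subst sum.swap) (simp add: sum_distrib_left mult_ac)
  have y_b: "y i' i c' c = lin b k' (\<lambda>j'. \<Sum>j<k. a i c j * u (j' * k + j)) i' c'" if "i < n" "c < B" for i' i c' c
    unfolding y_def split[OF that] unfolding lin_def by (simp add: sum_distrib_left mult_ac)
  have n12: "norm12 (n' * n) (B' * B) ?x = (\<Sum>i'<n'. \<Sum>i<n. L2_set (\<lambda>c'. L2_set (y i' i c') {..<B}) {..<B'})"
    unfolding norm12_def sum_nat_mult L2_set_nat_mult y_def ..
  have n22: "norm22 (n' * n) (B' * B) ?x =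
      L2_set (\<lambda>i'. L2_set (\<lambda>i. L2_set (\<lambda>c'. L2_set (y i' i c') {..<B}) {..<B'}) {..<n}) {..<n'}"
    unfolding norm22_def L2_set_nat_mult y_def ..
  define Y where "Y i' c' = L2_set (\<lambda>i. L2_set (y i' i c') {..<B}) {..<n}" for i' c'
  \<comment> \<open>The bound for \<open>a\<close> is applied for each frozen pair; moving the sum
    over i outside the l2 norm over c' then only increases the value.\<close>
  have step1: "\<alpha> * sqrt n * L2_set (Y i') {..<B'} \<le> (\<Sum>i<n. L2_set (\<lambda>c'. L2_set (y i' i c') {..<B}) {..<B'})" for i'
  proof -
    have "\<alpha> * sqrt n * L2_set (Y i') {..<B'} = L2_set (\<lambda>c'. \<alpha> * sqrt n * Y i' c') {..<B'}"
      using \<alpha> by (simp add: L2_set_cmult)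
    also have "\<dots> \<le> L2_set (\<lambda>c'. \<Sum>i<n. L2_set (y i' i c') {..<B}) {..<B'}"
    proof (rule L2_set_mono)
      fix c'
      let ?v = "\<lambda>j. \<Sum>j'<k'. b i' c' j' * u (j' * k + j)"
      have "norm22 n B (lin a k ?v) = Y i' c'" "norm12 n B (lin a k ?v) = (\<Sum>i<n. L2_set (y i' i c') {..<B})"
        by (simp_all add: norm22_def norm12_def Y_def y_a L2_set_def)
      then show "\<alpha> * sqrt n * Y i' c' \<le> (\<Sum>i<n. L2_set (y i' i c') {..<B})"
        using a unfolding spread_def by metis
      show "0 \<le> \<alpha> * sqrt n * Y i' c'" using \<alpha> by (simp add: Y_def)
    qed
    also have "\<dots> \<le> (\<Sum>i<n. L2_set (\<lambda>c'. L2_set (y i' i c') {..<B}) {..<B'})"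
      by (rule L2_set_sum_le) simp
    finally show ?thesis .
  qed
  have YL: "L2_set (Y i') {..<B'} = L2_set (\<lambda>i. L2_set (\<lambda>c. L2_set (\<lambda>c'. y i' i c' c) {..<B'}) {..<B}) {..<n}" for i'
    unfolding Y_def by (subst L2_set_nested) (simp add: L2_set_nested[of "\<lambda>c'. y i' _ c'"] L2_set_def sum_nonneg sum.swap[of _ "{..<B}" "{..<B'}"])
  \<comment> \<open>The squares are regrouped so that i and c are outermost, \<open>b\<close> acts
    under this norm, and two uses of Minkowski's inequality move the sum over i' outside.\<close>
  have step2: "\<beta> * sqrt n' * norm22 (n' * n) (B' * B) ?x \<le> (\<Sum>i'<n'. L2_set (Y i') {..<B'})"
  proof -
    define Z where "Z i c = L2_set (\<lambda>i'. L2_set (\<lambda>c'. y i' i c' c) {..<B'}) {..<n'}" for i c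
    let ?g = "\<lambda>i' i c' c. (y i' i c' c)\<^sup>2"
    have "(\<Sum>i'<n'. \<Sum>i<n. \<Sum>c'<B'. \<Sum>c<B. ?g i' i c' c) = (\<Sum>i<n. \<Sum>i'<n'. \<Sum>c'<B'. \<Sum>c<B. ?g i' i c' c)"
      by (rule sum.swap)
    also have "\<dots> = (\<Sum>i<n. \<Sum>i'<n'. \<Sum>c<B. \<Sum>c'<B'. ?g i' i c' c)"
      by (rule sum.cong[OF refl], rule sum.cong[OF refl], rule sum.swap)
    also have "\<dots> = (\<Sum>i<n. \<Sum>c<B. \<Sum>i'<n'. \<Sum>c'<B'. ?g i' i c' c)"
      by (rule sum.cong[OF refl], rule sum.swap)
    finally have "norm22 (n' * n) (B' * B) ?x = L2_set (\<lambda>i. L2_set (Z i) {..<B}) {..<n}"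
      unfolding n22 Z_def by (simp add: L2_set_def sum_nonneg)
    then have "\<beta> * sqrt n' * norm22 (n' * n) (B' * B) ?x =
       L2_set (\<lambda>i. L2_set (\<lambda>c. \<beta> * sqrt n' * Z i c) {..<B}) {..<n}"
      using \<beta> by (simp add: L2_set_cmult)
    also have "\<dots> \<le> L2_set (\<lambda>i. L2_set (\<lambda>c. \<Sum>i'<n'. L2_set (\<lambda>c'. y i' i c' c) {..<B'}) {..<B}) {..<n}"
    proof (intro L2_set_mono)
      fix i c assume ic: "i \<in> {..<n}" "c \<in> {..<B}"
      let ?w = "\<lambda>j'. \<Sum>j<k. a i c j * u (j' * k + j)"
      have "norm22 n' B' (lin b k' ?w) = Z i c"
        "norm12 n' B' (lin b k' ?w) = (\<Sum>i'<n'. L2_set (\<lambda>c'. y i' i c' c) {..<B'})"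
        using ic by (simp_all add: norm22_def norm12_def Z_def y_b L2_set_def)
      then show "\<beta> * sqrt n' * Z i c \<le> (\<Sum>i'<n'. L2_set (\<lambda>c'. y i' i c' c) {..<B'})"
        using b unfolding spread_def by metis
      show "0 \<le> \<beta> * sqrt n' * Z i c" using \<beta> by (simp add: Z_def)
    qed simp
    also have "\<dots> \<le> L2_set (\<lambda>i. \<Sum>i'<n'. L2_set (\<lambda>c. L2_set (\<lambda>c'. y i' i c' c) {..<B'}) {..<B}) {..<n}"
      by (intro L2_set_mono L2_set_sum_le) auto
    also have "\<dots> \<le> (\<Sum>i'<n'. L2_set (\<lambda>i. L2_set (\<lambda>c. L2_set (\<lambda>c'. y i' i c' c) {..<B'}) {..<B}) {..<n})"
      by (rule L2_set_sum_le) simp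
    finally show ?thesis unfolding YL .
  qed
  have "\<beta> * \<alpha> * sqrt (n' * n) * norm22 (n' * n) (B' * B) ?x =
      \<alpha> * sqrt n * (\<beta> * sqrt n' * norm22 (n' * n) (B' * B) ?x)"
    by (simp add: real_sqrt_mult mult_ac)
  also have "\<dots> \<le> \<alpha> * sqrt n * (\<Sum>i'<n'. L2_set (Y i') {..<B'})"
    using step2 \<alpha> by (intro mult_left_mono) auto
  also have "\<dots> \<le> norm12 (n' * n) (B' * B) ?x"
    unfolding n12 sum_distrib_left by (intro sum_mono step1)
  finally show "\<beta> * \<alpha> * sqrt (n' * n) * norm22 (n' * n) (B' * B) ?x \<le> norm12 (n' * n) (B' * B) ?x" .
qed

lemma spread_tensor_power:
  assumes "spread \<alpha> n B k a" "\<alpha> \<ge> 0"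
  shows "spread (\<alpha> ^ r) (n ^ r) (B ^ r) (k ^ r) (tensor_power n B k a r)"
proof (induction r)
  case 0
  show ?case by (simp add: spread_def norm12_def norm22_def L2_set_def)
next
  case (Suc r)
  have "tensor_power n B k a (Suc r) = tensor_at n B k a (tensor_power n B k a r)"
    by (simp add: fun_eq_iff tensor_at_def)
  then show ?case
    using spread_tensor[OF assms(1) Suc.IH assms(2)] assms(2) by (simp add: mult.commute)
qed

lemma nat_digit_less: "i < n \<Longrightarrow> I < m \<Longrightarrow> I * n + i < m * (n::nat)"
proof -
  assume "i < n" "I < m"
  then have "I * n + i < Suc I * n" "Suc I * n \<le> m * n" by (simp, intro mult_le_mono1, simp)
  then show ?thesis by linarith
qed

text \<open>The dimension must be right for every outcome, so this is independent of
  \<open>spread\<close>. Contracting \<open>u\<close> with a row of the last factor leaves a vector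
  killed by the r-th power, hence zero by induction; then \<open>a\<close> kills every slice of
  \<open>u\<close> along the last digit.\<close>

lemma tensor_power_injective:
  assumes "\<And>u. (\<And>i c. i < n \<Longrightarrow> c < B \<Longrightarrow> lin a k u i c = 0) \<Longrightarrow> (\<And>j. j < k \<Longrightarrow> u j = 0)"
    and "\<And>i c. i < n ^ r \<Longrightarrow> c < B ^ r \<Longrightarrow> lin (tensor_power n B k a r) (k ^ r) u i c = 0"
    and "j < k ^ r"
  shows "u j = 0"
  using assms(2,3)
proof (induction r arbitrary: u j)
  case 0
  then show ?case by (auto simp: lin_def)
next
  case (Suc r)
  have j: "j div k < k ^ r" "j mod k < k"
    using Suc.prems(2) by (cases "k = 0"; simp add: less_mult_imp_div_less mult.commute)+
  have inner: "(\<Sum>j'<k. a i c j' * u (J * k + j')) = 0" if ic: "i < n" "c < B" and J: "J < k ^ r" for i c J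
  proof (rule Suc.IH[of "\<lambda>J. \<Sum>j'<k. a i c j' * u (J * k + j')", OF _ J])
    fix I C assume IC: "I < n ^ r" "C < B ^ r"
    have "I * n + i < n ^ Suc r" "C * B + c < B ^ Suc r"
      using ic IC nat_digit_less[of i n I "n ^ r"] nat_digit_less[of c B C "B ^ r"] by (simp_all add: mult.commute)
    then have "lin (tensor_power n B k a (Suc r)) (k ^ Suc r) u (I * n + i) (C * B + c) = 0"
      by (rule Suc.prems(1))
    moreover have "lin (tensor_power n B k a (Suc r)) (k ^ Suc r) u (I * n + i) (C * B + c) =
        (\<Sum>J<k ^ r. \<Sum>j'<k. tensor_power n B k a (Suc r) (I * n + i) (C * B + c) (J * k + j') * u (J * k + j'))"
      unfolding lin_def power_Suc2 sum_nat_mult ..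
    moreover have "\<dots> = lin (tensor_power n B k a r) (k ^ r) (\<lambda>J. \<Sum>j'<k. a i c j' * u (J * k + j')) I C"
      unfolding lin_def sum_distrib_left by (intro sum.cong refl) (use ic in simp)
    ultimately show "lin (tensor_power n B k a r) (k ^ r) (\<lambda>J. \<Sum>j'<k. a i c j' * u (J * k + j')) I C = 0"
      by simp
  qed
  have "u (j div k * k + j mod k) = 0"
    by (rule assms(1)[of "\<lambda>j'. u (j div k * k + j')", OF _ j(2)]) (simp add: lin_def inner j)
  then show ?case by simp
qed


section \<open>Embedding a Euclidean space by signs\<close>

text \<open>The phase \<open>a\<close> lets one identity cover both parts of the characteristic
  function: 0 gives the cosines and \<open>- (pi / 2)\<close> the sines.\<close>

lemma avg_cos_signed_sum:
  "avg k (\<lambda>bs. cos (a + t * signed_sum u k bs)) = cos a * (\<Prod>j<k. cos (t * u j))"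
proof (induction k)
  case 0
  then show ?case by (simp add: avg_0 signed_sum_def)
next
  case (Suc k)
  have "avg (Suc k) (\<lambda>bs. cos (a + t * signed_sum u (Suc k) bs)) =
     avg k (\<lambda>x. cos (a + t * signed_sum u k x) * cos (t * u k))"
    unfolding avg_Suc
  proof (rule avg_cong)
    fix x :: "bool list" assume "length x = k"
    then have "(cos (a + t * signed_sum u (Suc k) (x @ [True])) + cos (a + t * signed_sum u (Suc k) (x @ [False]))) / 2 =
      (cos (a + t * signed_sum u k x + t * u k) + cos (a + t * signed_sum u k x - t * u k)) / 2"
      by (simp add: signed_sum_snoc sgn_bit_def algebra_simps)
    also have "\<dots> = cos (a + t * signed_sum u k x) * cos (t * u k)"
      unfolding cos_add[of "a + t * signed_sum u k x"] cos_diff[of "a + t * signed_sum u k x"] by simp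
    finally show "(cos (a + t * signed_sum u (Suc k) (x @ [True])) + cos (a + t * signed_sum u (Suc k) (x @ [False]))) / 2 =
      cos (a + t * signed_sum u k x) * cos (t * u k)" .
  qed
  also have "\<dots> = cos a * (\<Prod>j<k. cos (t * u j)) * cos (t * u k)"
    unfolding avg_cmult_right Suc.IH ..
  finally show ?case by simp
qed

lemma avg_sin_signed_sum: "avg k (\<lambda>bs. sin (t * signed_sum u k bs)) = 0"
proof -
  have "cos (- (pi / 2) + x) = sin x" for x :: real by (simp only: cos_add cos_minus sin_minus cos_pi_half sin_pi_half mult_1 mult_zero_left minus_mult_minus mult_minus_left minus_minus add_0 diff_0)
  then show ?thesis using avg_cos_signed_sum[of k "- (pi / 2)" t u] by simp
qed

text \<open>Both functions agree with 1 - y^2/2 up to a multiple of y^4, the multiples being 1/24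
  and 1/8.\<close>

lemma cos_exp_close: "\<bar>cos y - exp (- (y\<^sup>2 / 2))\<bar> \<le> y ^ 4" for y :: real
proof -
  obtain t where "cos y = (\<Sum>m<4. cos_coeff m * y ^ m) + (cos (t + 1/2 * real 4 * pi) / fact 4) * y ^ 4"
    using Maclaurin_cos_expansion[of y 4] by auto
  moreover have "{..<4} = {0, 1, 2, 3::nat}" by auto
  moreover have "fact 4 = (24::real)" by (simp add: eval_nat_numeral)
  ultimately have eq: "cos y = 1 - y\<^sup>2 / 2 + (cos (t + 2 * pi) / 24) * y ^ 4"
    by (simp add: cos_coeff_def)
  have "\<bar>(cos (t + 2 * pi) / 24) * y ^ 4\<bar> \<le> (1 / 24) * y ^ 4"
    unfolding abs_mult abs_divide using abs_cos_le_one[of "t + 2 * pi"]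
    by (intro mult_mono) auto
  then have 1: "\<bar>cos y - (1 - y\<^sup>2 / 2)\<bar> \<le> (1 / 24) * y ^ 4" using eq by simp
  have 2: "1 - y\<^sup>2 / 2 \<le> exp (- (y\<^sup>2 / 2))"
    using exp_ge_add_one_self[of "- (y\<^sup>2 / 2)"] by simp
  have 3: "exp (- (y\<^sup>2 / 2)) \<le> 1 - y\<^sup>2 / 2 + y ^ 4 / 8"
    using exp_minus_le_quadratic[of "y\<^sup>2 / 2"] by (simp add: power_divide)
  have "0 \<le> y ^ 4" by simp
  with 1 2 3 show ?thesis by linarith
qed

text \<open>Two products of factors in [-1, 1] differ by at most the sum of the differences of the
  factors. The fourth powers that arise are bounded by \<delta> times the squares, which add up to
  1.\<close>

lemma prod_cos_close:
  fixes t :: real and k :: nat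
  assumes "(\<Sum>j<k. (u j)\<^sup>2) = 1" "\<And>j. j < k \<Longrightarrow> (u j)\<^sup>2 \<le> \<delta>"
  shows "\<bar>(\<Prod>j<k. cos (t * u j)) - exp (- (t\<^sup>2 / 2))\<bar> \<le> t ^ 4 * \<delta>"
proof -
  have "(\<Prod>j<k. exp (- ((t * u j)\<^sup>2 / 2))) = exp (\<Sum>j<k. - ((t * u j)\<^sup>2 / 2))"
    by (rule exp_sum[symmetric, OF finite_lessThan])
  also have "(\<Sum>j<k. - ((t * u j)\<^sup>2 / 2)) = - (t\<^sup>2 / 2) * (\<Sum>j<k. (u j)\<^sup>2)"
    by (simp add: sum_distrib_left power_mult_distrib)
  finally have "exp (- (t\<^sup>2 / 2)) = (\<Prod>j<k. exp (- ((t * u j)\<^sup>2 / 2)))" using assms(1) by simp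
  then have "\<bar>(\<Prod>j<k. cos (t * u j)) - exp (- (t\<^sup>2 / 2))\<bar> \<le> (\<Sum>j<k. \<bar>cos (t * u j) - exp (- ((t * u j)\<^sup>2 / 2))\<bar>)"
    using norm_prod_diff[of "{..<k}" "\<lambda>j. cos (t * u j)" "\<lambda>j. exp (- ((t * u j)\<^sup>2 / 2))"] by simp
  also have "\<dots> \<le> (\<Sum>j<k. (t * u j) ^ 4)" by (intro sum_mono cos_exp_close)
  also have "\<dots> \<le> (\<Sum>j<k. t ^ 4 * \<delta> * (u j)\<^sup>2)"
  proof (rule sum_mono)
    fix j assume "j \<in> {..<k}"
    then have "(u j)\<^sup>2 * (u j)\<^sup>2 \<le> \<delta> * (u j)\<^sup>2" using assms(2) by (intro mult_right_mono) auto
    then have "t ^ 4 * ((u j)\<^sup>2 * (u j)\<^sup>2) \<le> t ^ 4 * (\<delta> * (u j)\<^sup>2)" by (intro mult_left_mono) auto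
    then show "(t * u j) ^ 4 \<le> t ^ 4 * \<delta> * (u j)\<^sup>2"
      by (simp add: power_mult_distrib mult.assoc flip: power_add)
  qed
  also have "\<dots> = t ^ 4 * \<delta>" using assms(1) by (simp flip: sum_distrib_left)
  finally show ?thesis .
qed

section \<open>Central limit theorem for mean absolute values\<close>

definition sign_distr :: "(nat \<Rightarrow> real) \<Rightarrow> nat \<Rightarrow> real measure" where
  "sign_distr u k = distr (measure_pmf (pmf_of_set (bit_strings k))) borel (signed_sum u k)"

lemma bit_strings_nonempty [simp]: "bit_strings k \<noteq> {}"
  using card_bit_strings[of k] by auto

lemma real_distribution_sign_distr: "real_distribution (sign_distr u k)"
  unfolding sign_distr_def
  by (intro real_distribution.intro real_distribution_axioms.intro measure_pmf.prob_space_distr) auto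

lemma integral_sign_distr:
  fixes f :: "real \<Rightarrow> real"
  assumes [measurable]: "f \<in> borel_measurable borel"
  shows "integral\<^sup>L (sign_distr u k) f = avg k (\<lambda>bs. f (signed_sum u k bs))"
  unfolding sign_distr_def avg_def
  by (subst integral_distr) (auto simp: integral_pmf_of_set card_bit_strings)

lemma char_sign_distr: "char (sign_distr u k) t = of_real (\<Prod>j<k. cos (t * u j))"
proof -
  have "char (sign_distr u k) t = (\<Sum>bs\<in>bit_strings k. (1 / 2 ^ k) *\<^sub>R iexp (t * signed_sum u k bs))"
    unfolding char_def sign_distr_def
    by (subst integral_distr, simp, simp, subst integral_measure_pmf[of "bit_strings k"])
      (auto simp: pmf_of_set card_bit_strings)
  also have "\<dots> = Complex (avg k (\<lambda>bs. cos (0 + t * signed_sum u k bs))) (avg k (\<lambda>bs. sin (t * signed_sum u k bs)))"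
    by (simp add: complex_eq_iff avg_def sum_divide_distrib Re_exp Im_exp)
  also have "\<dots> = of_real (\<Prod>j<k. cos (t * u j))"
    unfolding avg_cos_signed_sum avg_sin_signed_sum complex_of_real_def by simp
  finally show ?thesis .
qed

text \<open>The mean absolute value of a standard normal variable.\<close>

abbreviation gauss_abs :: real where "gauss_abs \<equiv> sqrt (2 / pi)"

text \<open>Weak convergence needs bounded test functions. The truncation error x^2/R is averaged
  against a second moment equal to 1, both for the signed sums and for the normal
  distribution.\<close>

lemma abs_truncation: "R > 0 \<Longrightarrow> min \<bar>x\<bar> R \<le> \<bar>x\<bar> \<and> \<bar>x\<bar> \<le> min \<bar>x\<bar> R + x\<^sup>2 / R" for x :: real
proof -
  assume R: "R > 0"
  have "\<bar>x\<bar> \<le> x\<^sup>2 / R" if "\<bar>x\<bar> > R"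
  proof -
    have "\<bar>x\<bar> * R \<le> \<bar>x\<bar> * \<bar>x\<bar>" using that by (intro mult_left_mono) auto
    then show ?thesis using R by (simp add: le_divide_eq power2_eq_square)
  qed
  moreover have "x\<^sup>2 / R \<ge> 0" using R by simp
  ultimately show ?thesis using R by (auto simp: min_def)
qed

lemma normal_truncation:
  assumes R: "R > 0"
  shows "\<bar>(LINT x|std_normal_distribution. min \<bar>x\<bar> R) - gauss_abs\<bar> \<le> 1 / R"
proof -
  interpret real_distribution std_normal_distribution by (rule real_dist_normal_dist)
  have 1: "integrable std_normal_distribution (\<lambda>x. \<bar>x\<bar>)" "(LINT x|std_normal_distribution. \<bar>x\<bar>) = gauss_abs"
    using integrable_std_normal_moment_abs[of 1] integral_std_normal_moment_abs_odd[of 0]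
    by (simp_all add: integrable_density integral_density)
  have 2: "integrable std_normal_distribution (\<lambda>x. x\<^sup>2)" "(LINT x|std_normal_distribution. x\<^sup>2) = 1"
    using integrable_std_normal_moment[of 2] integral_std_normal_moment_even[of 1]
    by (simp_all add: integrable_density integral_density)
  have 3: "integrable std_normal_distribution (\<lambda>x. min \<bar>x\<bar> R)"
    by (rule integrable_const_bound[where B = R]) (use R in auto)
  have "(LINT x|std_normal_distribution. min \<bar>x\<bar> R) \<le> (LINT x|std_normal_distribution. \<bar>x\<bar>)"
    using 1 3 abs_truncation[OF R] by (intro integral_mono) auto
  moreover have "(LINT x|std_normal_distribution. \<bar>x\<bar>) \<le> (LINT x|std_normal_distribution. min \<bar>x\<bar> R + x\<^sup>2 / R)"
    using 1 2 3 abs_truncation[OF R] by (intro integral_mono) auto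
  moreover have "(LINT x|std_normal_distribution. min \<bar>x\<bar> R + x\<^sup>2 / R) =
     (LINT x|std_normal_distribution. min \<bar>x\<bar> R) + 1 / R"
    using 2 3 by simp
  ultimately show ?thesis using 1 by simp
qed

lemma avg_truncation:
  assumes R: "R > 0" and u: "(\<Sum>j<k. (u j)\<^sup>2) = 1"
  shows "\<bar>avg k (\<lambda>bs. min \<bar>signed_sum u k bs\<bar> R) - avg k (\<lambda>bs. \<bar>signed_sum u k bs\<bar>)\<bar> \<le> 1 / R"
proof -
  have "avg k (\<lambda>bs. min \<bar>signed_sum u k bs\<bar> R) \<le> avg k (\<lambda>bs. \<bar>signed_sum u k bs\<bar>)"
    by (rule avg_mono) simp
  moreover have "avg k (\<lambda>bs. \<bar>signed_sum u k bs\<bar>) \<le>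
      avg k (\<lambda>bs. min \<bar>signed_sum u k bs\<bar> R + 1 / R * (signed_sum u k bs)\<^sup>2)"
    using abs_truncation[OF R] by (intro avg_mono) simp
  moreover have "\<dots> = avg k (\<lambda>bs. min \<bar>signed_sum u k bs\<bar> R) + 1 / R"
    unfolding avg_add avg_cmult avg_signed_sum_moments(1) u by simp
  ultimately show ?thesis by simp
qed

lemma avg_abs_signed_sum:
  assumes \<eta>: "\<eta> > 0"
  shows "\<exists>\<delta>>0. \<forall>k u. (\<Sum>j<k. (u j)\<^sup>2) = 1 \<longrightarrow> (\<forall>j<k. (u j)\<^sup>2 \<le> \<delta>) \<longrightarrow>
     \<bar>avg k (\<lambda>bs. \<bar>signed_sum u k bs\<bar>) - gauss_abs\<bar> < \<eta>"
proof (rule ccontr)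
  assume "\<not> ?thesis"
  then have "\<forall>\<delta>>0. \<exists>k u. (\<Sum>j<k. (u j)\<^sup>2) = 1 \<and> (\<forall>j<k. (u j)\<^sup>2 \<le> \<delta>) \<and>
     \<bar>avg k (\<lambda>bs. \<bar>signed_sum u k bs\<bar>) - gauss_abs\<bar> \<ge> \<eta>"
    by (meson linorder_not_less)
  then have "\<forall>n. \<exists>k u. (\<Sum>j<k. (u j)\<^sup>2) = 1 \<and> (\<forall>j<k. (u j)\<^sup>2 \<le> 1 / real (Suc n)) \<and>
     \<bar>avg k (\<lambda>bs. \<bar>signed_sum u k bs\<bar>) - gauss_abs\<bar> \<ge> \<eta>" by simp
  then obtain k u where u: "\<And>n. (\<Sum>j<k n. (u n j)\<^sup>2) = 1"
      "\<And>n j. j < k n \<Longrightarrow> (u n j)\<^sup>2 \<le> 1 / real (Suc n)"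
    and far: "\<And>n. \<bar>avg (k n) (\<lambda>bs. \<bar>signed_sum (u n) (k n) bs\<bar>) - gauss_abs\<bar> \<ge> \<eta>"
    by metis
  \<comment> \<open>Leaves two truncation errors of at most \<eta>/3 each, next to a convergence
    error below \<eta>/3.\<close>
  define R where "R = 3 / \<eta>"
  have R: "R > 0" "1 / R = \<eta> / 3" using \<eta> by (auto simp: R_def)
  have "weak_conv_m (\<lambda>n. sign_distr (u n) (k n)) std_normal_distribution"
  proof (rule levy_continuity)
    fix t
    have "(\<lambda>n. t ^ 4 * (1 / real (Suc n))) \<longlonglongrightarrow> t ^ 4 * 0"
      by (intro tendsto_mult tendsto_const LIMSEQ_Suc lim_1_over_n)
    then have "(\<lambda>n. t ^ 4 * (1 / real (Suc n))) \<longlonglongrightarrow> 0" by simp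
    then have "(\<lambda>n. (\<Prod>j<k n. cos (t * u n j)) - exp (- (t\<^sup>2 / 2))) \<longlonglongrightarrow> 0"
      by (rule Lim_null_comparison[rotated]) (use prod_cos_close[OF u] in auto)
    then have "(\<lambda>n. \<Prod>j<k n. cos (t * u n j)) \<longlonglongrightarrow> exp (- (t\<^sup>2 / 2))"
      by (simp add: LIM_zero_iff)
    then have "(\<lambda>n. complex_of_real (\<Prod>j<k n. cos (t * u n j))) \<longlonglongrightarrow> of_real (exp (- (t\<^sup>2 / 2)))"
      by (rule tendsto_of_real)
    then show "(\<lambda>n. char (sign_distr (u n) (k n)) t) \<longlonglongrightarrow> char std_normal_distribution t"
      by (simp only: char_sign_distr char_std_normal_distribution minus_divide_left)
  qed (auto intro: real_distribution_sign_distr real_dist_normal_dist)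
  then have "(\<lambda>n. integral\<^sup>L (sign_distr (u n) (k n)) (\<lambda>x. min \<bar>x\<bar> R)) \<longlonglongrightarrow>
      (LINT x|std_normal_distribution. min \<bar>x\<bar> R)"
    by (rule weak_conv_imp_integral_bdd_continuous_conv[rotated 2, where B = R])
      (use R in \<open>auto intro: real_distribution_sign_distr real_dist_normal_dist intro!: continuous_intros\<close>)
  then have "(\<lambda>n. avg (k n) (\<lambda>bs. min \<bar>signed_sum (u n) (k n) bs\<bar> R)) \<longlonglongrightarrow>
      (LINT x|std_normal_distribution. min \<bar>x\<bar> R)"
    by (simp add: integral_sign_distr)
  from LIMSEQ_D[OF this, of "\<eta> / 3"] \<eta> obtain n where
    "\<bar>avg (k n) (\<lambda>bs. min \<bar>signed_sum (u n) (k n) bs\<bar> R) - (LINT x|std_normal_distribution. min \<bar>x\<bar> R)\<bar> < \<eta> / 3"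
    by auto
  with normal_truncation[OF R(1)] avg_truncation[OF R(1) u(1), of n] far[of n]
  show False unfolding R(2) by linarith
qed

text \<open>
  Each coordinate is spread over \<open>L\<close> independent signs, and all sign patterns are used as rows. By the
  central limit theorem the coordinates of the image are then nearly Gaussian.
\<close>

theorem sign_embedding:
  assumes \<eta>: "0 < \<eta>" and b: "b > 0"
  obtains Q :: nat and T :: "nat \<Rightarrow> nat \<Rightarrow> int" and \<kappa>1 \<kappa>2 :: real
  where "Q > 0" "\<kappa>1 > 0" "\<kappa>2 > 0"
    "\<And>x. L2_set (\<lambda>\<rho>. \<Sum>\<beta><b. of_int (T \<rho> \<beta>) * x \<beta>) {..<Q} = \<kappa>2 * L2_set x {..<b}"
    "\<And>x. (1 - \<eta>) * \<kappa>1 * L2_set x {..<b} \<le> (\<Sum>\<rho><Q. \<bar>\<Sum>\<beta><b. of_int (T \<rho> \<beta>) * x \<beta>\<bar>)"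
    "\<And>x. (\<Sum>\<rho><Q. \<bar>\<Sum>\<beta><b. of_int (T \<rho> \<beta>) * x \<beta>\<bar>) \<le> (1 + \<eta>) * \<kappa>1 * L2_set x {..<b}"
proof -
  have "\<eta> * gauss_abs > 0" using \<eta> by simp
  from avg_abs_signed_sum[OF this] obtain \<delta> where \<delta>: "\<delta> > 0"
    and close: "\<And>k u. (\<Sum>j<k. (u j)\<^sup>2) = 1 \<Longrightarrow> (\<And>j. j < k \<Longrightarrow> (u j)\<^sup>2 \<le> \<delta>) \<Longrightarrow>
     \<bar>avg k (\<lambda>bs. \<bar>signed_sum u k bs\<bar>) - gauss_abs\<bar> < \<eta> * gauss_abs"
    by blast
  \<comment> \<open>Each coordinate of the spread and normalised vector has square at most
    1/L.\<close>
  define L where "L = nat \<lceil>1 / \<delta>\<rceil>"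
  have "real L \<ge> 1 / \<delta>" by (simp add: L_def) linarith
  moreover have "1 / \<delta> > 0" using \<delta> by simp
  ultimately have Lpos: "real L > 0" and "1 \<le> real L * \<delta>" using \<delta> by (linarith, simp add: field_simps)
  then have L: "L > 0" "1 / L \<le> \<delta>" by (auto simp: divide_le_eq mult.commute)
  \<comment> \<open>One row for every sign pattern: a sum over the rows is then exactly Q times an
    average, and the embedding involves no randomness.\<close>
  define Q where "Q = (2::nat) ^ (b * L)"
  obtain h where h: "bij_betw h {..<Q} (bit_strings (b * L))"
    using ex_bij_betw_nat_finite[OF finite_bit_strings[of "b * L"]]
    by (auto simp: card_bit_strings Q_def atLeast0LessThan)
  define T where "T \<rho> \<beta> = (\<Sum>l<L. if h \<rho> ! (\<beta> * L + l) then 1 else (-1::int))" for \<rho> \<beta>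
  define spr where "spr x m = x (m div L)" for x :: "nat \<Rightarrow> real" and m
  have T: "(\<Sum>\<beta><b. of_int (T \<rho> \<beta>) * x \<beta>) = signed_sum (spr x) (b * L) (h \<rho>)" for \<rho> x
  proof -
    have "signed_sum (spr x) (b * L) (h \<rho>) = (\<Sum>\<beta><b. \<Sum>l<L. sgn_bit (h \<rho> ! (\<beta> * L + l)) * x \<beta>)"
      unfolding signed_sum_def sum_nat_mult by (intro sum.cong refl) (simp add: spr_def)
    also have "\<dots> = (\<Sum>\<beta><b. of_int (T \<rho> \<beta>) * x \<beta>)"
      by (intro sum.cong refl) (auto simp: T_def sum_distrib_right sgn_bit_def intro!: sum.cong)
    finally show ?thesis ..
  qed
  have sumQ: "(\<Sum>\<rho><Q. f (h \<rho>)) = Q * avg (b * L) f" for f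
    using sum.reindex_bij_betw[OF h, of f] by (simp add: avg_def Q_def)
  have spr_sq: "(\<Sum>m<b * L. (spr x m)\<^sup>2) = L * (L2_set x {..<b})\<^sup>2" for x
  proof -
    have "(\<Sum>m<b * L. (spr x m)\<^sup>2) = (\<Sum>\<beta><b. \<Sum>l<L. (x \<beta>)\<^sup>2)"
      unfolding sum_nat_mult by (intro sum.cong refl) (simp add: spr_def)
    then show ?thesis by (simp add: L2_set_def sum_nonneg sum_distrib_left)
  qed
  \<comment> \<open>\<kappa>1 is the factor that exactly Gaussian coordinates would give; \<kappa>2
    is exact because variances add.\<close>
  define \<kappa>1 \<kappa>2 where "\<kappa>1 = Q * sqrt L * gauss_abs" and "\<kappa>2 = sqrt (Q * L)"
  have Q: "Q > 0" by (simp add: Q_def)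
  have n2: "L2_set (\<lambda>\<rho>. \<Sum>\<beta><b. of_int (T \<rho> \<beta>) * x \<beta>) {..<Q} = \<kappa>2 * L2_set x {..<b}" for x
  proof -
    have "(\<Sum>\<rho><Q. (signed_sum (spr x) (b * L) (h \<rho>))\<^sup>2) = (\<kappa>2 * L2_set x {..<b})\<^sup>2"
      unfolding sumQ[of "\<lambda>bs. (signed_sum (spr x) (b * L) bs)\<^sup>2"] avg_signed_sum_moments(1) spr_sq
      by (simp add: \<kappa>2_def power_mult_distrib)
    then show ?thesis unfolding T L2_set_def[of _ "{..<Q}"] by (simp add: \<kappa>2_def)
  qed
  have n1: "\<bar>(\<Sum>\<rho><Q. \<bar>\<Sum>\<beta><b. of_int (T \<rho> \<beta>) * x \<beta>\<bar>) - \<kappa>1 * L2_set x {..<b}\<bar> \<le> \<eta> * \<kappa>1 * L2_set x {..<b}" for x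
  proof (cases "L2_set x {..<b} = 0")
    \<comment> \<open>The zero vector cannot be normalised; its image vanishes by the exact l2
      identity.\<close>
    case True
    then have "L2_set (\<lambda>\<rho>. \<Sum>\<beta><b. of_int (T \<rho> \<beta>) * x \<beta>) {..<Q} = 0" by (simp add: n2)
    then have "\<forall>\<rho><Q. (\<Sum>\<beta><b. of_int (T \<rho> \<beta>) * x \<beta>) = 0" by (simp add: L2_set_eq_0_iff)
    then show ?thesis using True by simp
  next
    case False
    define r where "r = L2_set x {..<b}"
    have r: "r > 0" using False by (simp add: r_def less_le)
    define s where "s = sqrt L * r"
    have s: "s > 0" using r L by (simp add: s_def)
    define u where "u = (\<lambda>m. spr x m / s)"
    have u1: "(\<Sum>m<b * L. (u m)\<^sup>2) = 1"
      unfolding u_def power_divide sum_divide_distrib[symmetric] spr_sq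
      using r L by (simp add: s_def r_def[symmetric] power_mult_distrib)
    have u2: "(u m)\<^sup>2 \<le> \<delta>" if "m < b * L" for m
    proof -
      have "m div L < b" using that by (simp add: less_mult_imp_div_less)
      then have "(x (m div L))\<^sup>2 \<le> (\<Sum>\<beta><b. (x \<beta>)\<^sup>2)" by (intro member_le_sum) auto
      also have "\<dots> = r\<^sup>2" by (simp add: r_def L2_set_def sum_nonneg)
      finally have "(u m)\<^sup>2 \<le> r\<^sup>2 / s\<^sup>2"
        unfolding u_def spr_def power_divide by (intro divide_right_mono) auto
      also have "r\<^sup>2 / s\<^sup>2 = 1 / L" using r L by (simp add: s_def power_mult_distrib)
      finally show ?thesis using L by simp
    qed
    have "\<bar>avg (b * L) (\<lambda>bs. \<bar>signed_sum u (b * L) bs\<bar>) - gauss_abs\<bar> < \<eta> * gauss_abs"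
      using close[OF u1 u2] by simp
    moreover have "avg (b * L) (\<lambda>bs. \<bar>signed_sum u (b * L) bs\<bar>) = avg (b * L) (\<lambda>bs. \<bar>signed_sum (spr x) (b * L) bs\<bar>) / s"
      using s avg_cmult[of "b * L" "1 / s" "\<lambda>bs. \<bar>signed_sum (spr x) (b * L) bs\<bar>"]
      by (simp add: u_def signed_sum_divide abs_divide)
    ultimately have "\<bar>avg (b * L) (\<lambda>bs. \<bar>signed_sum (spr x) (b * L) bs\<bar>) / s - gauss_abs\<bar> * (Q * s) \<le>
        (\<eta> * gauss_abs) * (Q * s)"
      using s by (intro mult_right_mono) auto
    moreover have "\<bar>avg (b * L) (\<lambda>bs. \<bar>signed_sum (spr x) (b * L) bs\<bar>) / s - gauss_abs\<bar> * (Q * s) =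
       \<bar>(avg (b * L) (\<lambda>bs. \<bar>signed_sum (spr x) (b * L) bs\<bar>) / s - gauss_abs) * (Q * s)\<bar>"
      using s by (simp add: abs_mult)
    moreover have "(avg (b * L) (\<lambda>bs. \<bar>signed_sum (spr x) (b * L) bs\<bar>) / s - gauss_abs) * (Q * s) =
       Q * avg (b * L) (\<lambda>bs. \<bar>signed_sum (spr x) (b * L) bs\<bar>) - \<kappa>1 * r"
    proof -
      have "X / s * (Q * s) = Q * X" for X :: real using s by simp
      moreover have "gauss_abs * (Q * s) = \<kappa>1 * r" by (simp add: \<kappa>1_def s_def)
      ultimately show ?thesis by (simp only: left_diff_distrib)
    qed
    moreover have "(\<eta> * gauss_abs) * (Q * s) = \<eta> * \<kappa>1 * r" by (simp add: \<kappa>1_def s_def)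
    ultimately show ?thesis
      unfolding T sumQ[of "\<lambda>bs. \<bar>signed_sum (spr x) (b * L) bs\<bar>"] r_def[symmetric] by simp
  qed
  show thesis
  proof (rule that[of Q \<kappa>1 \<kappa>2 T])
    show "\<kappa>1 > 0" "\<kappa>2 > 0" using Q L by (auto simp: \<kappa>1_def \<kappa>2_def)
    show "(1 - \<eta>) * \<kappa>1 * L2_set x {..<b} \<le> (\<Sum>\<rho><Q. \<bar>\<Sum>\<beta><b. of_int (T \<rho> \<beta>) * x \<beta>\<bar>)" for x
      using n1[of x] by (simp add: abs_le_iff algebra_simps)
    show "(\<Sum>\<rho><Q. \<bar>\<Sum>\<beta><b. of_int (T \<rho> \<beta>) * x \<beta>\<bar>) \<le> (1 + \<eta>) * \<kappa>1 * L2_set x {..<b}" for x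
      using n1[of x] by (simp add: abs_le_iff algebra_simps)
  qed (use Q n2 in auto)
qed


section \<open>Bases given by columns\<close>

definition column_list :: "nat \<Rightarrow> nat \<Rightarrow> (nat \<Rightarrow> nat \<Rightarrow> real) \<Rightarrow> real vec list" where
  "column_list N m F = map (\<lambda>j. vec N (F j)) [0..<m]"

text \<open>A basis is a set of vectors, so equal columns have to be excluded: their difference
  would be a nontrivial relation. Span and independence are then carried over from the ambient space
  to the subspace.\<close>

lemma column_list_basis:
  fixes F :: "nat \<Rightarrow> nat \<Rightarrow> real"
  assumes inj: "\<And>u. (\<And>i. i < N \<Longrightarrow> (\<Sum>j<m. u j * F j i) = 0) \<Longrightarrow> (\<And>j. j < m \<Longrightarrow> u j = 0)"
  obtains E where "subspace_of N E" "dim_subspace N E = m" "is_basis_of N (column_list N m F) E"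
    "\<And>x. x \<in> E \<Longrightarrow> dim_vec x = N \<and> (\<exists>u. \<forall>i<N. vec_index x i = (\<Sum>j<m. u j * F j i))"
proof -
  interpret vec_space "TYPE(real)" N .
  let ?vs = "column_list N m F"
  have carr: "set ?vs \<subseteq> carrier_vec N" by (auto simp: column_list_def)
  have len: "length ?vs = m" by (simp add: column_list_def)
  have nth: "j < m \<Longrightarrow> ?vs ! j = vec N (F j)" for j by (simp add: column_list_def)
  have injF: "inj_on (\<lambda>j. vec N (F j)) {..<m}"
  proof (rule inj_onI)
    fix j j' assume j: "j \<in> {..<m}" "j' \<in> {..<m}" and eq: "vec N (F j) = vec N (F j')"
    show "j = j'"
    proof (rule ccontr)
      assume ne: "j \<noteq> j'"
      let ?u = "\<lambda>l. if l = j then 1 else if l = j' then -1 else (0::real)"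
      have "(\<Sum>l<m. ?u l * F l i) = 0" if "i < N" for i
      proof -
        have "(\<Sum>l<m. ?u l * F l i) = (\<Sum>l\<in>{j, j'}. ?u l * F l i)"
          using j by (intro sum.mono_neutral_right) auto
        also have "\<dots> = F j i - F j' i" using ne by simp
        also have "F j i = F j' i" using eq that by (metis index_vec)
        finally show ?thesis by simp
      qed
      from inj[of ?u, OF this, of j] j show False by simp
    qed
  qed
  have dist: "distinct ?vs"
    using injF by (simp add: column_list_def distinct_map atLeast0LessThan)
  have set_vs: "set ?vs = (\<lambda>j. vec N (F j)) ` {..<m}"
    by (auto simp: column_list_def)
  have lc: "vec_index (lincomb c (set ?vs)) i = (\<Sum>j<m. c (vec N (F j)) * F j i)" if "i < N" for c i
  proof -
    have "vec_index (lincomb c (set ?vs)) i = (\<Sum>x\<in>set ?vs. c x * vec_index x i)"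
      by (rule lincomb_index[OF that carr])
    also have "\<dots> = (\<Sum>j<m. c (vec N (F j)) * F j i)"
      unfolding set_vs using injF that by (subst sum.reindex) auto
    finally show ?thesis .
  qed
  have key: "\<forall>v\<in>set ?vs. c v = 0" if z: "lincomb c (set ?vs) = 0\<^sub>v N" for c
  proof -
    have "(\<Sum>j<m. c (vec N (F j)) * F j i) = 0" if "i < N" for i
      using lc[OF that, of c] z that by simp
    from inj[of "\<lambda>j. c (vec N (F j))", OF this]
    have "c (vec N (F j)) = 0" if "j < m" for j using that by blast
    then show ?thesis by (auto simp: set_vs)
  qed
  have li: "lin_indpt (set ?vs)"
    by (rule finite_lin_indpt2) (use carr key in \<open>auto simp: class_ring_simps module_vec_simps\<close>)
  define E where "E = span (set ?vs)"
  have sub: "subspace class_ring E V"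
    unfolding E_def by (rule span_is_subspace) (use carr in simp)
  have inE: "set ?vs \<subseteq> E" unfolding E_def by (rule in_own_span) (use carr in simp)
  interpret W: vectorspace class_ring "restricted_space N E"
    using subspace_is_vs[OF sub] by simp
  have "module.span class_ring (restricted_space N E) (set ?vs) = E"
    using span_li_not_depend(1)[OF inE] sub by (simp add: E_def subspace_def)
  moreover have "module.lin_dep class_ring (restricted_space N E) (set ?vs) = lin_dep (set ?vs)"
    using span_li_not_depend(2)[OF inE] sub by (simp add: subspace_def)
  ultimately have basis: "W.basis (set ?vs)"
    unfolding W.basis_def using li inE by simp
  have "dim_subspace N E = card (set ?vs)"
    unfolding dim_subspace_def by (rule W.dim_basis) (use basis in auto)
  then have dim: "dim_subspace N E = m" using dist len by (simp add: distinct_card)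
  have "dim_vec x = N \<and> (\<exists>u. \<forall>i<N. vec_index x i = (\<Sum>j<m. u j * F j i))" if "x \<in> E" for x
  proof -
    from that obtain c where c: "x = lincomb c (set ?vs)"
      unfolding E_def using finite_span[of "set ?vs"] carr by auto
    have "dim_vec x = N" unfolding c using lincomb_dim[of "set ?vs" c] carr by simp
    then show ?thesis using lc[of _ c] c by (intro conjI exI[of _ "\<lambda>j. c (vec N (F j))"]) auto
  qed
  then show thesis
    using that[of E] sub dim basis dist by (simp add: is_basis_of_def)
qed


section \<open>The algorithm\<close>

text \<open>With K = \<open>Q * Suc D ^ r\<close>, the r-fold power of a matrix with k columns ends
  up in K k^r coordinates; the largest k that fits is wanted.\<close>

definition max_root :: "nat \<Rightarrow> nat \<Rightarrow> nat \<Rightarrow> nat" where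
  "max_root K r N = Max {k. k \<le> N \<and> K * k ^ r \<le> N}"

lemma max_root_props:
  assumes "K > 0" "r > 0"
  shows "max_root K r N \<le> N" "K * max_root K r N ^ r \<le> N" "N < K * (max_root K r N + 1) ^ r"
    "K * (x + 1) ^ r \<le> N \<longleftrightarrow> x < max_root K r N"
proof -
  let ?S = "{k. k \<le> N \<and> K * k ^ r \<le> N}"
  have fin: "finite ?S" by simp
  have "0 \<in> ?S" using assms by (simp add: zero_power)
  then have "max_root K r N \<in> ?S" unfolding max_root_def using fin by (intro Max_in) auto
  then show 1: "max_root K r N \<le> N" and 2: "K * max_root K r N ^ r \<le> N" by auto
  have le: "y \<le> max_root K r N" if "K * y ^ r \<le> N" for y
  proof -
    have "y \<le> y ^ r" using assms(2) by (cases "y = 0") (auto intro: self_le_power)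
    also have "\<dots> \<le> K * y ^ r" using assms(1) by simp
    finally have "y \<in> ?S" using that by simp
    then show ?thesis unfolding max_root_def using fin by (rule Max_ge[rotated])
  qed
  show "N < K * (max_root K r N + 1) ^ r"
    using le[of "max_root K r N + 1"] by (auto simp: not_le[symmetric])
  show "K * (x + 1) ^ r \<le> N \<longleftrightarrow> x < max_root K r N"
  proof
    assume "x < max_root K r N"
    then have "K * (x + 1) ^ r \<le> K * max_root K r N ^ r"
      by (intro mult_left_mono power_mono) auto
    from this 2 show "K * (x + 1) ^ r \<le> N" by (rule order_trans)
  qed (use le[of "x + 1"] in auto)
qed

text \<open>Counting again: the root is the number of x with K (x + 1)^r \<le> N, by the last
  property in \<open>max_root_props\<close>.\<close>

definition rootE :: "nat \<Rightarrow> nat \<Rightarrow> iexp" where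
  "rootE K r = Sigma 2 (IfPos (Minus (Plus Size (Const 1)) (scaleE K (powE (Plus (Var 2) (Const 1)) r)))
     (Const 1) (Const 0))"

lemma ieval_rootE:
  assumes "K > 0" "r > 0"
  shows "ieval (rootE K r) N w e = int (max_root K r N)"
proof -
  have "ieval (rootE K r) N w e = (\<Sum>i<N. if int N + 1 - int K * (int i + 1) ^ r > 0 then 1 else 0)"
    unfolding rootE_def by (simp add: ieval_scaleE ieval_powE cong: if_cong)
  also have "\<dots> = int (max_root K r N) * 1"
  proof (rule sum_threshold)
    fix i
    have "int N + 1 - int K * (int i + 1) ^ r > 0 \<longleftrightarrow> int (K * (i + 1) ^ r) \<le> int N" by (auto simp: add.commute)
    also have "\<dots> \<longleftrightarrow> K * (i + 1) ^ r \<le> N" by (simp only: of_nat_le_iff)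
    also have "\<dots> \<longleftrightarrow> i < max_root K r N" by (rule max_root_props(4)[OF assms])
    finally show "int N + 1 - int K * (int i + 1) ^ r > 0 \<longleftrightarrow> i < max_root K r N" .
  qed (rule max_root_props(1)[OF assms])
  finally show ?thesis by simp
qed

section \<open>Integer entries and the expressions that compute them\<close>

definition base_int :: "nat \<Rightarrow> nat \<Rightarrow> nat \<Rightarrow> (int \<Rightarrow> int) \<Rightarrow> nat \<Rightarrow> nat \<Rightarrow> nat \<Rightarrow> int" where
  "base_int n B k w i c j =
     (if i < n then (if w (int ((i * B + c) * k + j)) > 0 then 1 else -1) else of_bool (i = n + j))"

text \<open>Integer counterpart of \<open>tensor_power\<close>. The factor with values in {-1, 0, 1}
  stands first, where \<open>signmulE\<close> needs it.\<close>

fun tensor_int :: "nat \<Rightarrow> nat \<Rightarrow> nat \<Rightarrow> (nat \<Rightarrow> nat \<Rightarrow> nat \<Rightarrow> int) \<Rightarrow> nat \<Rightarrow> nat \<Rightarrow> nat \<Rightarrow> nat \<Rightarrow> int" where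
  "tensor_int n B k a 0 i c j = 1"
| "tensor_int n B k a (Suc r) i c j =
     a (i mod n) (c mod B) (j mod k) * tensor_int n B k a r (i div n) (c div B) (j div k)"

text \<open>Coordinate \<open>i\<close> is split into a block \<open>i div Q\<close> of the tensor
  power and a row \<open>i mod Q\<close> of the embedding; the coordinates beyond the last block are
  padding.\<close>

definition entry :: "nat \<Rightarrow> nat \<Rightarrow> nat \<Rightarrow> nat \<Rightarrow> nat \<Rightarrow> (nat \<Rightarrow> nat \<Rightarrow> int) \<Rightarrow> (int \<Rightarrow> int) \<Rightarrow> nat \<Rightarrow> nat \<Rightarrow> int" where
  "entry D B k r Q T w j i =
     (if i < (D * k + k) ^ r * Q
      then \<Sum>\<beta><B ^ r. T (i mod Q) \<beta> * tensor_int (D * k + k) B k (base_int (D * k) B k w) r (i div Q) \<beta> j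
      else 0)"

text \<open>\<open>k\<close> is the first factor of \<open>mulE\<close> because it is at most N,
  whereas B i + c need not be. The place \<open>c\<close> ranges over a set of constant size and is
  therefore a number, not an expression.\<close>

definition baseE :: "nat \<Rightarrow> nat \<Rightarrow> iexp \<Rightarrow> iexp \<Rightarrow> nat \<Rightarrow> iexp \<Rightarrow> iexp" where
  "baseE D B k i c j = IfPos (Minus (scaleE D k) i)
     (IfPos (Bit (Plus (mulE k (Plus (scaleE B i) (Const (int c)))) j)) (Const 1) (Const (- 1)))
     (eqE i (Plus (scaleE D k) j) (Const 1) (Const 0))"

fun tensorE :: "nat \<Rightarrow> nat \<Rightarrow> iexp \<Rightarrow> nat \<Rightarrow> iexp \<Rightarrow> nat \<Rightarrow> iexp \<Rightarrow> iexp" where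
  "tensorE D B k 0 i c j = Const 1"
| "tensorE D B k (Suc r) i c j =
     signmulE (baseE D B k (modE i (scaleE (Suc D) k)) (c mod B) (modE j k))
       (tensorE D B k r (divE i (scaleE (Suc D) k)) (c div B) (divE j k))"

text \<open>The embedding \<open>T\<close> is known only to exist, but finitely many values of it
  matter and can be written into the program. The row \<open>i mod Q\<close> is known only at run
  time, so all Q rows are tested for it.\<close>

definition entryE :: "nat \<Rightarrow> nat \<Rightarrow> iexp \<Rightarrow> nat \<Rightarrow> nat \<Rightarrow> (nat \<Rightarrow> nat \<Rightarrow> int) \<Rightarrow> iexp" where
  "entryE D B k r Q T =
     IfPos (Minus (scaleE Q (powE (scaleE (Suc D) k) r)) (Var 1))
       (sumE (\<lambda>\<rho>. eqE (modE (Var 1) (Const (int Q))) (Const (int \<rho>))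
          (sumE (\<lambda>\<beta>. intscaleE (T \<rho> \<beta>) (tensorE D B k r (divE (Var 1) (Const (int Q))) \<beta> (Var 0))) (B ^ r))
          (Const 0)) Q)
       (Const 0)"

lemma ieval_baseE:
  assumes "ieval k N w e = int k'" "ieval i N w e = int i'" "ieval j N w e = int j'" "k' \<le> N"
  shows "ieval (baseE D B k i c j) N w e = base_int (D * k') B k' w i' c j'"
proof -
  have "ieval (mulE k (Plus (scaleE B i) (Const (int c)))) N w e = int k' * (int B * int i' + int c)"
    using assms by (simp add: ieval_mulE ieval_scaleE)
  then have idx: "ieval (Plus (mulE k (Plus (scaleE B i) (Const (int c)))) j) N w e = int ((i' * B + c) * k' + j')"
    using assms by (simp add: algebra_simps)
  have "int D * int k' - int i' > 0 \<longleftrightarrow> i' < D * k'"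
    by (simp flip: of_nat_mult)
  moreover have "int i' = int D * int k' + int j' \<longleftrightarrow> i' = D * k' + j'"
    by (simp flip: of_nat_mult of_nat_add)
  ultimately show ?thesis
    using assms idx unfolding baseE_def base_int_def
    by (simp add: ieval_eqE ieval_scaleE del: ieval.simps(5)) (simp add: ieval_scaleE)
qed

lemma base_int_values: "base_int n B k w i c j \<in> {-1, 0, 1}"
  by (simp add: base_int_def)

lemma ieval_tensorE:
  assumes k: "ieval k N w e = int k'" "k' > 0" "Suc D * k' \<le> N"
    and "ieval i N w e = int i'" "i' \<le> N" "ieval j N w e = int j'" "j' \<le> N"
  shows "ieval (tensorE D B k r i c j) N w e =
    tensor_int (D * k' + k') B k' (base_int (D * k') B k' w) r i' c j'"
  using assms(4-)
proof (induction r arbitrary: i i' c j j')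
  case (Suc r)
  have n: "ieval (scaleE (Suc D) k) N w e = int (D * k' + k')"
    using k by (simp add: ieval_scaleE algebra_simps)
  have kN: "k' \<le> N" using k by simp
  have i: "ieval (modE i (scaleE (Suc D) k)) N w e = int (i' mod (D * k' + k'))"
      "ieval (divE i (scaleE (Suc D) k)) N w e = int (i' div (D * k' + k'))"
    using Suc.prems k by (simp_all only: ieval_modE ieval_divE n) (simp_all add: zmod_int zdiv_int ieval_modE ieval_divE n)
  have j: "ieval (modE j k) N w e = int (j' mod k')" "ieval (divE j k) N w e = int (j' div k')"
    using Suc.prems k by (simp_all add: ieval_modE ieval_divE zmod_int zdiv_int)
  have b: "ieval (baseE D B k (modE i (scaleE (Suc D) k)) (c mod B) (modE j k)) N w e =
     base_int (D * k') B k' w (i' mod (D * k' + k')) (c mod B) (j' mod k')"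
    by (rule ieval_baseE) (use k i j kN in auto)
  have t: "ieval (tensorE D B k r (divE i (scaleE (Suc D) k)) (c div B) (divE j k)) N w e =
     tensor_int (D * k' + k') B k' (base_int (D * k') B k' w) r (i' div (D * k' + k')) (c div B) (j' div k')"
    by (rule Suc.IH[OF i(2) _ j(2)]) (use Suc.prems in \<open>auto intro: le_trans[OF div_le_dividend]\<close>)
  show ?case
    unfolding tensorE.simps tensor_int.simps
    by (subst ieval_signmulE) (use base_int_values in \<open>simp_all only: b t\<close>)
qed simp

lemma ieval_entryE:
  assumes k: "\<And>e. ieval k N w e = int k'" "k' > 0" "Suc D * k' \<le> N" and Q: "Q > 0"
    and ij: "i < N" "j < N" "e 0 = int j" "e 1 = int i"
  shows "ieval (entryE D B k r Q T) N w e = entry D B k' r Q T w j i"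
proof -
  have n: "ieval (scaleE (Suc D) k) N w e = int (D * k' + k')"
    using k by (simp add: ieval_scaleE algebra_simps)
  have nr: "ieval (scaleE Q (powE (scaleE (Suc D) k) r)) N w e = int ((D * k' + k') ^ r * Q)"
  proof -
    have "D * k' + k' \<le> N" using k(3) by simp
    then have le: "0 \<le> ieval (scaleE (Suc D) k) N w e" "ieval (scaleE (Suc D) k) N w e \<le> int N"
      unfolding n by (simp, simp only: of_nat_le_iff)
    show ?thesis unfolding ieval_scaleE[of Q] ieval_powE[OF le] n by (simp add: mult.commute)
  qed
  have i: "ieval (modE (Var 1) (Const (int Q))) N w e = int (i mod Q)"
      "ieval (divE (Var 1) (Const (int Q))) N w e = int (i div Q)"
    using ij Q by (simp_all add: ieval_modE ieval_divE zmod_int zdiv_int)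
  have t: "ieval (tensorE D B k r (divE (Var 1) (Const (int Q))) \<beta> (Var 0)) N w e =
     tensor_int (D * k' + k') B k' (base_int (D * k') B k' w) r (i div Q) \<beta> j" for \<beta>
    by (rule ieval_tensorE[OF k(1) k(2) k(3) i(2)]) (use ij in \<open>auto intro: le_trans[OF div_le_dividend]\<close>)
  have inner: "ieval (sumE (\<lambda>\<beta>. intscaleE (T \<rho> \<beta>) (tensorE D B k r (divE (Var 1) (Const (int Q))) \<beta> (Var 0))) (B ^ r)) N w e =
      (\<Sum>\<beta><B ^ r. T \<rho> \<beta> * tensor_int (D * k' + k') B k' (base_int (D * k') B k' w) r (i div Q) \<beta> j)" for \<rho>
    unfolding ieval_sumE ieval_intscaleE t ..
  have "int ((D * k' + k') ^ r * Q) - int i > 0 \<longleftrightarrow> i < (D * k' + k') ^ r * Q"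
    by (simp only: diff_gt_0_iff_gt of_nat_less_iff)
  moreover have "(\<Sum>\<rho><Q. if int (i mod Q) = int \<rho> then f \<rho> else 0) = f (i mod Q)" for f :: "nat \<Rightarrow> int"
  proof -
    have "(\<Sum>\<rho><Q. if int (i mod Q) = int \<rho> then f \<rho> else 0) = (\<Sum>\<rho><Q. if i mod Q = \<rho> then f \<rho> else 0)"
      by (simp only: of_nat_eq_iff)
    then show ?thesis using Q by simp
  qed
  moreover have "e (int 1) = int i" using ij(4) by simp
  ultimately show ?thesis
    unfolding entryE_def entry_def ieval.simps(1,2,6,7) nr ieval_sumE[of _ Q] ieval_eqE i inner using Q by simp
qed

lemma real_base_int:
  assumes "length bs \<ge> n * B * k" "c < B" "j < k"
  shows "real_of_int (base_int n B k (input_memory N bs ''bits'') i c j) = base_matrix n B k bs i c j"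
proof (cases "i < n")
  case True
  have "(i * B + c) * k + j < length bs"
    using index_le(2)[OF True assms(2,1)] assms(3) by (simp add: algebra_simps)
  then show ?thesis
    using True unfolding base_int_def base_matrix_def
    by (simp add: input_memory_def sgn_bit_def del: of_nat_add of_nat_mult)
qed (simp add: base_int_def base_matrix_def)

lemma tensor_power_cong:
  assumes "\<And>i c j. c < B \<Longrightarrow> j < k \<Longrightarrow> real_of_int (a i c j) = a' i c j" "B > 0" "k > 0"
  shows "real_of_int (tensor_int n B k a r i c j) = tensor_power n B k a' r i c j"
  by (induction r arbitrary: i c j) (auto simp: assms mult.commute)

text \<open>Leads from finite averages back to the probability in the theorem.\<close>

lemma measure_ge_avg:
  assumes "\<And>bs. length bs = L \<Longrightarrow> P bs \<Longrightarrow> bs \<in> A"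
  shows "measure_pmf.prob (pmf_of_set (bit_strings L)) A \<ge> 1 - avg L (\<lambda>bs. of_bool (\<not> P bs))"
proof -
  have "1 - avg L (\<lambda>bs. of_bool (\<not> P bs)) = avg L (\<lambda>bs. 1 - of_bool (\<not> P bs))"
    by (simp add: avg_diff)
  also have "\<dots> \<le> avg L (\<lambda>bs. of_bool (bs \<in> A))"
    using assms by (intro avg_mono) (auto simp: of_bool_def)
  also have "\<dots> = measure_pmf.prob (pmf_of_set (bit_strings L)) A"
    unfolding avg_def
    by (subst measure_pmf_of_set) (auto simp: card_bit_strings of_bool_def sum.If_cases Int_def)
  finally show ?thesis .
qed

text \<open>Joins the run of the machine with the linear algebra, for one fixed bit string. About
  the matrix it asks only for independent columns, so it serves small and large N alike.\<close>

lemma generates_output_program: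
  assumes a: "\<And>i j e. i < N \<Longrightarrow> j < N \<Longrightarrow> e 0 = int j \<Longrightarrow> e 1 = int i \<Longrightarrow>
       ieval a N (input_memory N bs ''bits'') e = F j i"
    and m: "\<And>e. ieval mE N (input_memory N bs ''bits'') e = int m"
    and M: "\<And>e. ieval ME N (input_memory N bs ''bits'') e = M"
    and q: "q > 0" and mN: "m \<le> N"
    and inj: "\<And>u. (\<And>i. i < N \<Longrightarrow> (\<Sum>j<m. u j * real_of_int (F j i)) = 0) \<Longrightarrow> (\<And>j. j < m \<Longrightarrow> u j = 0)"
  shows "\<exists>E. generates (output_program a mE ME q) (poly (output_poly a mE ME) N) N bs
      (real_of_int M / real_of_int q) m E \<and>
    (\<forall>x\<in>E. dim_vec x = N \<and> (\<exists>u. \<forall>i<N. vec_index x i = (\<Sum>j<m. u j * real_of_int (F j i))))"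
proof -
  let ?s = "input_memory N bs"
  have "?s ''N'' 0 = int N" by (simp add: input_memory_def)
  from runs_output_program[where s = ?s and N = N and a = a and F = F and m = mE and m' = "int m" and M = ME and M' = M and q = q, OF this a m M] obtain s t where
    t: "exec (output_program a mE ME q) ?s t s" "t \<le> poly (output_poly a mE ME) N"
    and s: "\<And>i j. j < N \<Longrightarrow> i < N \<Longrightarrow> s ''num'' (int (j * N + i)) = F j i \<and> s ''den'' (int (j * N + i)) = 1"
      "s ''m'' 0 = int m" "s ''M_num'' 0 = M" "s ''M_den'' 0 = q"
    unfolding runs_def by blast
  obtain E where E: "subspace_of N E" "dim_subspace N E = m"
      "is_basis_of N (column_list N m (\<lambda>j i. real_of_int (F j i))) E"
      "\<And>x. x \<in> E \<Longrightarrow> dim_vec x = N \<and> (\<exists>u. \<forall>i<N. vec_index x i = (\<Sum>j<m. u j * real_of_int (F j i)))"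
    using column_list_basis[where N = N and m = m and F = "\<lambda>j i. real_of_int (F j i)"] inj by blast
  have "reads_output N s (real_of_int M / real_of_int q) m (column_list N m (\<lambda>j i. real_of_int (F j i)))"
    unfolding reads_output_def reads_rat_def using s q mN
    by (auto simp: column_list_def simp del: of_nat_add of_nat_mult)
  then show ?thesis
    unfolding generates_def using E t by blast
qed


section \<open>Nearly Euclidean subspaces\<close>

text \<open>The embedding acts on each block separately and reproduces its Euclidean norm exactly in
  l2 and approximately in l1. Summed over the blocks, \<open>norm2\<close> therefore sees
  \<open>norm22\<close> and \<open>norm1\<close> sees \<open>norm12\<close>.\<close>

lemma embedded_norms:
  fixes x :: "nat \<Rightarrow> nat \<Rightarrow> real" and T :: "nat \<Rightarrow> nat \<Rightarrow> int"
  assumes n2: "\<And>x. L2_set (\<lambda>\<rho>. \<Sum>\<beta><b. of_int (T \<rho> \<beta>) * x \<beta>) {..<Q} = \<kappa>2 * L2_set x {..<b}" and \<kappa>2: "\<kappa>2 > 0"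
    and lo: "\<And>x. \<mu> * L2_set x {..<b} \<le> (\<Sum>\<rho><Q. \<bar>\<Sum>\<beta><b. of_int (T \<rho> \<beta>) * x \<beta>\<bar>)"
    and hi: "\<And>x. (\<Sum>\<rho><Q. \<bar>\<Sum>\<beta><b. of_int (T \<rho> \<beta>) * x \<beta>\<bar>) \<le> \<nu> * L2_set x {..<b}"
    and N: "n * Q \<le> N" "dim_vec v = N"
    and v: "\<And>i. i < N \<Longrightarrow> vec_index v i = (if i < n * Q then \<Sum>\<beta><b. of_int (T (i mod Q) \<beta>) * x (i div Q) \<beta> else 0)"
  shows "norm2 v = \<kappa>2 * norm22 n b x" "\<mu> * norm12 n b x \<le> norm1 v" "norm1 v \<le> \<nu> * norm12 n b x"
proof -
  define y where "y I \<rho> = (\<Sum>\<beta><b. of_int (T \<rho> \<beta>) * x I \<beta>)" for I \<rho>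
  \<comment> \<open>The condition on \<open>g\<close> makes the padding contribute nothing.\<close>
  have sum: "(\<Sum>i<N. g (vec_index v i)) = (\<Sum>I<n. \<Sum>\<rho><Q. g (y I \<rho>))" if g0: "g 0 = 0" for g :: "real \<Rightarrow> real"
  proof -
    have "(\<Sum>i<N. g (vec_index v i)) = (\<Sum>i<n * Q. g (vec_index v i))"
      using N(1) v g0 by (intro sum.mono_neutral_right) auto
    also have "\<dots> = (\<Sum>i<n * Q. g (y (i div Q) (i mod Q)))"
      using N(1) v by (intro sum.cong refl) (simp add: y_def)
    also have "\<dots> = (\<Sum>I<n. \<Sum>\<rho><Q. g (y I \<rho>))"
      unfolding sum_nat_mult by (intro sum.cong refl) simp
    finally show ?thesis .
  qed
  have n1: "norm1 v = (\<Sum>I<n. \<Sum>\<rho><Q. \<bar>y I \<rho>\<bar>)"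
    unfolding norm1_def N(2) by (rule sum) simp
  show "\<mu> * norm12 n b x \<le> norm1 v" "norm1 v \<le> \<nu> * norm12 n b x"
    unfolding n1 norm12_def sum_distrib_left y_def by (rule sum_mono, rule lo, rule sum_mono, rule hi)
  have "norm2 v = sqrt (\<Sum>I<n. \<Sum>\<rho><Q. (y I \<rho>)\<^sup>2)"
    unfolding norm2_def N(2) by (subst sum) auto
  also have "\<dots> = L2_set (\<lambda>I. L2_set (y I) {..<Q}) {..<n}"
    by (simp add: L2_set_def sum_nonneg)
  also have "\<dots> = L2_set (\<lambda>I. \<kappa>2 * L2_set (x I) {..<b}) {..<n}"
    unfolding y_def n2 ..
  also have "\<dots> = \<kappa>2 * norm22 n b x"
    using \<kappa>2 by (simp add: L2_set_cmult norm22_def)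
  finally show "norm2 v = \<kappa>2 * norm22 n b x" .
qed

text \<open>One has k^2 \<le> N^(2/r) \<le> y for y = N^(\<gamma>/2). The product of D B and y is at
  most the larger of y^2 and (D B)^2, which the two terms of the maximum cover. The logarithm is at
  least 1, as N \<ge> 7 exceeds e.\<close>

lemma num_bits_ge:
  assumes \<epsilon>: "0 < \<epsilon>" "\<epsilon> < 1" and \<gamma>: "0 < \<gamma>" "\<gamma> < 1"
    and r: "real r * \<gamma> \<ge> 4" and k: "k \<ge> 7" "k ^ r \<le> N" "k \<le> N"
  shows "D * k * B * k \<le> num_bits ((real (D * B))\<^sup>2 + 1) \<epsilon> \<gamma> N"
proof -
  have r0: "real r > 0" using r \<gamma> by (cases "r = 0") auto
  have N: "real N \<ge> 7" using k by linarith
  define y where "y = real N powr (\<gamma> / 2)"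
  have y0: "y \<ge> 0" by (simp add: y_def)
  have yy: "y * y = real N powr \<gamma>" unfolding y_def by (simp flip: powr_add)
  have "(real k)\<^sup>2 = (real k powr real r) powr (2 / real r)"
    using k r0 by (simp add: powr_powr)
  also have "real k powr real r = real (k ^ r)" using k by (simp add: powr_realpow)
  also have "real (k ^ r) powr (2 / real r) \<le> real N powr (2 / real r)"
    using k by (intro powr_mono2) auto
  also have "\<dots> \<le> y"
    unfolding y_def using N r r0 by (intro powr_mono) (auto simp: field_simps)
  finally have ky: "(real k)\<^sup>2 \<le> y" .
  let ?C = "(real (D * B))\<^sup>2 + 1"
  have "real (D * k * B * k) = real (D * B) * (real k)\<^sup>2"
    by (simp add: power2_eq_square)
  also have "\<dots> \<le> real (D * B) * y" using ky by (intro mult_left_mono) auto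
  also have "\<dots> \<le> max (real N powr \<gamma>) ?C"
  proof (cases "real (D * B) \<le> y")
    case True
    then have "real (D * B) * y \<le> y * y" using y0 by (intro mult_right_mono)
    then show ?thesis using yy by linarith
  next
    case False
    then have "real (D * B) * y \<le> real (D * B) * real (D * B)" by (intro mult_left_mono) auto
    then show ?thesis by (simp add: power2_eq_square)
  qed
  finally have 1: "real (D * k * B * k) \<le> max (real N powr \<gamma>) ?C" .
  have "\<epsilon> * \<gamma> \<le> 1 * 1" using \<epsilon> \<gamma> by (intro mult_mono) auto
  then have "real N * (\<epsilon> * \<gamma>) \<le> real N * 1" by (intro mult_left_mono) auto
  then have "real N \<le> real N / (\<epsilon> * \<gamma>)" using \<epsilon> \<gamma> by (simp add: le_divide_eq)
  moreover have "exp 1 \<le> real N" using exp_le N by linarith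
  ultimately have "exp 1 \<le> real N / (\<epsilon> * \<gamma>)" by linarith
  then have ln: "ln (real N / (\<epsilon> * \<gamma>)) \<ge> 1"
    using \<epsilon> \<gamma> N by (subst ln_ge_iff) auto
  have "real (D * k * B * k) \<le> max (real N powr \<gamma>) ?C * 1" using 1 by simp
  also have "\<dots> \<le> max (real N powr \<gamma>) ?C * ln (real N / (\<epsilon> * \<gamma>))"
    using ln by (intro mult_left_mono) (auto simp: le_max_iff_disj)
  finally have "real (D * k * B * k) \<le> max (real N powr \<gamma>) ?C * ln (real N / (\<epsilon> * \<gamma>))" .
  then show ?thesis unfolding num_bits_def by (rule le_nat_floor)
qed

lemma one_dimensional:
  fixes x :: "real vec"
  assumes "dim_vec x = N" "N > 0" "\<And>i. i < N \<Longrightarrow> vec_index x i = (if i = 0 then z else 0)"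
  shows "norm1 x = \<bar>z\<bar>" "norm2 x = \<bar>z\<bar>"
proof -
  have "(\<Sum>i<N. \<bar>vec_index x i\<bar>) = (\<Sum>i<N. if i = 0 then \<bar>z\<bar> else 0)" using assms by (intro sum.cong) auto
  then show "norm1 x = \<bar>z\<bar>" using assms by (simp add: norm1_def)
  have "(\<Sum>i<N. (vec_index x i)\<^sup>2) = (\<Sum>i<N. if i = 0 then z\<^sup>2 else 0)" using assms by (intro sum.cong) auto
  then show "norm2 x = \<bar>z\<bar>" using assms by (simp add: norm2_def)
qed

lemma one_minus_power_ge: "0 \<le> x \<Longrightarrow> x \<le> 1 \<Longrightarrow> (1 - x) ^ n \<ge> 1 - real n * x" for x :: real
  using Bernoulli_inequality[of "- x" n] by simp

lemma nearly_euclidean_subspaces: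
  fixes \<epsilon> \<gamma> :: real
  assumes \<epsilon>: "0 < \<epsilon>" "\<epsilon> < 1" and \<gamma>: "0 < \<gamma>" "\<gamma> < 1"
  shows "\<exists>c>0. \<exists>C>0. \<exists>(A :: program) (p :: nat poly). \<forall>N\<ge>1.
        \<exists>(M :: bool list \<Rightarrow> real) (m :: bool list \<Rightarrow> nat) (E :: bool list \<Rightarrow> real vec set).
          (\<forall>bs \<in> bit_strings (num_bits C \<epsilon> \<gamma> N).
             generates A (poly p N) N bs (M bs) (m bs) (E bs) \<and>
             M bs > 0 \<and> real (m bs) \<ge> c * real N) \<and>
          measure_pmf.prob (pmf_of_set (bit_strings (num_bits C \<epsilon> \<gamma> N)))
            {bs. \<forall>x\<in>E bs. (1 - \<epsilon>) * M bs * norm2 x \<le> norm1 x \<and>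
                           norm1 x \<le> (1 + \<epsilon>) * M bs * norm2 x} > 98 / 100"
proof -
  \<comment> \<open>Gives r\<gamma> \<ge> 4, as \<open>num_bits_ge\<close> asks, with r even, so
    that the square root of \<open>n ^ r\<close> is the integer \<open>n ^ q\<close>, which enters
    M.\<close>
  define q where "q = nat \<lceil>2 / \<gamma>\<rceil>"
  define r where "r = 2 * q"
  have "real q \<ge> 2 / \<gamma>" by (simp add: q_def) linarith
  then have r4: "real r * \<gamma> \<ge> 4" using \<gamma> by (simp add: r_def field_simps)
  have r0: "r > 0" using r4 by (cases "r = 0") auto
  \<comment> \<open>The lower estimate loses r factors 1 - \<eta> to the tensor power and one to the
    embedding; the upper estimate needs 3\<eta> \<le> \<epsilon>.\<close>
  define \<eta> where "\<eta> = \<epsilon> / (r + 3)"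
  have \<eta>: "0 < \<eta>" "\<eta> < 1" using \<epsilon> by (auto simp: \<eta>_def divide_less_eq)
  have \<eta>r: "\<eta> * (r + 3) = \<epsilon>" by (simp add: \<eta>_def)
  obtain B D where B: "B > 0" and D: "D > 0"
    and rand: "\<And>k L. k \<ge> 7 \<Longrightarrow> L \<ge> D * k * B * k \<Longrightarrow>
      avg L (\<lambda>bs. of_bool (\<not> spread (1 - \<eta>) (D * k + k) B k (base_matrix (D * k) B k bs))) < 2 / 100"
    using base_matrix_spread[OF \<eta>] by blast
  define b where "b = B ^ r"
  have b: "b > 0" using B by (simp add: b_def)
  obtain Q :: nat and T :: "nat \<Rightarrow> nat \<Rightarrow> int" and \<kappa>1 \<kappa>2 :: real
    where Q: "Q > 0" and \<kappa>: "\<kappa>1 > 0" "\<kappa>2 > 0"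
    and T2: "\<And>x. L2_set (\<lambda>\<rho>. \<Sum>\<beta><b. of_int (T \<rho> \<beta>) * x \<beta>) {..<Q} = \<kappa>2 * L2_set x {..<b}"
    and Tlo: "\<And>x. (1 - \<eta>) * \<kappa>1 * L2_set x {..<b} \<le> (\<Sum>\<rho><Q. \<bar>\<Sum>\<beta><b. of_int (T \<rho> \<beta>) * x \<beta>\<bar>)"
    and Thi: "\<And>x. (\<Sum>\<rho><Q. \<bar>\<Sum>\<beta><b. of_int (T \<rho> \<beta>) * x \<beta>\<bar>) \<le> (1 + \<eta>) * \<kappa>1 * L2_set x {..<b}"
    by (rule sign_embedding[OF \<eta>(1) b]) (rule that, assumption+)
  \<comment> \<open>M has to be rational, and \<kappa>1/\<kappa>2 need not be. The approximation is
    taken from below, at the cost of a factor 1 - \<eta> in the upper estimate.\<close>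
  have "(1 - \<eta>) * (\<kappa>1 / \<kappa>2) < 1 * (\<kappa>1 / \<kappa>2)" using \<kappa> \<eta> by (intro mult_strict_right_mono) auto
  then obtain \<kappa> where "\<kappa> \<in> \<rat>" and \<kappa>b: "(1 - \<eta>) * (\<kappa>1 / \<kappa>2) < \<kappa>" "\<kappa> < \<kappa>1 / \<kappa>2"
    using Rats_dense_in_real by auto
  then obtain \<kappa>p \<kappa>q :: int where \<kappa>q: "\<kappa>q > 0" and \<kappa>eq: "\<kappa> = of_int \<kappa>p / of_int \<kappa>q"
    by (elim Rats_cases') auto
  have "(1 - \<eta>) * (\<kappa>1 / \<kappa>2) > 0" using \<kappa> \<eta> by simp
  then have \<kappa>0: "\<kappa> > 0" using \<kappa>b(1) by linarith
  define K where "K = Q * Suc D ^ r"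
  have K: "K > 0" using Q by (simp add: K_def)
  define kE where "kE = rootE K r"
  \<comment> \<open>For k < 7 the output is the line through the first unit vector, on which both
    norms agree, with M = 1 written as \<kappa>q/\<kappa>q.\<close>
  define aE where "aE = IfPos (Minus (Const 7) kE) (eqE (Plus (Var 0) (Var 1)) (Const 0) (Const 1) (Const 0))
      (entryE D B kE r Q T)"
  define mE where "mE = IfPos (Minus (Const 7) kE) (Const 1) (powE kE r)"
  define ME where "ME = IfPos (Minus (Const 7) kE) (Const \<kappa>q) (intscaleE \<kappa>p (powE (scaleE (Suc D) kE) q))"
  define C where "C = (real (D * B))\<^sup>2 + 1"
  \<comment> \<open>Fits both cases: for k < 7 the dimension is 1 and N < K 7^r, otherwise N < K (k
    + 1)^r \<le> K (7k)^r.\<close>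
  define c where "c = 1 / real (K * 7 ^ r)"
  have main: "\<exists>(M :: bool list \<Rightarrow> real) (m :: bool list \<Rightarrow> nat) (E :: bool list \<Rightarrow> real vec set).
          (\<forall>bs \<in> bit_strings (num_bits C \<epsilon> \<gamma> N).
             generates (output_program aE mE ME \<kappa>q) (poly (output_poly aE mE ME) N) N bs (M bs) (m bs) (E bs) \<and>
             M bs > 0 \<and> real (m bs) \<ge> c * real N) \<and>
          measure_pmf.prob (pmf_of_set (bit_strings (num_bits C \<epsilon> \<gamma> N)))
            {bs. \<forall>x\<in>E bs. (1 - \<epsilon>) * M bs * norm2 x \<le> norm1 x \<and>
                           norm1 x \<le> (1 + \<epsilon>) * M bs * norm2 x} > 98 / 100"
    if N1: "N \<ge> 1" for N
  proof -
    define k where "k = max_root K r N"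
    note kprops = max_root_props[OF K r0, of N, folded k_def]
    have kE: "ieval kE N w e = int k" for w e
      unfolding kE_def k_def by (rule ieval_rootE[OF K r0])
    define L where "L = num_bits C \<epsilon> \<gamma> N"
    show ?thesis
    proof (cases "k < 7")
      case True
      define F where "F j i = (if i + j = 0 then 1 else 0 :: int)" for j i :: nat
      have "\<exists>E. generates (output_program aE mE ME \<kappa>q) (poly (output_poly aE mE ME) N) N bs
          (real_of_int \<kappa>q / real_of_int \<kappa>q) 1 E \<and>
        (\<forall>x\<in>E. dim_vec x = N \<and> (\<exists>u. \<forall>i<N. vec_index x i = (\<Sum>j<1. u j * real_of_int (F j i))))" for bs
      proof (rule generates_output_program)
        fix u :: "nat \<Rightarrow> real" and j :: nat
        assume "\<And>i. i < N \<Longrightarrow> (\<Sum>j<1. u j * real_of_int (F j i)) = 0" "j < 1"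
        from this(1)[of 0] this(2) show "u j = 0" using N1 by (simp add: F_def)
      qed (use True \<kappa>q N1 in \<open>auto simp: aE_def mE_def ME_def kE ieval_eqE F_def\<close>)
      then obtain E where
        E: "\<And>bs. generates (output_program aE mE ME \<kappa>q) (poly (output_poly aE mE ME) N) N bs
          (real_of_int \<kappa>q / real_of_int \<kappa>q) 1 (E bs)"
        and Ex: "\<And>bs x. x \<in> E bs \<Longrightarrow> dim_vec x = N \<and> (\<exists>u. \<forall>i<N. vec_index x i = (\<Sum>j<1. u j * real_of_int (F j i)))"
        by metis
      have norms: "norm1 x = norm2 x \<and> norm2 x \<ge> 0" if x: "x \<in> E bs" for x bs
      proof -
        from Ex[OF x] obtain u where "dim_vec x = N" "\<And>i. i < N \<Longrightarrow> vec_index x i = (\<Sum>j<1. u j * real_of_int (F j i))"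
          by blast
        then have "norm1 x = \<bar>u 0\<bar>" "norm2 x = \<bar>u 0\<bar>"
          using one_dimensional[of x N "u 0"] N1 by (auto simp: F_def)
        then show ?thesis by simp
      qed
      have "real N \<le> real (K * 7 ^ r)"
      proof -
        have "N < K * (k + 1) ^ r" by (rule kprops)
        also have "\<dots> \<le> K * 7 ^ r" using True by (intro mult_left_mono power_mono) auto
        finally show ?thesis by (simp only: of_nat_le_iff)
      qed
      then have cN: "c * real N \<le> 1" using K by (simp add: c_def divide_le_eq)
      have "{bs. \<forall>x\<in>E bs. (1 - \<epsilon>) * 1 * norm2 x \<le> norm1 x \<and> norm1 x \<le> (1 + \<epsilon>) * 1 * norm2 x} = UNIV"
        using norms \<epsilon> by (auto intro!: mult_left_le_one_le simp: algebra_simps)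
      then show ?thesis
        using E cN \<kappa>q
        by (intro exI[of _ "\<lambda>_. 1"] exI[of _ "\<lambda>_. 1"] exI[of _ E]) (simp add: measure_pmf.prob_space[simplified])
    next
      case False
      then have k7: "k \<ge> 7" by simp
      define n where "n = D * k + k"
      have Kk: "K * k ^ r = n ^ r * Q"
        by (simp add: K_def n_def power_mult_distrib[symmetric] algebra_simps)
      have PN: "n ^ r * Q \<le> N" using kprops(2) Kk by simp
      have n0: "n > 0" using k7 by (simp add: n_def)
      \<comment> \<open>The arithmetic of the program applies to n only if n \<le> N.\<close>
      have "n \<le> n ^ r" using n0 r0 by (intro self_le_power) auto
      also have "\<dots> \<le> n ^ r * Q" using Q by simp
      finally have nN: "n \<le> N" using PN by simp
      have "k ^ r \<le> K * k ^ r" using K by simp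
      then have krN: "k ^ r \<le> N" using kprops(2) by linarith
      have kN: "k \<le> N" by (rule kprops)
      define a where "a bs = base_matrix (D * k) B k bs" for bs
      define w where "w bs = input_memory N bs ''bits''" for bs
      define F where "F bs = entry D B k r Q T (w bs)" for bs
      have L: "L \<ge> D * k * B * k"
        unfolding L_def C_def using \<epsilon> \<gamma> r4 k7 krN kN by (rule num_bits_ge)
      \<comment> \<open>The vector with coefficients \<open>u\<close> in block form, before the
        blocks are embedded.\<close>
      define x where "x bs u = lin (tensor_power n B k (a bs) r) (k ^ r) u" for bs u
      have Fx: "(\<Sum>j<k ^ r. u j * real_of_int (F bs j i)) =
          (if i < n ^ r * Q then \<Sum>\<beta><b. of_int (T (i mod Q) \<beta>) * x bs u (i div Q) \<beta> else 0)"
        if "length bs = L" for bs u i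
      proof (cases "i < n ^ r * Q")
        case True
        have "real_of_int (F bs j i) = (\<Sum>\<beta><b. of_int (T (i mod Q) \<beta>) * tensor_power n B k (a bs) r (i div Q) \<beta> j)" for j
        proof -
          have "real_of_int (tensor_int n B k (base_int (D * k) B k (w bs)) r I \<beta> j) =
             tensor_power n B k (a bs) r I \<beta> j" for I \<beta>
            unfolding w_def a_def
            by (intro tensor_power_cong real_base_int) (use that L B k7 in \<open>auto simp: mult_ac\<close>)
          then show ?thesis using True by (simp add: F_def entry_def n_def b_def)
        qed
        then have "(\<Sum>j<k ^ r. u j * real_of_int (F bs j i)) =
          (\<Sum>j<k ^ r. \<Sum>\<beta><b. of_int (T (i mod Q) \<beta>) * (tensor_power n B k (a bs) r (i div Q) \<beta> j * u j))"
          by (simp add: sum_distrib_left mult_ac)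
        also have "\<dots> = (\<Sum>\<beta><b. of_int (T (i mod Q) \<beta>) * x bs u (i div Q) \<beta>)"
          by (subst sum.swap) (simp add: x_def lin_def sum_distrib_left)
        finally show ?thesis using True by simp
      qed (simp add: F_def entry_def n_def)
      \<comment> \<open>The embedding is injective by the exact l2 identity, and the base matrix by
        its identity part, whatever the bits.\<close>
      have inj: "u j = 0"
        if bs: "length bs = L" and z: "\<And>i. i < N \<Longrightarrow> (\<Sum>j<k ^ r. u j * real_of_int (F bs j i)) = 0" and j: "j < k ^ r"
        for bs u j
      proof (rule tensor_power_injective[where n = n and B = B and k = k and a = "a bs" and r = r and u = u, OF _ _ j])
        fix u :: "nat \<Rightarrow> real" and j
        assume "\<And>i c. i < n \<Longrightarrow> c < B \<Longrightarrow> lin (a bs) k u i c = 0" and j: "j < k"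
        from this(1)[of "D * k + j" 0] j B have "lin (a bs) k u (D * k + j) 0 = 0" by (simp add: n_def)
        moreover have "lin (a bs) k u (D * k + j) 0 = u j"
          using j by (simp add: a_def lin_def base_matrix_def of_bool_def if_distrib[of "\<lambda>x. x * _"] cong: if_cong)
        ultimately show "u j = 0" by simp
      next
        fix I \<beta> assume I: "I < n ^ r" and \<beta>: "\<beta> < B ^ r"
        have "(\<Sum>\<beta><b. of_int (T \<rho> \<beta>) * x bs u I \<beta>) = 0" if \<rho>: "\<rho> < Q" for \<rho>
        proof -
          have "I * Q + \<rho> < n ^ r * Q" by (rule nat_digit_less[OF \<rho> I])
          then show ?thesis using z[of "I * Q + \<rho>"] Fx[OF bs, of u "I * Q + \<rho>"] PN \<rho> by simp
        qed
        then have "L2_set (\<lambda>\<rho>. \<Sum>\<beta><b. of_int (T \<rho> \<beta>) * x bs u I \<beta>) {..<Q} = 0"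
          by (simp add: L2_set_eq_0_iff)
        then have "L2_set (x bs u I) {..<b} = 0" using T2[of "x bs u I"] \<kappa> by simp
        then show "lin (tensor_power n B k (a bs) r) (k ^ r) u I \<beta> = 0"
          using \<beta> by (simp add: L2_set_eq_0_iff x_def b_def)
      qed
      have ev_a: "ieval aE N (w bs) e = F bs j i"
        if "i < N" "j < N" "e 0 = int j" "e 1 = int i" for bs i j e
      proof -
        have "ieval (entryE D B kE r Q T) N (w bs) e = entry D B k r Q T (w bs) j i"
          by (rule ieval_entryE) (use kE k7 nN Q that in \<open>auto simp: n_def\<close>)
        then show ?thesis using False by (simp add: aE_def kE F_def)
      qed
      have ev_m: "ieval mE N (w bs) e = int (k ^ r)" for bs e
        using False kN by (simp add: mE_def kE ieval_powE)
      have ev_M: "ieval ME N (w bs) e = \<kappa>p * int n ^ q" for bs e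
      proof -
        have n: "ieval (scaleE (Suc D) kE) N (w bs) e = int n"
          unfolding ieval_scaleE kE n_def by (simp add: algebra_simps)
        have "ieval (powE (scaleE (Suc D) kE) q) N (w bs) e = int n ^ q"
          by (subst ieval_powE) (use n nN in \<open>simp_all del: scaleE.simps\<close>)
        then show ?thesis
          unfolding ME_def ieval.simps(7) ieval_intscaleE using False by (simp add: kE)
      qed
      define M where "M = \<kappa> * real n ^ q"
      have Meq: "M = real_of_int (\<kappa>p * int n ^ q) / real_of_int \<kappa>q" by (simp add: M_def \<kappa>eq)
      \<comment> \<open>The length condition stands inside the quantifier so that \<open>E\<close>
        can be chosen as a function on all strings.\<close>
      have "\<exists>E. length bs = L \<longrightarrow> generates (output_program aE mE ME \<kappa>q) (poly (output_poly aE mE ME) N) N bs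
          M (k ^ r) E \<and>
        (\<forall>v\<in>E. dim_vec v = N \<and> (\<exists>u. \<forall>i<N. vec_index v i = (\<Sum>j<k ^ r. u j * real_of_int (F bs j i))))" for bs
      proof (cases "length bs = L")
        case True
        have "\<exists>E. generates (output_program aE mE ME \<kappa>q) (poly (output_poly aE mE ME) N) N bs
          (real_of_int (\<kappa>p * int n ^ q) / real_of_int \<kappa>q) (k ^ r) E \<and>
        (\<forall>v\<in>E. dim_vec v = N \<and> (\<exists>u. \<forall>i<N. vec_index v i = (\<Sum>j<k ^ r. u j * real_of_int (F bs j i))))"
        proof (rule generates_output_program)
          show "ieval aE N (input_memory N bs ''bits'') e = F bs j i"
            if "i < N" "j < N" "e 0 = int j" "e 1 = int i" for i j e
            using ev_a[OF that, of bs] by (simp only: w_def)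
          show "ieval mE N (input_memory N bs ''bits'') e = int (k ^ r)"
            "ieval ME N (input_memory N bs ''bits'') e = \<kappa>p * int n ^ q" for e
            using ev_m[of bs e] ev_M[of bs e] by (simp_all only: w_def)
          show "u j = 0" if "\<And>i. i < N \<Longrightarrow> (\<Sum>j<k ^ r. u j * real_of_int (F bs j i)) = 0" "j < k ^ r" for u j
            by (rule inj[OF True that])
        qed (rule \<kappa>q krN)+
        then show ?thesis unfolding Meq by blast
      qed auto
      then have "\<exists>E. \<forall>bs. length bs = L \<longrightarrow> generates (output_program aE mE ME \<kappa>q) (poly (output_poly aE mE ME) N) N bs
          M (k ^ r) (E bs) \<and>
        (\<forall>v\<in>E bs. dim_vec v = N \<and> (\<exists>u. \<forall>i<N. vec_index v i = (\<Sum>j<k ^ r. u j * real_of_int (F bs j i))))"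
        by (intro choice allI)
      then obtain E where E_all: "\<forall>bs. length bs = L \<longrightarrow> generates (output_program aE mE ME \<kappa>q) (poly (output_poly aE mE ME) N) N bs
          M (k ^ r) (E bs) \<and>
        (\<forall>v\<in>E bs. dim_vec v = N \<and> (\<exists>u. \<forall>i<N. vec_index v i = (\<Sum>j<k ^ r. u j * real_of_int (F bs j i))))"
        by (elim exE)
      have E: "generates (output_program aE mE ME \<kappa>q) (poly (output_poly aE mE ME) N) N bs M (k ^ r) (E bs)"
        if "length bs = L" for bs using E_all that by simp
      have Ev: "dim_vec v = N \<and> (\<exists>u. \<forall>i<N. vec_index v i = (\<Sum>j<k ^ r. u j * real_of_int (F bs j i)))"
        if "length bs = L" "v \<in> E bs" for bs v using E_all that by simp
      have Mpos: "M > 0" using \<kappa>0 n0 by (simp add: M_def)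
      have dim: "real (k ^ r) \<ge> c * real N"
      proof -
        have "N \<le> K * (k + 1) ^ r" using kprops(3) by simp
        also have "\<dots> \<le> K * (7 * k) ^ r" using k7 by (intro mult_left_mono power_mono) auto
        finally have "real N \<le> real (K * (7 * k) ^ r)" by (simp only: of_nat_le_iff)
        also have "\<dots> = real (k ^ r) * real (K * 7 ^ r)" by (simp add: power_mult_distrib)
        finally show ?thesis using K by (simp add: c_def divide_le_eq)
      qed
      have good: "(1 - \<epsilon>) * M * norm2 v \<le> norm1 v \<and> norm1 v \<le> (1 + \<epsilon>) * M * norm2 v"
        if bs: "length bs = L" and sp: "spread (1 - \<eta>) n B k (a bs)" and v: "v \<in> E bs" for bs v
      proof -
        from Ev[OF bs v] obtain u where u: "dim_vec v = N"
          "\<And>i. i < N \<Longrightarrow> vec_index v i = (\<Sum>j<k ^ r. u j * real_of_int (F bs j i))" by blast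
        let ?x = "x bs u"
        have v': "vec_index v i = (if i < n ^ r * Q then \<Sum>\<beta><b. of_int (T (i mod Q) \<beta>) * ?x (i div Q) \<beta> else 0)"
          if "i < N" for i using u(2)[OF that] Fx[OF bs] by simp
        have e2: "norm2 v = \<kappa>2 * norm22 (n ^ r) b ?x"
          and e1: "(1 - \<eta>) * \<kappa>1 * norm12 (n ^ r) b ?x \<le> norm1 v" "norm1 v \<le> (1 + \<eta>) * \<kappa>1 * norm12 (n ^ r) b ?x"
          using embedded_norms[OF T2 \<kappa>(2) Tlo Thi PN u(1) v'] by auto
        have sq: "sqrt (real (n ^ r)) = real n ^ q"
        proof -
          have "real (n ^ r) = (real n ^ q)\<^sup>2" by (simp add: r_def power_mult[symmetric] mult.commute)
          then show ?thesis by simp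
        qed
        have "spread ((1 - \<eta>) ^ r) (n ^ r) b (k ^ r) (tensor_power n B k (a bs) r)"
          unfolding b_def using spread_tensor_power[OF sp] \<eta> by simp
        then have lo: "(1 - \<eta>) ^ r * real n ^ q * norm22 (n ^ r) b ?x \<le> norm12 (n ^ r) b ?x"
          unfolding spread_def x_def sq by blast
        have hi: "norm12 (n ^ r) b ?x \<le> real n ^ q * norm22 (n ^ r) b ?x"
          using norm12_le_norm22[of "n ^ r" b ?x] unfolding sq .
        define z where "z = norm22 (n ^ r) b ?x"
        have z0: "z \<ge> 0" by (simp add: z_def)
        have \<kappa>1b: "\<kappa> * \<kappa>2 \<le> \<kappa>1" "(1 - \<eta>) * \<kappa>1 \<le> \<kappa> * \<kappa>2"
          using \<kappa>b \<kappa> by (simp_all add: field_simps)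
        have "(1 - \<epsilon>) * M * norm2 v = (1 - \<epsilon>) * (\<kappa> * \<kappa>2) * (real n ^ q * z)"
          by (simp add: M_def e2 z_def)
        also have "\<dots> \<le> (1 - \<eta>) ^ (r + 1) * \<kappa>1 * (real n ^ q * z)"
        proof (intro mult_right_mono mult_mono \<kappa>1b)
          have "1 - \<epsilon> \<le> 1 - real (r + 1) * \<eta>"
            using \<eta> \<eta>r by (simp add: algebra_simps)
          also have "\<dots> \<le> (1 - \<eta>) ^ (r + 1)" using \<eta> by (intro one_minus_power_ge) auto
          finally show "1 - \<epsilon> \<le> (1 - \<eta>) ^ (r + 1)" .
        qed (use \<eta> \<kappa> \<kappa>0 z0 in auto)
        also have "\<dots> = (1 - \<eta>) * \<kappa>1 * ((1 - \<eta>) ^ r * real n ^ q * z)" by simp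
        also have "\<dots> \<le> (1 - \<eta>) * \<kappa>1 * norm12 (n ^ r) b ?x"
          using lo \<eta> \<kappa> unfolding z_def by (intro mult_left_mono) auto
        also have "\<dots> \<le> norm1 v" by (rule e1)
        finally have 1: "(1 - \<epsilon>) * M * norm2 v \<le> norm1 v" .
        have "norm1 v \<le> (1 + \<eta>) * \<kappa>1 * norm12 (n ^ r) b ?x" by (rule e1)
        also have "\<dots> \<le> (1 + \<eta>) * \<kappa>1 * (real n ^ q * z)"
          using hi \<eta> \<kappa> unfolding z_def by (intro mult_left_mono) auto
        \<comment> \<open>A factor 1 - \<eta> is split off because the available comparison is (1 -
          \<eta>) \<kappa>1 \<le> \<kappa> \<kappa>2.\<close>
        also have "\<dots> \<le> ((1 + \<epsilon>) * (1 - \<eta>)) * \<kappa>1 * (real n ^ q * z)"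
        proof (intro mult_right_mono)
          have "3 * \<eta> \<le> \<epsilon>" using \<eta>r \<eta> mult_left_mono[of 3 "real r + 3" \<eta>] by simp
          moreover have "\<epsilon> * \<eta> \<le> 1 * \<eta>" using \<epsilon> \<eta> by (intro mult_right_mono) auto
          ultimately show "1 + \<eta> \<le> (1 + \<epsilon>) * (1 - \<eta>)" by (simp add: algebra_simps)
        qed (use \<kappa> z0 in auto)
        also have "\<dots> = (1 + \<epsilon>) * (((1 - \<eta>) * \<kappa>1) * (real n ^ q * z))" by simp
        also have "\<dots> \<le> (1 + \<epsilon>) * ((\<kappa> * \<kappa>2) * (real n ^ q * z))"
          using \<epsilon> z0 \<kappa>1b by (intro mult_left_mono mult_right_mono) auto
        also have "\<dots> = (1 + \<epsilon>) * M * norm2 v" by (simp add: M_def e2 z_def)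
        finally show ?thesis using 1 by simp
      qed
      have "98 / 100 < 1 - avg L (\<lambda>bs. of_bool (\<not> spread (1 - \<eta>) n B k (a bs)))"
        using rand[OF k7 L] by (simp add: n_def a_def)
      also have "\<dots> \<le> measure_pmf.prob (pmf_of_set (bit_strings L))
          {bs. \<forall>x\<in>E bs. (1 - \<epsilon>) * M * norm2 x \<le> norm1 x \<and> norm1 x \<le> (1 + \<epsilon>) * M * norm2 x}"
        by (rule measure_ge_avg) (use good in auto)
      finally show ?thesis
        using E dim Mpos unfolding L_def[symmetric]
        by (intro exI[of _ "\<lambda>_. M"] exI[of _ "\<lambda>_. k ^ r"] exI[of _ E]) (auto simp: bit_strings_def)
    qed
  qed
  have "c > 0" using K by (simp add: c_def)
  moreover have "C > 0" by (simp add: C_def add_nonneg_pos)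
  ultimately show ?thesis
    using main by (intro exI[of _ c] conjI exI[of _ C] exI[of _ "output_program aE mE ME \<kappa>q"]
        exI[of _ "output_poly aE mE ME"]) auto
qed

theorem theorem1:
  shows "\<exists>c C :: real \<Rightarrow> real \<Rightarrow> real.
    (\<forall>\<epsilon>\<in>{0<..<1}. \<forall>\<gamma>\<in>{0<..<1}. c \<epsilon> \<gamma> > 0 \<and> C \<epsilon> \<gamma> > 0) \<and>
    (\<forall>\<epsilon>\<in>{0<..<1}. \<forall>\<gamma>\<in>{0<..<1}.
      \<exists>(A :: program) (p :: nat poly). \<forall>N\<ge>1.
        \<exists>(M :: bool list \<Rightarrow> real) (m :: bool list \<Rightarrow> nat) (E :: bool list \<Rightarrow> real vec set).
          (\<forall>bs \<in> bit_strings (num_bits (C \<epsilon> \<gamma>) \<epsilon> \<gamma> N).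
             generates A (poly p N) N bs (M bs) (m bs) (E bs) \<and>
             M bs > 0 \<and> real (m bs) \<ge> c \<epsilon> \<gamma> * real N) \<and>
          measure_pmf.prob (pmf_of_set (bit_strings (num_bits (C \<epsilon> \<gamma>) \<epsilon> \<gamma> N)))
            {bs. \<forall>x\<in>E bs. (1 - \<epsilon>) * M bs * norm2 x \<le> norm1 x \<and>
                           norm1 x \<le> (1 + \<epsilon>) * M bs * norm2 x} > 98 / 100)"
proof -
  define P :: "real \<Rightarrow> real \<Rightarrow> real \<Rightarrow> real \<Rightarrow> bool" where
    "P \<epsilon> \<gamma> c C \<longleftrightarrow> (\<exists>(A :: program) (p :: nat poly). \<forall>N\<ge>1.
        \<exists>(M :: bool list \<Rightarrow> real) (m :: bool list \<Rightarrow> nat) (E :: bool list \<Rightarrow> real vec set).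
          (\<forall>bs \<in> bit_strings (num_bits C \<epsilon> \<gamma> N).
             generates A (poly p N) N bs (M bs) (m bs) (E bs) \<and>
             M bs > 0 \<and> real (m bs) \<ge> c * real N) \<and>
          measure_pmf.prob (pmf_of_set (bit_strings (num_bits C \<epsilon> \<gamma> N)))
            {bs. \<forall>x\<in>E bs. (1 - \<epsilon>) * M bs * norm2 x \<le> norm1 x \<and>
                           norm1 x \<le> (1 + \<epsilon>) * M bs * norm2 x} > 98 / 100)" for \<epsilon> \<gamma> c C
  have ex: "\<exists>c>0. \<exists>C>0. P \<epsilon> \<gamma> c C" if "\<epsilon> \<in> {0<..<1}" "\<gamma> \<in> {0<..<1}" for \<epsilon> \<gamma>
    unfolding P_def by (rule nearly_euclidean_subspaces) (use that in auto)
  \<comment> \<open>\<open>c\<close> is fixed before \<open>C\<close>, which is then chosen to go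
    with this \<open>c\<close>.\<close>
  define c where "c \<epsilon> \<gamma> = (SOME c. c > 0 \<and> (\<exists>C>0. P \<epsilon> \<gamma> c C))" for \<epsilon> \<gamma>
  define C where "C \<epsilon> \<gamma> = (SOME C. C > 0 \<and> P \<epsilon> \<gamma> (c \<epsilon> \<gamma>) C)" for \<epsilon> \<gamma>
  have c: "c \<epsilon> \<gamma> > 0 \<and> (\<exists>C>0. P \<epsilon> \<gamma> (c \<epsilon> \<gamma>) C)" if "\<epsilon> \<in> {0<..<1}" "\<gamma> \<in> {0<..<1}" for \<epsilon> \<gamma>
    unfolding c_def by (rule someI_ex) (use ex[OF that] in blast)
  have C: "C \<epsilon> \<gamma> > 0 \<and> P \<epsilon> \<gamma> (c \<epsilon> \<gamma>) (C \<epsilon> \<gamma>)" if "\<epsilon> \<in> {0<..<1}" "\<gamma> \<in> {0<..<1}" for \<epsilon> \<gamma>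
    unfolding C_def by (rule someI_ex) (use c[OF that] in blast)
  show ?thesis
    by (rule exI[of _ c], rule exI[of _ C], intro conjI ballI)
      (use c C in simp, use c C in simp, use C in \<open>simp only: P_def\<close>)
qed

end
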